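(* Suppose that a six-dimensional real nilpotent Lie algebra $\mathfrak h$ admits a special Lagrangian semi-direct product structure $(\mathfrak h=\mathfrak g\ltimes_\rho V, J,\omega)$. Then $\mathfrak h$ is isomorphic to one of $\mathfrak h_1,\mathfrak h_4,\mathfrak h_7,\mathfrak h_8,\mathfrak h_9,\mathfrak h_{10},\mathfrak h_{11}$. The weak mirror image $(\mathfrak h^\vee,J_\omega,\omega_J)$ of $(\mathfrak h,J,\omega)$ has underlying Lie algebra $\mathfrak h^\vee$ isomorphic, respectively, to $\mathfrak h_1,\mathfrak h_7,\mathfrak h_4,\mathfrak h_8,\mathfrak h_9,\mathfrak h_{10},\mathfrak h_{11}$. In addition: (1) All special Lagrangian semi-direct product structures $(J,\omega)$ on $\mathfrak h_\ell$, $\ell\in\{1,8,9,10\}$, are self-mirror: there is an isomorphism $\mathfrak h_\ell\cong\mathfrak h_\ell^\vee$ and there are quasi-isomorphisms $$\mathrm{DGA}(\mathfrak h_\ell^\vee,\omega_J)\approx\mathrm{DGA}(\mathfrak h_\ell,\omega)\approx\mathrm{DGA}(\mathfrak h_\ell^\vee,J_\omega)\approx\mathrm{DGA}(\mathfrak h_\ell,J).$$ (2) The algebras $\mathfrak h_7$ and $\mathfrak h_4$ form a mirror pair of special Lagrangian semi-direct products. (3) The mirror of a special Lagrangian semi-direct product structure on $\mathfrak h_{11}$ is again a special Lagrangian semi-direct product structure on $\mathfrak h_{11}$, but the two pseudo-Kähler structures are not equivalent.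
   Context: Lie algebra names. A list $(de^1,\dots,de^6)$ denotes the real six-dimensional Lie algebra with a basis $e_1,\dots,e_6$ whose dual basis satisfies these equations, where $ij$ stands for $e^i\wedge e^j$ and $d\alpha(x,y)=-\alpha([x,y])$ is the Chevalley-Eilenberg differential. Up to isomorphism: $\mathfrak h_1$ is abelian; $\mathfrak h_4=(0,0,0,0,13,14-23)$; $\mathfrak h_7=(0,0,0,12,13,-23)$; $\mathfrak h_8=(0,0,0,0,0,-23)$; $\mathfrak h_9=(0,0,0,12,0,14-23)$; $\mathfrak h_{10}=(0,0,0,12,13,14)$; $\mathfrak h_{11}=(0,0,0,12,13,14-23)$. Semi-direct products. For a Lie algebra $\mathfrak g$ and a representation $\rho:\mathfrak g\to\mathrm{End}(V)$, $\mathfrak g\ltimes_\rho V$ is $\mathfrak g\oplus V$ with bracket $[x+u,y+v]=[x,y]+\rho(x)v-\rho(y)u$. The dual semi-direct product is $\mathfrak h^\vee=\mathfrak g\ltimes_{\rho^*}V^*$ with $(\rho^*(x)a)(u)=-a(\rho(x)u)$. Structures. A complex structure $J$ ($J^2=-1$) is integrable if $[x,y]-[Jx,Jy]+J([x,Jy]+[Jx,y])=0$ for all $x,y$. A pseudo-Kähler structure is a pair $(\omega,J)$ with $\omega$ a symplectic form (closed non-degenerate 2-form), $J$ an integrable complex structure and $\omega(J\xi,J\eta)=\omega(\xi,\eta)$. It is a special Lagrangian structure on the semi-direct product $\mathfrak h=\mathfrak g\ltimes_\rho V$ if $J\mathfrak g=V$ and $\mathfrak g$ and $V$ are both Lagrangian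 for $\omega$. Its mirror image is $(\mathfrak h^\vee,J_\omega,\omega_J)$, where for $x,y\in\mathfrak g$, $u,v\in V^*$: $\omega_J(x+u,y+v)=v(Jx)-u(Jy)$ and $J_\omega(x+u)=-\omega^{-1}(u)+\omega(x)$, with $\omega(x)=\omega(x,\cdot)|_V$ giving the isomorphism $\omega:\mathfrak g\to V^*$. This is a special Lagrangian structure on $\mathfrak h^\vee$. Two pseudo-Kähler Lie algebras are equivalent if there is a Lie algebra isomorphism between them intertwining the complex structures and pulling back one symplectic form to the other. A pair $(\mathfrak h,J)$, $(\mathfrak k,\omega)$ is a weak mirror pair if $\mathrm{DGA}(\mathfrak h,J)$ and $\mathrm{DGA}(\mathfrak k,\omega)$ are quasi-isomorphic. DGAs. $\mathrm{DGA}(\mathfrak h,J)$: let $\mathfrak h^{(1,0)},\mathfrak h^{(0,1)}\subset\mathfrak h_{\mathbb C}$ be the $\pm i$-eigenspaces of $J$, and $\mathfrak h^{*(1,0)},\mathfrak h^{*(0,1)}\subset\mathfrak h^*_{\mathbb C}$ the annihilators of $\mathfrak h^{(0,1)}$ and $\mathfrak h^{(1,0)}$ respectively. Put $\mathfrak f^1=\mathfrak h^{(1,0)}\oplus\mathfrak h^{*(0,1)}$ and $\overline{\mathfrak f}^1=\mathfrak h^{(0,1)}\oplus\mathfrak h^{*(1,0)}$, complex Lie algebras under the Schouten bracket $[x+\alpha\bullet y+\beta]=[x,y]+\iota_xd\beta-\iota_yd\alpha$. The natural pairing $\langle x+\alpha,y+\beta\rangle=\alpha(y)+\beta(x)$ identifies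 $(\overline{\mathfrak f}^1)^*\cong\mathfrak f^1$, so the Chevalley-Eilenberg differential of $\overline{\mathfrak f}^1$ becomes a differential $\bar\partial$ on $\wedge^\bullet\mathfrak f^1$; $\mathrm{DGA}(\mathfrak h,J)=(\wedge^\bullet\mathfrak f^1,[-\bullet-],\wedge,\bar\partial)$ with the bracket extended as a Gerstenhaber bracket (graded biderivation). $\mathrm{DGA}(\mathfrak k,\omega)$ is the complexification of $(\wedge^\bullet\mathfrak k^*,[-\bullet-]_\omega,\wedge,d)$, where $[\alpha\bullet\beta]_\omega=\omega([\omega^{-1}\alpha,\omega^{-1}\beta])$ on $\mathfrak k^*$ via $\omega:\mathfrak k\to\mathfrak k^*$, $x\mapsto\omega(x,\cdot)$, extended as a Gerstenhaber bracket, and $d$ is the Chevalley-Eilenberg differential. A quasi-isomorphism is a homomorphism of differential Gerstenhaber algebras (respecting degree, wedge product, bracket and differential) inducing an isomorphism on cohomology; $\approx$ denotes the existence of quasi-isomorphisms. *)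

theory Defs
  imports "HOL-Analysis.Analysis" "HOL-Library.Function_Algebras"
begin

section \<open>Real Lie algebras and semi-direct products\<close>

definition lie_algebra :: "('a::real_vector \<Rightarrow> 'a \<Rightarrow> 'a) \<Rightarrow> bool" where
  "lie_algebra br \<longleftrightarrow> bilinear br \<and> (\<forall>x. br x x = 0) \<and>
     (\<forall>x y z. br x (br y z) + br y (br z x) + br z (br x y) = 0)"

definition lie_isomorphism ::
  "('a::real_vector \<Rightarrow> 'a \<Rightarrow> 'a) \<Rightarrow> ('b::real_vector \<Rightarrow> 'b \<Rightarrow> 'b) \<Rightarrow> ('a \<Rightarrow> 'b) \<Rightarrow> bool" where
  "lie_isomorphism br br' f \<longleftrightarrow> linear f \<and> bij f \<and> (\<forall>x y. f (br x y) = br' (f x) (f y))"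

definition lie_isomorphic ::
  "('a::real_vector \<Rightarrow> 'a \<Rightarrow> 'a) \<Rightarrow> ('b::real_vector \<Rightarrow> 'b \<Rightarrow> 'b) \<Rightarrow> bool" where
  "lie_isomorphic br br' \<longleftrightarrow> (\<exists>f. lie_isomorphism br br' f)"

primrec lower_central :: "('a::real_vector \<Rightarrow> 'a \<Rightarrow> 'a) \<Rightarrow> nat \<Rightarrow> 'a set" where
  "lower_central br 0 = UNIV"
| "lower_central br (Suc n) = span {br x y | x y. y \<in> lower_central br n}"

definition nilpotent_lie :: "('a::real_vector \<Rightarrow> 'a \<Rightarrow> 'a) \<Rightarrow> bool" where
  "nilpotent_lie br \<longleftrightarrow> (\<exists>n. lower_central br n = {0})"

definition lie_representation ::
  "('g::real_vector \<Rightarrow> 'g \<Rightarrow> 'g) \<Rightarrow> ('g \<Rightarrow> 'v::real_vector \<Rightarrow> 'v) \<Rightarrow> bool" where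
  "lie_representation br \<rho> \<longleftrightarrow> bilinear \<rho> \<and>
     (\<forall>x y v. \<rho> (br x y) v = \<rho> x (\<rho> y v) - \<rho> y (\<rho> x v))"

fun semidirect ::
  "('g::real_vector \<Rightarrow> 'g \<Rightarrow> 'g) \<Rightarrow> ('g \<Rightarrow> 'v::real_vector \<Rightarrow> 'v) \<Rightarrow> 'g \<times> 'v \<Rightarrow> 'g \<times> 'v \<Rightarrow> 'g \<times> 'v"
where
  "semidirect br \<rho> (x, u) (y, v) = (br x y, \<rho> x v - \<rho> y u)"

typedef (overloaded) 'v dual = "{f :: 'v::real_vector \<Rightarrow> real. linear f}"
  morphisms dual_apply Dual
proof
  show "(\<lambda>_. 0) \<in> {f :: 'v \<Rightarrow> real. linear f}" by (simp add: linear_iff)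
qed

setup_lifting type_definition_dual

instantiation dual :: (real_vector) real_vector
begin

lift_definition zero_dual :: "'a dual" is "\<lambda>_. 0"
  by (simp add: linear_iff)

lift_definition plus_dual :: "'a dual \<Rightarrow> 'a dual \<Rightarrow> 'a dual" is "\<lambda>f g x. f x + g x"
  by (rule linear_compose_add)

lift_definition minus_dual :: "'a dual \<Rightarrow> 'a dual \<Rightarrow> 'a dual" is "\<lambda>f g x. f x - g x"
  by (rule linear_compose_sub)

lift_definition uminus_dual :: "'a dual \<Rightarrow> 'a dual" is "\<lambda>f x. - f x"
  by (rule linear_compose_neg)

lift_definition scaleR_dual :: "real \<Rightarrow> 'a dual \<Rightarrow> 'a dual" is "\<lambda>c f x. c *\<^sub>R f x"
  by (rule linear_compose_scale_right)

instance
  by standard (transfer; simp add: fun_eq_iff algebra_simps)+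

end

definition dual_rep :: "('g \<Rightarrow> 'v::real_vector \<Rightarrow> 'v) \<Rightarrow> 'g \<Rightarrow> 'v dual \<Rightarrow> 'v dual" where
  "dual_rep \<rho> x a = Dual (\<lambda>u. - dual_apply a (\<rho> x u))"


section \<open>Special Lagrangian structures and their mirror images\<close>

text \<open>The last conjunct says that \<open>\<omega>\<close> is closed for the Chevalley-Eilenberg differential.\<close>

definition symplectic ::
  "('a::real_vector \<Rightarrow> 'a \<Rightarrow> 'a) \<Rightarrow> ('a \<Rightarrow> 'a \<Rightarrow> real) \<Rightarrow> bool" where
  "symplectic br \<omega> \<longleftrightarrow> bilinear \<omega> \<and> (\<forall>x. \<omega> x x = 0) \<and>
     (\<forall>x. (\<forall>y. \<omega> x y = 0) \<longrightarrow> x = 0) \<and>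
     (\<forall>x y z. \<omega> (br x y) z + \<omega> (br y z) x + \<omega> (br z x) y = 0)"

definition integrable_complex_structure ::
  "('a::real_vector \<Rightarrow> 'a \<Rightarrow> 'a) \<Rightarrow> ('a \<Rightarrow> 'a) \<Rightarrow> bool" where
  "integrable_complex_structure br J \<longleftrightarrow> linear J \<and> (\<forall>x. J (J x) = - x) \<and>
     (\<forall>x y. br x y - br (J x) (J y) + J (br x (J y) + br (J x) y) = 0)"

definition pseudo_kaehler ::
  "('a::real_vector \<Rightarrow> 'a \<Rightarrow> 'a) \<Rightarrow> ('a \<Rightarrow> 'a) \<Rightarrow> ('a \<Rightarrow> 'a \<Rightarrow> real) \<Rightarrow> bool" where
  "pseudo_kaehler br J \<omega> \<longleftrightarrow> symplectic br \<omega> \<and> integrable_complex_structure br J \<and>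
     (\<forall>x y. \<omega> (J x) (J y) = \<omega> x y)"

definition lagrangian :: "('a \<Rightarrow> 'a \<Rightarrow> real) \<Rightarrow> 'a set \<Rightarrow> bool" where
  "lagrangian \<omega> W \<longleftrightarrow> {x. \<forall>y\<in>W. \<omega> x y = 0} = W"

definition special_lagrangian ::
  "('g::real_vector \<Rightarrow> 'g \<Rightarrow> 'g) \<Rightarrow> ('g \<Rightarrow> 'v::real_vector \<Rightarrow> 'v) \<Rightarrow>
   ('g \<times> 'v \<Rightarrow> 'g \<times> 'v) \<Rightarrow> ('g \<times> 'v \<Rightarrow> 'g \<times> 'v \<Rightarrow> real) \<Rightarrow> bool" where
  "special_lagrangian br \<rho> J \<omega> \<longleftrightarrow>
     lie_algebra br \<and> lie_representation br \<rho> \<and>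
     pseudo_kaehler (semidirect br \<rho>) J \<omega> \<and>
     J ` (UNIV \<times> {0}) = {0} \<times> UNIV \<and>
     lagrangian \<omega> (UNIV \<times> {0}) \<and> lagrangian \<omega> ({0} \<times> UNIV)"

definition omega_iso :: "('g \<times> 'v \<Rightarrow> 'g \<times> 'v \<Rightarrow> real) \<Rightarrow> 'g::real_vector \<Rightarrow> 'v::real_vector dual" where
  "omega_iso \<omega> x = Dual (\<lambda>v. \<omega> (x, 0) (0, v))"

fun mirror_J ::
  "('g::real_vector \<times> 'v::real_vector \<Rightarrow> 'g \<times> 'v \<Rightarrow> real) \<Rightarrow> 'g \<times> 'v dual \<Rightarrow> 'g \<times> 'v dual" where
  "mirror_J \<omega> (x, u) = (- inv (omega_iso \<omega>) u, omega_iso \<omega> x)"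

fun mirror_omega ::
  "('g::real_vector \<times> 'v::real_vector \<Rightarrow> 'g \<times> 'v) \<Rightarrow> 'g \<times> 'v dual \<Rightarrow> 'g \<times> 'v dual \<Rightarrow> real" where
  "mirror_omega J (x, u) (y, v) = dual_apply v (snd (J (x, 0))) - dual_apply u (snd (J (y, 0)))"

definition pseudo_kaehler_equivalent ::
  "('a::real_vector \<Rightarrow> 'a \<Rightarrow> 'a) \<Rightarrow> ('a \<Rightarrow> 'a) \<Rightarrow> ('a \<Rightarrow> 'a \<Rightarrow> real) \<Rightarrow>
   ('b::real_vector \<Rightarrow> 'b \<Rightarrow> 'b) \<Rightarrow> ('b \<Rightarrow> 'b) \<Rightarrow> ('b \<Rightarrow> 'b \<Rightarrow> real) \<Rightarrow> bool" where
  "pseudo_kaehler_equivalent br J \<omega> br' J' \<omega>' \<longleftrightarrow>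
     (\<exists>f. lie_isomorphism br br' f \<and> (\<forall>x. f (J x) = J' (f x)) \<and>
          (\<forall>x y. \<omega>' (f x) (f y) = \<omega> x y))"


section \<open>Differential Gerstenhaber algebras\<close>

record 'a dga =
  dga_carrier :: "'a set"
  dga_scale :: "complex \<Rightarrow> 'a \<Rightarrow> 'a"
  dga_homog :: "nat \<Rightarrow> 'a set"
  dga_wedge :: "'a \<Rightarrow> 'a \<Rightarrow> 'a"
  dga_bracket :: "'a \<Rightarrow> 'a \<Rightarrow> 'a"
  dga_diff :: "'a \<Rightarrow> 'a"

definition dga_hom :: "'a::ab_group_add dga \<Rightarrow> 'b::ab_group_add dga \<Rightarrow> ('a \<Rightarrow> 'b) \<Rightarrow> bool" where
  "dga_hom A B \<phi> \<longleftrightarrow>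
     (\<forall>a\<in>dga_carrier A. \<phi> a \<in> dga_carrier B \<and>
        (\<forall>c. \<phi> (dga_scale A c a) = dga_scale B c (\<phi> a)) \<and>
        \<phi> (dga_diff A a) = dga_diff B (\<phi> a)) \<and>
     (\<forall>n. \<forall>a\<in>dga_homog A n. \<phi> a \<in> dga_homog B n) \<and>
     (\<forall>a\<in>dga_carrier A. \<forall>b\<in>dga_carrier A.
        \<phi> (a + b) = \<phi> a + \<phi> b \<and>
        \<phi> (dga_wedge A a b) = dga_wedge B (\<phi> a) (\<phi> b) \<and>
        \<phi> (dga_bracket A a b) = dga_bracket B (\<phi> a) (\<phi> b))"

definition cocycles :: "'a::ab_group_add dga \<Rightarrow> 'a set" where
  "cocycles A = {a \<in> dga_carrier A. dga_diff A a = 0}"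

definition cohomologous :: "'a::ab_group_add dga \<Rightarrow> ('a \<times> 'a) set" where
  "cohomologous A = {(a, b). a \<in> cocycles A \<and> b \<in> cocycles A \<and> a - b \<in> dga_diff A ` dga_carrier A}"

definition cohomology :: "'a::ab_group_add dga \<Rightarrow> 'a set set" where
  "cohomology A = cocycles A // cohomologous A"

text \<open>\<open>cohomologous B `` (\<phi> ` X)\<close> is the image of the class \<open>X\<close> under the induced map.\<close>

definition quasi_isomorphism :: "'a::ab_group_add dga \<Rightarrow> 'b::ab_group_add dga \<Rightarrow> ('a \<Rightarrow> 'b) \<Rightarrow> bool" where
  "quasi_isomorphism A B \<phi> \<longleftrightarrow> dga_hom A B \<phi> \<and>
     bij_betw (\<lambda>X. cohomologous B `` (\<phi> ` X)) (cohomology A) (cohomology B)"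

definition quasi_isomorphic :: "'a::ab_group_add dga \<Rightarrow> 'b::ab_group_add dga \<Rightarrow> bool" (infix \<open>\<approx>\<close> 50) where
  "A \<approx> B \<longleftrightarrow> (\<exists>\<phi>. quasi_isomorphism A B \<phi>)"


subsection \<open>The exterior algebra of the dual of a complex Lie algebra\<close>

text \<open>
  \<open>L\<close> is a complex subspace of a type with scalar multiplication \<open>sc\<close>. An element of the exterior
  algebra of the dual of \<open>L\<close> is encoded as one function \<open>A\<close> on lists, whose restriction to the
  lists of length \<open>p\<close> in \<open>L\<close> is the alternating \<open>p\<close>-form that is its component of degree \<open>p\<close>;
  \<open>A\<close> is \<open>0\<close> on lists that leave \<open>L\<close>. For \<open>L\<close> of finite dimension \<open>n\<close> the components of degree
  above \<open>n\<close> vanish automatically.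
\<close>

type_synonym 'l forms = "'l list \<Rightarrow> complex"

definition alt_forms :: "'l::ab_group_add set \<Rightarrow> (complex \<Rightarrow> 'l \<Rightarrow> 'l) \<Rightarrow> 'l forms set" where
  "alt_forms L sc = {A.
     (\<forall>xs. \<not> set xs \<subseteq> L \<longrightarrow> A xs = 0) \<and>
     (\<forall>xs ys. \<forall>x\<in>L. \<forall>y\<in>L. set xs \<subseteq> L \<longrightarrow> set ys \<subseteq> L \<longrightarrow>
        A (xs @ (x + y) # ys) = A (xs @ x # ys) + A (xs @ y # ys)) \<and>
     (\<forall>xs ys c. \<forall>x\<in>L. set xs \<subseteq> L \<longrightarrow> set ys \<subseteq> L \<longrightarrow>
        A (xs @ sc c x # ys) = c * A (xs @ x # ys)) \<and>
     (\<forall>xs ys zs x. A (xs @ x # ys @ x # zs) = 0)}"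

definition homog_forms :: "'l::ab_group_add set \<Rightarrow> (complex \<Rightarrow> 'l \<Rightarrow> 'l) \<Rightarrow> nat \<Rightarrow> 'l forms set" where
  "homog_forms L sc n = {A \<in> alt_forms L sc. \<forall>xs. length xs \<noteq> n \<longrightarrow> A xs = 0}"

definition scale_form :: "complex \<Rightarrow> 'l forms \<Rightarrow> 'l forms" where
  "scale_form c A = (\<lambda>xs. c * A xs)"

text \<open>
  Shuffle product: \<open>S\<close> is the set of positions fed to \<open>A\<close>, and the exponent counts the inversions
  of the corresponding shuffle; so \<open>(\<alpha> \<and> \<beta>)(x, y) = \<alpha>(x) \<beta>(y) - \<alpha>(y) \<beta>(x)\<close> in degree one.
\<close>

definition wedge :: "'l forms \<Rightarrow> 'l forms \<Rightarrow> 'l forms" where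
  "wedge A B = (\<lambda>xs. \<Sum>S\<in>Pow {..<length xs}.
     (-1) ^ card {(i, j). i < j \<and> j < length xs \<and> i \<notin> S \<and> j \<in> S} * A (nths xs S) * B (nths xs (- S)))"

definition ce_diff :: "'l set \<Rightarrow> ('l \<Rightarrow> 'l \<Rightarrow> 'l) \<Rightarrow> 'l forms \<Rightarrow> 'l forms" where
  "ce_diff L lb A = (\<lambda>xs. if set xs \<subseteq> L
     then \<Sum>(i, j)\<in>{(i, j). i < j \<and> j < length xs}.
            (-1) ^ (i + j) * A (lb (xs ! i) (xs ! j) # nths xs (- {i, j}))
     else 0)"

definition one_form :: "('l \<Rightarrow> complex) \<Rightarrow> 'l forms" where
  "one_form \<alpha> = (\<lambda>xs. case xs of [x] \<Rightarrow> \<alpha> x | _ \<Rightarrow> 0)"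

text \<open>
  \<open>B\<close> is a Gerstenhaber bracket on the forms on \<open>L\<close> that restricts, in degree one, to the Lie
  bracket \<open>wb\<close> of \<open>W\<close> carried over by the identification \<open>\<iota>\<close> of \<open>W\<close> with the dual of \<open>L\<close>. Since the
  exterior algebra is generated in degree one, these conditions determine \<open>B\<close> on \<open>alt_forms L sc\<close>,
  and the graded Jacobi identity follows from that of \<open>wb\<close>.
\<close>

definition gerstenhaber_extension ::
  "'l::ab_group_add set \<Rightarrow> (complex \<Rightarrow> 'l \<Rightarrow> 'l) \<Rightarrow> 'w set \<Rightarrow> ('w \<Rightarrow> 'w \<Rightarrow> 'w) \<Rightarrow> ('w \<Rightarrow> 'l \<Rightarrow> complex) \<Rightarrow>
   ('l forms \<Rightarrow> 'l forms \<Rightarrow> 'l forms) \<Rightarrow> bool" where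
  "gerstenhaber_extension L sc W wb \<iota> B \<longleftrightarrow>
     (\<forall>F\<in>W. \<forall>G\<in>W. B (one_form (\<iota> F)) (one_form (\<iota> G)) = one_form (\<iota> (wb F G))) \<and>
     (\<forall>a\<in>alt_forms L sc. \<forall>b\<in>alt_forms L sc. \<forall>c\<in>alt_forms L sc. \<forall>k.
        B a (b + c) = B a b + B a c \<and> B (a + b) c = B a c + B b c \<and>
        B (scale_form k a) b = scale_form k (B a b) \<and> B a (scale_form k b) = scale_form k (B a b)) \<and>
     (\<forall>p q. \<forall>a\<in>homog_forms L sc p. \<forall>b\<in>homog_forms L sc q.
        (if p + q = 0 then B a b = 0 else B a b \<in> homog_forms L sc (p + q - 1)) \<and>
        B a b = - scale_form ((-1) ^ ((p + 1) * (q + 1))) (B b a) \<and>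
        (\<forall>c\<in>alt_forms L sc.
           B a (wedge b c) = wedge (B a b) c + scale_form ((-1) ^ ((p + 1) * q)) (wedge b (B a c))))"

definition exterior_dga ::
  "'l::ab_group_add set \<Rightarrow> (complex \<Rightarrow> 'l \<Rightarrow> 'l) \<Rightarrow> ('l \<Rightarrow> 'l \<Rightarrow> 'l) \<Rightarrow>
   'w set \<Rightarrow> ('w \<Rightarrow> 'w \<Rightarrow> 'w) \<Rightarrow> ('w \<Rightarrow> 'l \<Rightarrow> complex) \<Rightarrow> 'l forms dga" where
  "exterior_dga L sc lb W wb \<iota> =
     \<lparr> dga_carrier = alt_forms L sc, dga_scale = scale_form, dga_homog = homog_forms L sc,
       dga_wedge = wedge, dga_bracket = (SOME B. gerstenhaber_extension L sc W wb \<iota> B),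
       dga_diff = ce_diff L lb \<rparr>"


subsection \<open>Complexification\<close>

text \<open>The pair \<open>(x, y)\<close> stands for \<open>x + i y\<close>.\<close>

type_synonym 'a cpx = "'a \<times> 'a"

fun cpx_scale :: "complex \<Rightarrow> 'a::real_vector cpx \<Rightarrow> 'a cpx" where
  "cpx_scale c (x, y) = (Re c *\<^sub>R x - Im c *\<^sub>R y, Re c *\<^sub>R y + Im c *\<^sub>R x)"

fun cpx_bracket :: "('a::real_vector \<Rightarrow> 'a \<Rightarrow> 'a) \<Rightarrow> 'a cpx \<Rightarrow> 'a cpx \<Rightarrow> 'a cpx" where
  "cpx_bracket br (x, y) (x', y') = (br x x' - br y y', br x y' + br y x')"

fun cpx_form :: "('a \<Rightarrow> 'a \<Rightarrow> real) \<Rightarrow> 'a cpx \<Rightarrow> 'a cpx \<Rightarrow> complex" where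
  "cpx_form \<omega> (x, y) (x', y') = Complex (\<omega> x x' - \<omega> y y') (\<omega> x y' + \<omega> y x')"

definition cpx_dual :: "('a::real_vector cpx \<Rightarrow> complex) set" where
  "cpx_dual = {\<alpha>. Vector_Spaces.linear cpx_scale (*) \<alpha>}"


subsection \<open>The DGA of a complex structure\<close>

definition holo :: "('a::real_vector \<Rightarrow> 'a) \<Rightarrow> 'a cpx set" where
  "holo J = {z. map_prod J J z = cpx_scale \<i> z}"

definition antiholo :: "('a::real_vector \<Rightarrow> 'a) \<Rightarrow> 'a cpx set" where
  "antiholo J = {z. map_prod J J z = cpx_scale (- \<i>) z}"

definition holo_dual :: "('a::real_vector \<Rightarrow> 'a) \<Rightarrow> ('a cpx \<Rightarrow> complex) set" where
  "holo_dual J = {\<alpha> \<in> cpx_dual. \<forall>z\<in>antiholo J. \<alpha> z = 0}"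

definition antiholo_dual :: "('a::real_vector \<Rightarrow> 'a) \<Rightarrow> ('a cpx \<Rightarrow> complex) set" where
  "antiholo_dual J = {\<alpha> \<in> cpx_dual. \<forall>z\<in>holo J. \<alpha> z = 0}"

type_synonym 'a gtangent = "'a cpx \<times> ('a cpx \<Rightarrow> complex)"

definition f1 :: "('a::real_vector \<Rightarrow> 'a) \<Rightarrow> 'a gtangent set" where
  "f1 J = holo J \<times> antiholo_dual J"

definition f1_bar :: "('a::real_vector \<Rightarrow> 'a) \<Rightarrow> 'a gtangent set" where
  "f1_bar J = antiholo J \<times> holo_dual J"

fun gt_scale :: "complex \<Rightarrow> 'a::real_vector gtangent \<Rightarrow> 'a gtangent" where
  "gt_scale c (x, \<alpha>) = (cpx_scale c x, \<lambda>z. c * \<alpha> z)"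

definition d_one :: "('a::real_vector \<Rightarrow> 'a \<Rightarrow> 'a) \<Rightarrow> ('a cpx \<Rightarrow> complex) \<Rightarrow> 'a cpx \<Rightarrow> 'a cpx \<Rightarrow> complex" where
  "d_one br \<alpha> x y = - \<alpha> (cpx_bracket br x y)"

fun schouten :: "('a::real_vector \<Rightarrow> 'a \<Rightarrow> 'a) \<Rightarrow> 'a gtangent \<Rightarrow> 'a gtangent \<Rightarrow> 'a gtangent" where
  "schouten br (x, \<alpha>) (y, \<beta>) = (cpx_bracket br x y, \<lambda>z. d_one br \<beta> x z - d_one br \<alpha> y z)"

fun gt_pairing :: "'a gtangent \<Rightarrow> 'a gtangent \<Rightarrow> complex" where
  "gt_pairing (x, \<alpha>) (y, \<beta>) = \<alpha> y + \<beta> x"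

text \<open>
  The exterior algebra of \<open>f1 J\<close> is realised as the algebra of alternating forms on \<open>f1_bar J\<close>,
  through the isomorphism of \<open>f1 J\<close> with the dual of \<open>f1_bar J\<close> given by the pairing; under this
  identification the differential is by definition the Chevalley-Eilenberg differential of
  \<open>f1_bar J\<close>.
\<close>

definition DGA_complex :: "('a::real_vector \<Rightarrow> 'a \<Rightarrow> 'a) \<Rightarrow> ('a \<Rightarrow> 'a) \<Rightarrow> 'a gtangent forms dga" where
  "DGA_complex br J =
     exterior_dga (f1_bar J) gt_scale (schouten br) (f1 J) (schouten br)
       (\<lambda>F G. if G \<in> f1_bar J then gt_pairing F G else 0)"


subsection \<open>The DGA of a symplectic structure\<close>

definition omega_bracket ::
  "('a::real_vector \<Rightarrow> 'a \<Rightarrow> 'a) \<Rightarrow> ('a \<Rightarrow> 'a \<Rightarrow> real) \<Rightarrow>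
   ('a cpx \<Rightarrow> complex) \<Rightarrow> ('a cpx \<Rightarrow> complex) \<Rightarrow> 'a cpx \<Rightarrow> complex" where
  "omega_bracket br \<omega> \<alpha> \<beta> =
     cpx_form \<omega> (cpx_bracket br (inv (cpx_form \<omega>) \<alpha>) (inv (cpx_form \<omega>) \<beta>))"

text \<open>
  The complexification of the exterior algebra of the real dual is taken as the exterior algebra
  of the dual of the complexified Lie algebra, with bracket and differential extended complex
  linearly.
\<close>

definition DGA_symplectic :: "('a::real_vector \<Rightarrow> 'a \<Rightarrow> 'a) \<Rightarrow> ('a \<Rightarrow> 'a \<Rightarrow> real) \<Rightarrow> 'a cpx forms dga" where
  "DGA_symplectic br \<omega> =
     exterior_dga UNIV cpx_scale (cpx_bracket br) cpx_dual (omega_bracket br \<omega>) (\<lambda>\<alpha>. \<alpha>)"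

definition weak_mirror_pair ::
  "('a::real_vector \<Rightarrow> 'a \<Rightarrow> 'a) \<Rightarrow> ('a \<Rightarrow> 'a) \<Rightarrow> ('b::real_vector \<Rightarrow> 'b \<Rightarrow> 'b) \<Rightarrow> ('b \<Rightarrow> 'b \<Rightarrow> real) \<Rightarrow> bool" where
  "weak_mirror_pair br J br' \<omega> \<longleftrightarrow> DGA_complex br J \<approx> DGA_symplectic br' \<omega>"


section \<open>The six-dimensional nilpotent Lie algebras\<close>

text \<open>\<open>e2 i j\<close> is the 2-form \<open>e\<^sup>i \<and> e\<^sup>j\<close>; the type \<open>6\<close> has the elements \<open>1, 2, 3, 4, 5, 6 = 0\<close>.\<close>

definition e2 :: "6 \<Rightarrow> 6 \<Rightarrow> real^6 \<Rightarrow> real^6 \<Rightarrow> real" where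
  "e2 i j x y = x $ i * y $ j - x $ j * y $ i"

text \<open>The Lie algebra \<open>(de\<^sup>1, \<dots>, de\<^sup>6)\<close>: the \<open>k\<close>-th component of \<open>[x, y]\<close> is \<open>- de\<^sup>k(x, y)\<close>.\<close>

definition from_equations :: "(real^6 \<Rightarrow> real^6 \<Rightarrow> real) list \<Rightarrow> real^6 \<Rightarrow> real^6 \<Rightarrow> real^6" where
  "from_equations D x y = (\<Sum>k = 1..6. - (D ! (k - 1)) x y *\<^sub>R axis (of_nat k) 1)"

definition "\<hh>\<^sub>1 = from_equations [0, 0, 0, 0, 0, 0]"
definition "\<hh>\<^sub>4 = from_equations [0, 0, 0, 0, e2 1 3, e2 1 4 - e2 2 3]"
definition "\<hh>\<^sub>7 = from_equations [0, 0, 0, e2 1 2, e2 1 3, - e2 2 3]"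
definition "\<hh>\<^sub>8 = from_equations [0, 0, 0, 0, 0, - e2 2 3]"
definition "\<hh>\<^sub>9 = from_equations [0, 0, 0, e2 1 2, 0, e2 1 4 - e2 2 3]"
definition "\<hh>\<^sub>1\<^sub>0 = from_equations [0, 0, 0, e2 1 2, e2 1 3, e2 1 4]"
definition "\<hh>\<^sub>1\<^sub>1 = from_equations [0, 0, 0, e2 1 2, e2 1 3, e2 1 4 - e2 2 3]"

end

theory Submission
  imports Defs
begin

text \<open>
  Let \<open>J\<close> identify \<open>V\<close> with \<open>\<gg>\<close>. Integrability makes \<open>\<rho>\<close> a left-symmetric product \<open>x y\<close> on \<open>\<gg>\<close> with
  \<open>[x, y] = x y - y x\<close>, and \<open>B(x, y) = \<omega>(x, J y)\<close> is a Hessian metric: it is symmetric, non-degenerate and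
  satisfies \<open>B([x, y], z) = B(x, y z) - B(y, x z)\<close>. In these terms the mirror keeps \<open>B\<close> and replaces the product by
  the dual one, \<open>B(x \<circ> y, z) = - B(y, x z)\<close>. The algebra \<open>\<ff>\<^sup>1\<close> of the complex structure and its conjugate are
  both isomorphic to the complexified \<open>\<hh>\<^sup>\<or>\<close>, and their pairing becomes the mirror symplectic form, whence the
  weak mirror pairs.

  By nilpotency the product is either zero or has the normal form \<open>v\<^sub>1 v\<^sub>1 = a v\<^sub>2 + k v\<^sub>3\<close>, \<open>v\<^sub>1 v\<^sub>2 = b v\<^sub>3\<close>,
  \<open>v\<^sub>2 v\<^sub>1 = c v\<^sub>3\<close>, where \<open>v\<^sub>3\<close> is null and orthogonal to \<open>v\<^sub>2\<close>; duality replaces \<open>(b, c)\<close> by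
  \<open>(b - 2 c, - c)\<close>. The Lie algebra depends only on which of \<open>a\<close>, \<open>b\<close>, \<open>c\<close>, \<open>b - c\<close> vanish. The ratio
  \<open>b / c\<close>, replaced by \<open>2 - b / c\<close> in the mirror, is an invariant of the complex structure on \<open>\<hh>\<^sub>1\<^sub>1\<close>, where
  \<open>b \<noteq> c\<close>; in the self-mirror cases there is an explicit isometry exchanging the two products.
\<close>


section \<open>The exterior algebra\<close>

text \<open>The bracket of \<open>exterior_dga\<close> is picked by \<open>SOME\<close>, so two of
  these algebras can be compared only after Gerstenhaber extensions are known to exist and to be
  unique on alternating forms; both facts come from a finite basis. Every quasi-isomorphism obtained
  is an isomorphism. Dualising a product twice gives it back, so the complex algebra of either
  structure is the symplectic algebra of the other, and self-mirror symmetry needs only a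
  symplectomorphism between the two. In the normal form, closedness gives
  \<open>(2 * c - b) * B v1 v3 = a * B v2 v2\<close>; hence \<open>a\<close> vanishes exactly when
  \<open>b = 2 * c\<close>, and its mirror value exactly when \<open>b = 0\<close>. The reflection t
  -> 2 - t of the ratio t = b / c fixes 1 (\<open>\<hh>\<^sub>9\<close>) and infinity
  (\<open>\<hh>\<^sub>1\<^sub>0\<close>), exchanges 2 (\<open>\<hh>\<^sub>4\<close>) with 0
  (\<open>\<hh>\<^sub>7\<close>) and moves every other value, all of which belong to
  \<open>\<hh>\<^sub>1\<^sub>1\<close>; \<open>b = c = 0\<close> leaves \<open>\<hh>\<^sub>1\<close>
  and \<open>\<hh>\<^sub>8\<close>.\<close>

definition contract :: "'l \<Rightarrow> 'l forms \<Rightarrow> 'l forms" where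
  "contract x A = (\<lambda>xs. A (x # xs))"

text \<open>The parity automorphism of the grading. It holds the sign of the antiderivation rule for
  \<open>contract\<close>, so that this rule can be stated without homogeneous components.\<close>

definition bar_form :: "'l forms \<Rightarrow> 'l forms" where
  "bar_form A = (\<lambda>xs. (-1) ^ length xs * A xs)"

lemma wedge_Nil: "wedge A B [] = A [] * B []"
  by (simp add: wedge_def)

text \<open>Shuffles of \<open>x # xs\<close> either hand \<open>x\<close> to the first factor or to
  the second.\<close>

lemma Pow_lessThan_Suc_split:
  "Pow {..<Suc n} = (\<lambda>S. insert 0 (Suc ` S)) ` Pow {..<n} \<union> (\<lambda>S. Suc ` S) ` Pow {..<n}"
  (is "?L = ?R")
proof -
  have "Pow {..<Suc n} = Pow (insert 0 (Suc ` {..<n}))"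
    by (simp add: lessThan_Suc_eq_insert_0)
  also have "\<dots> = Pow (Suc ` {..<n}) \<union> insert 0 ` Pow (Suc ` {..<n})"
    by (rule Pow_insert)
  also have "Pow (Suc ` {..<n}) = (\<lambda>S. Suc ` S) ` Pow {..<n}"
    by (simp add: image_Pow_surj)
  finally show ?thesis by (auto simp: image_image)
qed

lemma nths_Cons_insert: "nths (x # xs) (insert 0 (Suc ` S)) = x # nths xs S"
  "nths (x # xs) (Suc ` S) = nths xs S"
  "nths (x # xs) (- insert 0 (Suc ` S)) = nths xs (- S)"
  "nths (x # xs) (- Suc ` S) = x # nths xs (- S)"
proof -
  have e: "{j. Suc j \<in> Suc ` S} = S" "{j. Suc j \<in> insert 0 (Suc ` S)} = S"
    "{j. Suc j \<in> - insert 0 (Suc ` S)} = - S" "{j. Suc j \<in> - (Suc ` S)} = - S"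
    by auto
  show "nths (x # xs) (insert 0 (Suc ` S)) = x # nths xs S"
  "nths (x # xs) (Suc ` S) = nths xs S"
  "nths (x # xs) (- insert 0 (Suc ` S)) = nths xs (- S)"
  "nths (x # xs) (- Suc ` S) = x # nths xs (- S)"
    unfolding nths_Cons e by auto
qed

definition inversions :: "nat \<Rightarrow> nat set \<Rightarrow> (nat \<times> nat) set" where
  "inversions n S = {(i, j). i < j \<and> j < n \<and> i \<notin> S \<and> j \<in> S}"

lemma finite_inversions: "finite (inversions n S)"
  by (rule finite_subset[of _ "{..<n} \<times> {..<n}"]) (auto simp: inversions_def)

lemma card_inversions_insert: "card (inversions (Suc n) (insert 0 (Suc ` S))) = card (inversions n S)"
proof -
  have "inversions (Suc n) (insert 0 (Suc ` S)) = map_prod Suc Suc ` inversions n S"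
    (is "?L = ?R")
  proof (intro equalityI subsetI)
    fix p assume "p \<in> ?L"
    then obtain i j where p: "p = (i, j)" "i < j" "j < Suc n" "i \<notin> insert 0 (Suc ` S)"
      "j \<in> insert 0 (Suc ` S)"
      by (auto simp: inversions_def)
    then obtain i' j' where "i = Suc i'" "j = Suc j'"
      by (metis insertI1 not_less_zero old.nat.exhaust)
    with p show "p \<in> ?R" by (auto simp: inversions_def image_iff)
  qed (auto simp: inversions_def)
  moreover have "inj (map_prod Suc Suc)" by (simp add: prod.inj_map)
  ultimately show ?thesis by (metis card_image inj_on_subset subset_UNIV)
qed

text \<open>Position 0, when it goes to the second factor, is inverted with every position in the
  shifted set. The extra sign is the one that \<open>bar_form\<close> produces on the first
  factor.\<close>

lemma card_inversions_Suc:
  assumes "S \<subseteq> {..<n}"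
  shows "card (inversions (Suc n) (Suc ` S)) = card S + card (inversions n S)"
proof -
  have "inversions (Suc n) (Suc ` S) = (\<lambda>j. (0, Suc j)) ` S \<union> map_prod Suc Suc ` inversions n S"
    (is "?L = ?R")
  proof (intro equalityI subsetI)
    fix p assume "p \<in> ?L"
    then obtain i j where p: "p = (i, Suc j)" "i < Suc j" "Suc j < Suc n" "i \<notin> Suc ` S" "j \<in> S"
      by (auto simp: inversions_def)
    then show "p \<in> ?R" by (cases i) (auto simp: inversions_def image_iff)
  qed (use assms in \<open>auto simp: inversions_def\<close>)
  moreover have "finite S" using assms finite_subset by blast
  moreover have "card (map_prod Suc Suc ` inversions n S) = card (inversions n S)"
    by (rule card_image) (meson inj_on_subset inj_Suc prod.inj_map subset_UNIV)
  moreover have "card ((\<lambda>j. (0 :: nat, Suc j)) ` S) = card S"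
    by (rule card_image) (simp add: inj_on_def)
  moreover have "(\<lambda>j. (0, Suc j)) ` S \<inter> map_prod Suc Suc ` inversions n S = {}" by auto
  ultimately show ?thesis by (simp add: card_Un_disjoint finite_inversions)
qed

text \<open>This recursion lets every identity for the shuffle product be proved by induction on the argument list.\<close>

lemma wedge_Cons:
  "wedge A B (x # xs) = wedge (contract x A) B xs + wedge (bar_form A) (contract x B) xs"
proof -
  let ?n = "length xs"
  let ?t = "\<lambda>S. (-1) ^ card (inversions (Suc ?n) S) * A (nths (x # xs) S) * B (nths (x # xs) (- S))"
  have "wedge A B (x # xs) = (\<Sum>S\<in>Pow {..<Suc ?n}. ?t S)"
    by (simp add: wedge_def inversions_def)
  also have "\<dots> = (\<Sum>S\<in>(\<lambda>S. insert 0 (Suc ` S)) ` Pow {..<?n}. ?t S) + (\<Sum>S\<in>(\<lambda>S. Suc ` S) ` Pow {..<?n}. ?t S)"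
    unfolding Pow_lessThan_Suc_split by (rule sum.union_disjoint) auto
  also have "(\<Sum>S\<in>(\<lambda>S. insert 0 (Suc ` S)) ` Pow {..<?n}. ?t S) = (\<Sum>S\<in>Pow {..<?n}. ?t (insert 0 (Suc ` S)))"
    by (rule sum.reindex_cong[of "\<lambda>S. insert 0 (Suc ` S)"]) (auto simp: inj_on_def)
  also have "\<dots> = wedge (contract x A) B xs"
    by (simp add: wedge_def card_inversions_insert nths_Cons_insert contract_def inversions_def[symmetric])
  also have "(\<Sum>S\<in>(\<lambda>S. Suc ` S) ` Pow {..<?n}. ?t S) = (\<Sum>S\<in>Pow {..<?n}. ?t (Suc ` S))"
    by (rule sum.reindex_cong[of "\<lambda>S. Suc ` S"]) (auto simp: inj_on_def)
  also have "\<dots> = wedge (bar_form A) (contract x B) xs"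
    unfolding wedge_def inversions_def[symmetric]
  proof (rule sum.cong)
    fix S assume S: "S \<in> Pow {..<?n}"
    then have "{i. i < ?n \<and> i \<in> S} = S" by auto
    with S show "?t (Suc ` S) = (- 1) ^ card (inversions (length xs) S) * bar_form A (nths xs S) * contract x B (nths xs (- S))"
      by (simp add: card_inversions_Suc nths_Cons_insert contract_def bar_form_def length_nths power_add)
  qed simp
  finally show ?thesis .
qed

lemma contract_wedge:
  "contract x (wedge A B) = wedge (contract x A) B + wedge (bar_form A) (contract x B)"
  by (simp add: fun_eq_iff contract_def wedge_Cons plus_fun_def)

lemma contract_add: "contract x (A + B) = contract x A + contract x B"
  by (simp add: contract_def plus_fun_def)

lemma contract_zero [simp]: "contract x 0 = 0"
  by (simp add: contract_def zero_fun_def)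

lemma contract_scale: "contract x (scale_form c A) = scale_form c (contract x A)"
  by (simp add: contract_def scale_form_def)

lemma contract_bar_form: "contract x (bar_form A) = - bar_form (contract x A)"
  by (simp add: contract_def bar_form_def fun_eq_iff)

lemma wedge_add_left: "wedge (A + A') B = wedge A B + wedge A' B"
  by (simp add: wedge_def fun_eq_iff sum.distrib algebra_simps)

lemma wedge_add_right: "wedge A (B + B') = wedge A B + wedge A B'"
  by (simp add: wedge_def fun_eq_iff sum.distrib algebra_simps)

lemma wedge_scale_left: "wedge (scale_form c A) B = scale_form c (wedge A B)"
  by (simp add: wedge_def scale_form_def fun_eq_iff sum_distrib_left algebra_simps)

lemma wedge_scale_right: "wedge A (scale_form c B) = scale_form c (wedge A B)"
  by (simp add: wedge_def scale_form_def fun_eq_iff sum_distrib_left algebra_simps)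

lemma wedge_zero_left [simp]: "wedge 0 B = 0"
  by (simp add: wedge_def fun_eq_iff)

lemma wedge_zero_right [simp]: "wedge A 0 = 0"
  by (simp add: wedge_def fun_eq_iff)

lemma uminus_form: "- A = scale_form (-1) (A :: 'l forms)"
  by (simp add: scale_form_def fun_eq_iff)

lemma wedge_minus_left: "wedge (- A) B = - wedge A B"
  by (simp add: wedge_scale_left uminus_form)

lemma wedge_minus_right: "wedge A (- B) = - wedge A B"
  by (simp add: wedge_scale_right uminus_form)

lemma wedge_sum_left: "wedge (sum f I) B = (\<Sum>i\<in>I. wedge (f i) B)"
  by (induction I rule: infinite_finite_induct)
    (simp_all only: sum.infinite sum.empty sum.insert wedge_zero_left wedge_add_left not_False_eq_True)

lemma wedge_sum_right: "wedge A (sum f I) = (\<Sum>i\<in>I. wedge A (f i))"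
  by (induction I rule: infinite_finite_induct)
    (simp_all only: sum.infinite sum.empty sum.insert wedge_zero_right wedge_add_right not_False_eq_True)

lemma bar_form_wedge: "bar_form (wedge A B) = wedge (bar_form A) (bar_form B)"
proof
  fix xs show "bar_form (wedge A B) xs = wedge (bar_form A) (bar_form B) xs"
  proof (induction xs arbitrary: A B)
    case Nil then show ?case by (simp add: bar_form_def wedge_Nil)
  next
    case (Cons x xs)
    have "bar_form (wedge A B) (x # xs) = - bar_form (wedge (contract x A) B) xs - bar_form (wedge (bar_form A) (contract x B)) xs"
      by (simp add: bar_form_def wedge_Cons algebra_simps)
    also have "\<dots> = wedge (bar_form A) (bar_form B) (x # xs)"
      by (simp add: wedge_Cons Cons contract_bar_form wedge_minus_left wedge_minus_right)
    finally show ?case .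
  qed
qed

lemma wedge_assoc: "wedge (wedge A B) C = wedge A (wedge B C)"
proof
  fix xs show "wedge (wedge A B) C xs = wedge A (wedge B C) xs"
  proof (induction xs arbitrary: A B C)
    case Nil then show ?case by (simp add: wedge_Nil)
  next
    case (Cons x xs)
    then show ?case
      by (simp add: wedge_Cons contract_wedge wedge_add_left wedge_add_right bar_form_wedge)
  qed
qed

text \<open>Associativity and graded commutativity of the shuffle product are facts about functions
  on lists; this notion of degree lets them be stated in that generality.\<close>

definition supported_at :: "nat \<Rightarrow> 'l forms \<Rightarrow> bool" where
  "supported_at n A \<longleftrightarrow> (\<forall>xs. length xs \<noteq> n \<longrightarrow> A xs = 0)"

lemma supported_at_contract: "supported_at n A \<Longrightarrow> supported_at (n - 1) (contract x A)"
  by (cases n) (auto simp: supported_at_def contract_def)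

lemma contract_supported_at_0: "supported_at 0 A \<Longrightarrow> contract x A = 0"
  by (auto simp: supported_at_def contract_def)

lemma bar_form_supported_at: "supported_at n A \<Longrightarrow> bar_form A = scale_form ((-1) ^ n) A"
  by (auto simp: supported_at_def bar_form_def scale_form_def fun_eq_iff)

lemma scale_form_scale_form [simp]: "scale_form c (scale_form d A) = scale_form (c * d) A"
  by (simp add: scale_form_def mult.assoc)

lemma scale_form_1 [simp]: "scale_form 1 A = A"
  by (simp add: scale_form_def)

lemma scale_form_zero_right [simp]: "scale_form c 0 = 0"
  by (simp add: scale_form_def fun_eq_iff)

lemma scale_form_add: "scale_form c (A + B) = scale_form c A + scale_form c B"
  by (simp add: scale_form_def fun_eq_iff algebra_simps)

lemma scale_form_sum: "scale_form c (sum f I) = (\<Sum>i\<in>I. scale_form c (f i))"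
  by (induction I rule: infinite_finite_induct)
    (simp_all only: sum.infinite sum.empty sum.insert scale_form_zero_right scale_form_add not_False_eq_True)

lemma wedge_commute:
  assumes "supported_at p A" "supported_at q B"
  shows "wedge A B = scale_form ((-1) ^ (p * q)) (wedge B A)"
proof
  fix xs show "wedge A B xs = scale_form ((-1) ^ (p * q)) (wedge B A) xs"
    using assms
  proof (induction xs arbitrary: A B p q)
    case Nil
    then show ?case
      by (cases "p = 0 \<or> q = 0") (auto simp: wedge_Nil scale_form_def supported_at_def)
  next
    case (Cons x xs)
    \<comment> \<open>The exponent has the parity of (p - 1) q, written without truncated
      subtraction.\<close>
    have 1: "wedge (contract x A) B xs = (-1) ^ (p * q + q) * wedge B (contract x A) xs"
    proof (cases p)
      case 0
      then have "contract x A = 0" using contract_supported_at_0 Cons.prems(1) by metis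
      then show ?thesis by simp
    next
      case (Suc p')
      then have "supported_at p' (contract x A)" using supported_at_contract[OF Cons.prems(1)] by simp
      from Cons.IH[OF this Cons.prems(2)] Suc show ?thesis
        by (simp add: scale_form_def power_add mult.assoc[symmetric])
    qed
    have 2: "wedge A (contract x B) xs = (-1) ^ (p * q + p) * wedge (contract x B) A xs"
    proof (cases q)
      case 0
      then have "contract x B = 0" using contract_supported_at_0 Cons.prems(2) by metis
      then show ?thesis by simp
    next
      case (Suc p')
      then have "supported_at p' (contract x B)" using supported_at_contract[OF Cons.prems(2)] by simp
      from Cons.IH[OF Cons.prems(1) this] Suc show ?thesis
        by (simp add: scale_form_def power_add mult.assoc[symmetric])
    qed
    show ?case
      unfolding wedge_Cons scale_form_def
      using bar_form_supported_at[OF Cons.prems(1)] bar_form_supported_at[OF Cons.prems(2)]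
      by (simp add: 1 2 wedge_scale_left wedge_scale_right)
         (simp add: scale_form_def wedge_Cons 1 2 power_add algebra_simps wedge_scale_left)
  qed
qed

lemma supported_at_wedge:
  assumes "supported_at p A" "supported_at q B"
  shows "supported_at (p + q) (wedge A B)"
  unfolding supported_at_def
proof (intro allI impI)
  fix xs :: "'a list" assume "length xs \<noteq> p + q"
  then show "wedge A B xs = 0" using assms
  proof (induction xs arbitrary: A B p q)
    case Nil then show ?case by (auto simp: wedge_Nil supported_at_def)
  next
    case (Cons x xs)
    have 1: "wedge (contract x A) B xs = 0"
    proof (cases p)
      case 0 then show ?thesis using contract_supported_at_0 Cons.prems by fastforce
    next
      case (Suc p')
      then have "supported_at p' (contract x A)" using supported_at_contract Cons.prems(2) by fastforce
      then show ?thesis by (rule Cons.IH[rotated]) (use Cons.prems Suc in auto)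
    qed
    have 2: "wedge (bar_form A) (contract x B) xs = 0"
    proof (cases q)
      case 0 then show ?thesis using contract_supported_at_0 Cons.prems by fastforce
    next
      case (Suc q')
      then have "supported_at q' (contract x B)" using supported_at_contract Cons.prems(3) by fastforce
      moreover have "supported_at p (bar_form A)" using Cons.prems(2) by (auto simp: supported_at_def bar_form_def)
      ultimately show ?thesis by (intro Cons.IH) (use Cons.prems Suc in auto)
    qed
    show ?case by (simp add: wedge_Cons 1 2)
  qed
qed

section \<open>Alternating forms and their contractions\<close>

lemma alt_forms_outside: "A \<in> alt_forms L sc \<Longrightarrow> \<not> set xs \<subseteq> L \<Longrightarrow> A xs = 0"
  by (simp add: alt_forms_def)

lemma alt_forms_add:
  "A \<in> alt_forms L sc \<Longrightarrow> x \<in> L \<Longrightarrow> y \<in> L \<Longrightarrow> set xs \<subseteq> L \<Longrightarrow> set ys \<subseteq> L \<Longrightarrow>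
    A (xs @ (x + y) # ys) = A (xs @ x # ys) + A (xs @ y # ys)"
  by (simp add: alt_forms_def)

lemma alt_forms_scale:
  "A \<in> alt_forms L sc \<Longrightarrow> x \<in> L \<Longrightarrow> set xs \<subseteq> L \<Longrightarrow> set ys \<subseteq> L \<Longrightarrow>
    A (xs @ sc c x # ys) = c * A (xs @ x # ys)"
  by (simp add: alt_forms_def)

lemma alt_forms_alternating: "A \<in> alt_forms L sc \<Longrightarrow> A (xs @ x # ys @ x # zs) = 0"
  by (simp add: alt_forms_def)

lemma zero_in_alt_forms [simp]: "0 \<in> alt_forms L sc"
  by (simp add: alt_forms_def)

lemma alt_forms_closed_add: "A \<in> alt_forms L sc \<Longrightarrow> B \<in> alt_forms L sc \<Longrightarrow> A + B \<in> alt_forms L sc"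
  by (simp add: alt_forms_def algebra_simps)

lemma alt_forms_closed_minus: "A \<in> alt_forms L sc \<Longrightarrow> - A \<in> alt_forms L sc"
  by (simp add: alt_forms_def)

lemma alt_forms_closed_sum:
  "(\<And>i. i \<in> I \<Longrightarrow> f i \<in> alt_forms L sc) \<Longrightarrow> sum f I \<in> alt_forms L sc"
  by (induction I rule: infinite_finite_induct)
    (simp_all only: sum.infinite sum.empty sum.insert zero_in_alt_forms alt_forms_closed_add insert_iff not_False_eq_True simp_thms)

lemma contract_in_alt_forms:
  assumes "A \<in> alt_forms L sc"
  shows "contract x A \<in> alt_forms L sc"
proof (cases "x \<in> L")
  case True
  show ?thesis
    unfolding alt_forms_def
  proof (intro CollectI conjI allI ballI impI)
    fix xs ys zs and u v :: 'a and c
    show "\<not> set xs \<subseteq> L \<Longrightarrow> contract x A xs = 0"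
      using alt_forms_outside[OF assms] by (simp add: contract_def)
    show "contract x A (xs @ u # ys @ u # zs) = 0"
      using alt_forms_alternating[OF assms, of "x # xs"] by (simp add: contract_def)
    assume "u \<in> L" "set xs \<subseteq> L" "set ys \<subseteq> L"
    then show "contract x A (xs @ sc c u # ys) = c * contract x A (xs @ u # ys)"
      using alt_forms_scale[OF assms, of _ "x # xs"] True by (simp add: contract_def)
    assume "v \<in> L"
    with \<open>u \<in> L\<close> \<open>set xs \<subseteq> L\<close> \<open>set ys \<subseteq> L\<close>
    show "contract x A (xs @ (u + v) # ys) = contract x A (xs @ u # ys) + contract x A (xs @ v # ys)"
      using alt_forms_add[OF assms, of _ _ "x # xs"] True by (simp add: contract_def)
  qed
next
  case False
  then have "contract x A = 0"
    using alt_forms_outside[OF assms] by (auto simp: contract_def fun_eq_iff)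
  then show ?thesis by simp
qed

lemma contract_outside: "A \<in> alt_forms L sc \<Longrightarrow> x \<notin> L \<Longrightarrow> contract x A = 0"
  using alt_forms_outside by (fastforce simp: contract_def fun_eq_iff)

lemma contract_add_arg:
  assumes "A \<in> alt_forms L sc" "x \<in> L" "y \<in> L"
  shows "contract (x + y) A = contract x A + contract y A"
proof
  fix xs show "contract (x + y) A xs = (contract x A + contract y A) xs"
    using alt_forms_add[OF assms, of "[]" xs] alt_forms_outside[OF assms(1)]
    by (cases "set xs \<subseteq> L") (auto simp: contract_def)
qed

lemma contract_scale_arg:
  assumes "A \<in> alt_forms L sc" "x \<in> L"
  shows "contract (sc c x) A = scale_form c (contract x A)"
proof
  fix xs show "contract (sc c x) A xs = scale_form c (contract x A) xs"
    using alt_forms_scale[OF assms, of "[]" xs] alt_forms_outside[OF assms(1)]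
    by (cases "set xs \<subseteq> L") (auto simp: contract_def scale_form_def)
qed

lemma contract_contract_same: "A \<in> alt_forms L sc \<Longrightarrow> contract x (contract x A) = 0"
  using alt_forms_alternating[of A L sc "[]" x "[]"] by (simp add: contract_def fun_eq_iff)

lemma bar_form_in_alt_forms: "A \<in> alt_forms L sc \<Longrightarrow> bar_form A \<in> alt_forms L sc"
  by (simp add: alt_forms_def bar_form_def algebra_simps)

lemma homog_forms_iff: "A \<in> homog_forms L sc n \<longleftrightarrow> A \<in> alt_forms L sc \<and> supported_at n A"
  by (auto simp: homog_forms_def supported_at_def)

definition const_form :: "complex \<Rightarrow> 'l forms" where
  "const_form c = (\<lambda>xs. if xs = [] then c else 0)"

lemma contract_const_form [simp]: "contract x (const_form c) = 0"
  by (simp add: contract_def const_form_def fun_eq_iff)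

lemma contract_one_form: "contract x (one_form f) = const_form (f x)"
  by (auto simp: contract_def one_form_def const_form_def fun_eq_iff split: list.split)

lemma supported_at_one_form: "supported_at 1 (one_form f)"
  by (auto simp: supported_at_def one_form_def split: list.split)

lemma bar_form_one_form: "bar_form (one_form f) = - one_form f"
  by (auto simp: bar_form_def one_form_def fun_eq_iff split: list.split)

lemma bar_form_const_form [simp]: "bar_form (const_form c) = const_form c"
  by (auto simp: bar_form_def const_form_def)

lemma wedge_const_form_left: "wedge (const_form c) A = scale_form c A"
proof
  fix xs show "wedge (const_form c) A xs = scale_form c A xs"
  proof (induction xs arbitrary: A)
    case (Cons x xs)
    have "wedge (const_form c) A (x # xs) = wedge 0 A xs + wedge (const_form c) (contract x A) xs"
      by (simp only: wedge_Cons contract_const_form bar_form_const_form)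
    then show ?case using Cons by (simp add: scale_form_def contract_def)
  qed (simp add: wedge_Nil const_form_def scale_form_def)
qed

lemma wedge_const_form_right: "wedge A (const_form c) = scale_form c A"
proof
  fix xs show "wedge A (const_form c) xs = scale_form c A xs"
  proof (induction xs arbitrary: A)
    case (Cons x xs)
    have "wedge A (const_form c) (x # xs) = wedge (contract x A) (const_form c) xs + wedge (bar_form A) 0 xs"
      by (simp only: wedge_Cons contract_const_form)
    then show ?case using Cons by (simp add: scale_form_def contract_def)
  qed (simp add: wedge_Nil const_form_def scale_form_def)
qed

lemma const_form_eq_scale: "const_form c = scale_form c (const_form 1)"
  by (auto simp: const_form_def scale_form_def)

lemma const_form_in_alt_forms [simp]: "const_form c \<in> alt_forms L sc"
  by (auto simp: alt_forms_def const_form_def)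

lemma supported_at_0_eq: "supported_at 0 A \<Longrightarrow> A = const_form (A [])"
  by (auto simp: supported_at_def const_form_def)

lemma supported_at_add: "supported_at n A \<Longrightarrow> supported_at n B \<Longrightarrow> supported_at n (A + B)"
  by (simp add: supported_at_def)

lemma supported_at_zero [simp]: "supported_at n 0"
  by (simp add: supported_at_def)

lemma supported_at_sum: "(\<And>i. i \<in> I \<Longrightarrow> supported_at n (f i)) \<Longrightarrow> supported_at n (sum f I)"
  by (induction I rule: infinite_finite_induct)
    (simp_all only: sum.infinite sum.empty sum.insert supported_at_zero supported_at_add insert_iff not_False_eq_True simp_thms)

locale complex_subspace =
  fixes L :: "'l::ab_group_add set" and sc :: "complex \<Rightarrow> 'l \<Rightarrow> 'l"
  assumes add_closed: "x \<in> L \<Longrightarrow> y \<in> L \<Longrightarrow> x + y \<in> L"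
    and scale_closed: "x \<in> L \<Longrightarrow> sc c x \<in> L"
    and zero_closed: "0 \<in> L"
begin

lemma one_form_in_alt_forms:
  assumes "\<And>x. x \<notin> L \<Longrightarrow> f x = 0"
    and "\<And>x y. x \<in> L \<Longrightarrow> y \<in> L \<Longrightarrow> f (x + y) = f x + f y"
    and "\<And>c x. x \<in> L \<Longrightarrow> f (sc c x) = c * f x"
  shows "one_form f \<in> alt_forms L sc"
  unfolding alt_forms_def
proof (intro CollectI conjI allI ballI impI)
  fix xs ys zs :: "'l list" and u v :: 'l and c
  show "\<not> set xs \<subseteq> L \<Longrightarrow> one_form f xs = 0"
    using assms(1) by (auto simp: one_form_def split: list.split)
  show "one_form f (xs @ u # ys @ u # zs) = 0"
    by (cases xs) (auto simp: one_form_def split: list.split)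
  assume "u \<in> L" "set xs \<subseteq> L" "set ys \<subseteq> L"
  then show "one_form f (xs @ sc c u # ys) = c * one_form f (xs @ u # ys)"
    using assms(3) by (cases xs; cases ys) (auto simp: one_form_def split: list.split)
  assume "v \<in> L"
  then show "one_form f (xs @ (u + v) # ys) = one_form f (xs @ u # ys) + one_form f (xs @ v # ys)"
    using assms(2) \<open>u \<in> L\<close> by (cases xs; cases ys) (auto simp: one_form_def split: list.split)
qed

text \<open>Vanishing on adjacent repetitions suffices, by polarisation.\<close>

lemma alt_formsI:
  assumes out: "\<And>xs. \<not> set xs \<subseteq> L \<Longrightarrow> A xs = 0"
    and add: "\<And>xs ys x y. x \<in> L \<Longrightarrow> y \<in> L \<Longrightarrow> set xs \<subseteq> L \<Longrightarrow> set ys \<subseteq> L \<Longrightarrow>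
        A (xs @ (x + y) # ys) = A (xs @ x # ys) + A (xs @ y # ys)"
    and scale: "\<And>xs ys x c. x \<in> L \<Longrightarrow> set xs \<subseteq> L \<Longrightarrow> set ys \<subseteq> L \<Longrightarrow>
        A (xs @ sc c x # ys) = c * A (xs @ x # ys)"
    and alt: "\<And>xs x ys. A (xs @ x # x # ys) = 0"
  shows "A \<in> alt_forms L sc"
proof -
  have swap: "A (xs @ x # y # zs) = - A (xs @ y # x # zs)" for xs x y zs
  proof (cases "set (xs @ x # y # zs) \<subseteq> L")
    case True
    then have L: "x \<in> L" "y \<in> L" "x + y \<in> L" "set xs \<subseteq> L" "set zs \<subseteq> L" by (auto intro: add_closed)
    have "0 = A (xs @ (x + y) # (x + y) # zs)" by (simp add: alt)
    also have "\<dots> = A (xs @ x # (x + y) # zs) + A (xs @ y # (x + y) # zs)"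
      by (rule add) (use L in auto)
    also have "A (xs @ x # (x + y) # zs) = A (xs @ x # x # zs) + A (xs @ x # y # zs)"
      using add[of x y "xs @ [x]" zs] L by simp
    also have "A (xs @ y # (x + y) # zs) = A (xs @ y # x # zs) + A (xs @ y # y # zs)"
      using add[of x y "xs @ [y]" zs] L by simp
    finally show ?thesis by (simp add: alt eq_neg_iff_add_eq_0 add.commute)
  next
    case False then show ?thesis using out[of "xs @ x # y # zs"] out[of "xs @ y # x # zs"] by auto
  qed
  have "A (xs @ x # ys @ x # zs) = 0" for xs x ys zs
  proof (induction ys arbitrary: xs)
    case (Cons y ys)
    then show ?case using swap[of xs x y "ys @ x # zs"] Cons[of "xs @ [y]"] by simp
  qed (simp add: alt)
  with assms show ?thesis by (auto simp: alt_forms_def)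
qed

text \<open>Each property is pushed by \<open>wedge_Cons\<close> to the place of the list where it
  is tested. For a repeated argument this leaves two contractions with the same vector, whose mixed
  terms cancel by the sign in \<open>contract_bar_form\<close>.\<close>

lemma wedge_in_alt_forms:
  assumes "A \<in> alt_forms L sc" "B \<in> alt_forms L sc"
  shows "wedge A B \<in> alt_forms L sc"
proof (rule alt_formsI)
  note [intro] = contract_in_alt_forms bar_form_in_alt_forms
  fix xs ys x y c
  show "\<not> set xs \<subseteq> L \<Longrightarrow> wedge A B xs = 0"
    using assms
  proof (induction xs arbitrary: A B)
    case (Cons x xs)
    show ?case
    proof (cases "x \<in> L")
      case True
      with Cons(2) have "\<not> set xs \<subseteq> L" by auto
      then have "wedge (contract x A) B xs = 0" "wedge (bar_form A) (contract x B) xs = 0"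
        using Cons(1,3,4) by blast+
      then show ?thesis by (simp add: wedge_Cons)
    next
      case False
      with Cons(3,4) have "contract x A = 0" "contract x B = 0" by (auto intro: contract_outside)
      then show ?thesis by (simp add: wedge_Cons)
    qed
  qed simp
  show "wedge A B (xs @ x # x # ys) = 0"
    using assms
  proof (induction xs arbitrary: A B)
    case Nil
    have "contract x (contract x (wedge A B)) = 0"
      by (simp only: contract_wedge contract_add contract_contract_same[OF Nil(1)]
        contract_contract_same[OF Nil(2)] contract_bar_form wedge_minus_left
        wedge_zero_left wedge_zero_right add_0_left add_0_right right_minus)
    from fun_cong[OF this, of ys] show ?case by (simp add: contract_def)
  next
    case (Cons a xs)
    then show ?case by (simp add: wedge_Cons contract_in_alt_forms bar_form_in_alt_forms)
  qed
  assume L: "x \<in> L"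
  show "wedge A B (xs @ sc c x # ys) = c * wedge A B (xs @ x # ys)"
    using assms
  proof (induction xs arbitrary: A B)
    case Nil
    then show ?case
      using L by (simp add: wedge_Cons contract_scale_arg[OF Nil(1) L] contract_scale_arg[OF Nil(2) L]
        wedge_scale_left wedge_scale_right) (simp add: scale_form_def algebra_simps)
  qed (simp add: wedge_Cons contract_in_alt_forms bar_form_in_alt_forms algebra_simps)
  assume L': "y \<in> L"
  show "wedge A B (xs @ (x + y) # ys) = wedge A B (xs @ x # ys) + wedge A B (xs @ y # ys)"
    using assms
  proof (induction xs arbitrary: A B)
    case Nil
    then show ?case
      using L by (simp add: wedge_Cons contract_add_arg[OF Nil(1) L L'] contract_add_arg[OF Nil(2) L L']
        wedge_add_left wedge_add_right)
  qed (simp add: wedge_Cons contract_in_alt_forms bar_form_in_alt_forms)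
qed

text \<open>Polarisation of \<open>contract_contract_same\<close>; if one of the vectors lies
  outside \<open>L\<close>, both sides vanish.\<close>

lemma contract_anticommute:
  assumes A: "A \<in> alt_forms L sc"
  shows "contract x (contract y A) = - contract y (contract x A)"
proof (cases "x \<in> L \<and> y \<in> L")
  case True
  then have L: "x \<in> L" "y \<in> L" "x + y \<in> L" by (auto intro: add_closed)
  note cA = contract_in_alt_forms[OF A]
  have "0 = contract (x + y) (contract (x + y) A)" by (simp add: contract_contract_same[OF A])
  also have "\<dots> = contract x (contract y A) + contract y (contract x A)"
    by (simp only: contract_add_arg[OF A L(1,2)] contract_add contract_add_arg[OF cA L(1,2)]
      contract_contract_same[OF A] add_0_left add_0_right)
      (simp only: add.commute)
  finally show ?thesis by (simp add: eq_neg_iff_add_eq_0)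
next
  case False
  then have "contract x A = 0 \<or> contract y A = 0"
    "contract x (contract y A) = 0 \<or> contract y (contract x A) = 0"
    using contract_outside[OF A] contract_outside[OF contract_in_alt_forms[OF A]] by blast+
  then show ?thesis
    using contract_outside[OF A] contract_outside[OF contract_in_alt_forms[OF A]] False contract_zero
    by (metis neg_equal_0_iff_equal)
qed

end

section \<open>Gerstenhaber brackets\<close>

lemma scale_form_minus: "scale_form c (- A) = - scale_form c A"
  by (simp add: scale_form_def fun_eq_iff)

lemma sum_form_apply: "sum f I xs = (\<Sum>i\<in>I. f i xs)" for f :: "'i \<Rightarrow> 'a forms"
  by (induction I rule: infinite_finite_induct) (simp_all add: zero_fun_def)

definition component :: "nat \<Rightarrow> 'l forms \<Rightarrow> 'l forms" where
  "component n A = (\<lambda>xs. if length xs = n then A xs else 0)"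

lemma component_in_homog_forms: "A \<in> alt_forms L sc \<Longrightarrow> component n A \<in> homog_forms L sc n"
  by (auto simp: homog_forms_def component_def alt_forms_def)

lemma sum_components:
  assumes "\<And>xs. length xs > N \<Longrightarrow> A xs = 0"
  shows "A = (\<Sum>n\<le>N. component n A)"
proof
  fix xs
  show "A xs = (\<Sum>n\<le>N. component n A) xs"
    using assms[of xs] by (cases "length xs \<le> N") (auto simp: sum_form_apply component_def intro!: sum.neutral[symmetric])
qed

context
  fixes L :: "'l::ab_group_add set" and sc W wb \<iota> B
  assumes B: "gerstenhaber_extension L sc W wb \<iota> B"
begin

lemma gerstenhaber_zero:
  assumes a: "a \<in> alt_forms L sc"
  shows "B a 0 = 0" "B 0 a = 0"
proof -
  have "B a (0 + 0) = B a 0 + B a 0" "B (0 + 0) a = B 0 a + B 0 a"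
    using B a zero_in_alt_forms unfolding gerstenhaber_extension_def by blast+
  then show "B a 0 = 0" "B 0 a = 0" by (simp_all only: add_0_right add_cancel_right_right)
qed

lemma gerstenhaber_sum:
  assumes a: "a \<in> alt_forms L sc" and "\<And>i. i \<in> I \<Longrightarrow> f i \<in> alt_forms L sc" "finite I"
  shows "B a (sum f I) = (\<Sum>i\<in>I. B a (f i)) \<and> B (sum f I) a = (\<Sum>i\<in>I. B (f i) a)"
  using assms(3,2)
proof (induction I rule: finite_induct)
  case empty
  then show ?case using gerstenhaber_zero[OF a] by (simp only: sum.empty simp_thms)
next
  case (insert i I)
  have "f i \<in> alt_forms L sc" "sum f I \<in> alt_forms L sc"
    using insert.prems by (auto intro: alt_forms_closed_sum)
  then have "B a (f i + sum f I) = B a (f i) + B a (sum f I)" "B (f i + sum f I) a = B (f i) a + B (sum f I) a"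
    using a B unfolding gerstenhaber_extension_def by blast+
  with insert show ?case by (simp only: sum.insert insert_iff simp_thms)
qed

text \<open>Degree, symmetry and the Leibniz rule are axioms for homogeneous arguments. A bound on
  the degrees makes every form a finite sum of such arguments, to which additivity reduces the
  bracket.\<close>

lemma gerstenhaber_components:
  assumes a: "a \<in> alt_forms L sc" "\<And>xs. length xs > N \<Longrightarrow> a xs = 0"
    and b: "b \<in> alt_forms L sc" "\<And>xs. length xs > N \<Longrightarrow> b xs = 0"
  shows "B a b = (\<Sum>n\<le>N. \<Sum>m\<le>N. B (component n a) (component m b))"
proof -
  have comp: "component n c \<in> alt_forms L sc" if "c \<in> alt_forms L sc" for c n
    using component_in_homog_forms[OF that] by (simp add: homog_forms_iff)
  have sa: "a = (\<Sum>n\<le>N. component n a)" and sb: "b = (\<Sum>n\<le>N. component n b)"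
    by (intro sum_components a b; assumption)+
  have "B a b = B (\<Sum>n\<le>N. component n a) b" by (rule arg_cong[where f = "\<lambda>x. B x b", OF sa])
  also have "\<dots> = (\<Sum>n\<le>N. B (component n a) b)"
    by (rule gerstenhaber_sum[OF b(1) comp[OF a(1)] finite_atMost, THEN conjunct2])
  also have "\<dots> = (\<Sum>n\<le>N. B (component n a) (\<Sum>m\<le>N. component m b))"
    by (intro sum.cong refl arg_cong[where f = "B _", OF sb])
  also have "\<dots> = (\<Sum>n\<le>N. \<Sum>m\<le>N. B (component n a) (component m b))"
    by (intro sum.cong refl gerstenhaber_sum[OF comp[OF a(1)] comp[OF b(1)] finite_atMost, THEN conjunct1])
  finally show ?thesis .
qed

lemma gerstenhaber_closed:
  assumes a: "a \<in> alt_forms L sc" "\<And>xs. length xs > N \<Longrightarrow> a xs = 0"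
    and b: "b \<in> alt_forms L sc" "\<And>xs. length xs > N \<Longrightarrow> b xs = 0"
  shows "B a b \<in> alt_forms L sc"
proof -
  have "B a b = (\<Sum>n\<le>N. \<Sum>m\<le>N. B (component n a) (component m b))"
    by (rule gerstenhaber_components) (use assms in auto)
  moreover have "B (component n a) (component m b) \<in> alt_forms L sc" for n m
  proof -
  have "if n + m = 0 then B (component n a) (component m b) = 0
      else B (component n a) (component m b) \<in> homog_forms L sc (n + m - 1)"
    using B component_in_homog_forms[OF a(1)] component_in_homog_forms[OF b(1)]
    unfolding gerstenhaber_extension_def by blast
  then show "B (component n a) (component m b) \<in> alt_forms L sc"
    by (cases "n + m = 0") (simp_all only: if_True if_False zero_in_alt_forms homog_forms_iff)
  qed
  ultimately show ?thesis by (simp only: alt_forms_closed_sum)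
qed

end

text \<open>A finite basis \<open>E\<close> of \<open>L\<close> with its dual basis
  \<open>\<epsilon>\<close>. The coordinates are extended by 0 outside \<open>L\<close> because
  \<open>alt_forms\<close> asks this of a form.\<close>

locale finite_complex_space = complex_subspace L sc
  for L :: "'l::ab_group_add set" and sc +
  fixes E :: "'l set" and \<epsilon> :: "'l \<Rightarrow> 'l \<Rightarrow> complex"
  assumes finite_E: "finite E" and E_subset: "E \<subseteq> L"
    and coord_outside: "e \<in> E \<Longrightarrow> x \<notin> L \<Longrightarrow> \<epsilon> e x = 0"
    and coord_add: "e \<in> E \<Longrightarrow> x \<in> L \<Longrightarrow> y \<in> L \<Longrightarrow> \<epsilon> e (x + y) = \<epsilon> e x + \<epsilon> e y"
    and coord_scale: "e \<in> E \<Longrightarrow> x \<in> L \<Longrightarrow> \<epsilon> e (sc c x) = c * \<epsilon> e x"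
    and coord_basis: "e \<in> E \<Longrightarrow> e' \<in> E \<Longrightarrow> \<epsilon> e e' = (if e = e' then 1 else 0)"
    and expand: "x \<in> L \<Longrightarrow> x = (\<Sum>e\<in>E. sc (\<epsilon> e x) e)"
begin

lemma coord_form_in_alt_forms: "e \<in> E \<Longrightarrow> one_form (\<epsilon> e) \<in> alt_forms L sc"
  by (rule one_form_in_alt_forms) (auto intro: coord_outside coord_add coord_scale)

lemma contract_zero_arg: "A \<in> alt_forms L sc \<Longrightarrow> contract 0 A = 0"
  using contract_add_arg[of A L sc 0 0] zero_closed by simp

lemma contract_expand:
  assumes A: "A \<in> alt_forms L sc" and x: "x \<in> L"
  shows "contract x A = (\<Sum>e\<in>E. scale_form (\<epsilon> e x) (contract e A))"
proof -
  \<comment> \<open>Additivity of \<open>contract\<close> in the vector is available only inside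
    \<open>L\<close>, so the induction carries the membership of the partial sums along.\<close>
  have "contract (\<Sum>e\<in>F. sc (\<epsilon> e x) e) A = (\<Sum>e\<in>F. scale_form (\<epsilon> e x) (contract e A))
      \<and> (\<Sum>e\<in>F. sc (\<epsilon> e x) e) \<in> L" if "finite F" "F \<subseteq> E" for F
    using that
  proof (induction F rule: finite_induct)
    case empty
    then show ?case using contract_zero_arg[OF A] zero_closed by (simp only: sum.empty simp_thms)
  next
    case (insert e F)
    then have e: "e \<in> L" "sc (\<epsilon> e x) e \<in> L" using E_subset scale_closed by auto
    with insert show ?case
      by (simp only: sum.insert insert_subset contract_add_arg[OF A] contract_scale_arg[OF A] add_closed simp_thms)
  qed
  from this[OF finite_E] have "contract (\<Sum>e\<in>E. sc (\<epsilon> e x) e) A = (\<Sum>e\<in>E. scale_form (\<epsilon> e x) (contract e A))"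
    by blast
  with expand[OF x] show ?thesis by simp
qed

text \<open>The operator on the left counts the degree. Contracting it with \<open>x\<close> yields
  \<open>contract x A\<close>, by \<open>contract_expand\<close>, plus the same operator applied to
  \<open>contract x A\<close>, which has one degree less; the sign from passing a one-form cancels
  the sign from anticommuting the contractions.\<close>

lemma euler_formula_apply:
  assumes "A \<in> alt_forms L sc" "supported_at p A"
  shows "(\<Sum>e\<in>E. wedge (one_form (\<epsilon> e)) (contract e A) xs) = of_nat p * A xs"
  using assms
proof (induction xs arbitrary: A p)
  case Nil
  then show ?case by (cases p) (auto simp: wedge_Nil one_form_def supported_at_def)
next
  case (Cons x xs)
  show ?case
  proof (cases "x \<in> L \<and> p \<noteq> 0")
    case True
    then obtain q where q: "p = Suc q" using not0_implies_Suc by blast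
    have "(\<Sum>e\<in>E. wedge (one_form (\<epsilon> e)) (contract e A) (x # xs)) =
      (\<Sum>e\<in>E. scale_form (\<epsilon> e x) (contract e A) xs + wedge (one_form (\<epsilon> e)) (contract e (contract x A)) xs)"
      by (rule sum.cong)
        (simp_all add: wedge_Cons contract_one_form bar_form_one_form wedge_const_form_left
          contract_anticommute[OF Cons.prems(1), of x] wedge_minus_left wedge_minus_right)
    also have "\<dots> = contract x A xs + (\<Sum>e\<in>E. wedge (one_form (\<epsilon> e)) (contract e (contract x A)) xs)"
      using contract_expand[OF Cons.prems(1), of x] True by (simp add: sum.distrib sum_form_apply)
    also have "(\<Sum>e\<in>E. wedge (one_form (\<epsilon> e)) (contract e (contract x A)) xs) = of_nat q * contract x A xs"
      using supported_at_contract[OF Cons.prems(2), of x] q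
      by (intro Cons.IH) (auto intro: contract_in_alt_forms Cons.prems)
    finally show ?thesis by (simp add: q contract_def algebra_simps)
  next
    case False
    then have cx: "contract x A = 0"
      using contract_outside[OF Cons.prems(1)] contract_supported_at_0[of A x] Cons.prems(2)
      by (cases "p = 0") auto
    have ce: "wedge (one_form (\<epsilon> e)) (contract e A) (x # xs) = 0" if e: "e \<in> E" for e
    proof (cases "p = 0")
      case True
      with Cons.prems(2) have "contract e A = 0" by (simp add: contract_supported_at_0)
      then show ?thesis by simp
    next
      case p: False
      with False have "x \<notin> L" by simp
      then show ?thesis
        using alt_forms_outside[OF wedge_in_alt_forms[OF coord_form_in_alt_forms[OF e]
          contract_in_alt_forms[OF Cons.prems(1)]], of "x # xs"]
        by simp
    qed
    have "(\<Sum>e\<in>E. wedge (one_form (\<epsilon> e)) (contract e A) (x # xs)) = 0"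
      by (intro sum.neutral ballI ce)
    with fun_cong[OF cx, of xs] show ?thesis by (simp only: contract_def zero_fun_apply mult_zero_right)
  qed
qed

text \<open>In positive degree the factor can be divided out: this is generation of the exterior
  algebra in degree one, in the form that uniqueness of the bracket uses.\<close>

lemma euler_formula:
  assumes "A \<in> alt_forms L sc" "supported_at p A"
  shows "(\<Sum>e\<in>E. wedge (one_form (\<epsilon> e)) (contract e A)) = scale_form (of_nat p) A"
  using euler_formula_apply[OF assms] by (simp add: fun_eq_iff sum_form_apply scale_form_def)

text \<open>By the Euler formula, contracting with a further basis vector lowers both \<open>S\<close> and the degree.\<close>

lemma alt_form_zero_if_contract_zero:
  assumes "finite S" "S \<subseteq> E" "A \<in> alt_forms L sc" "supported_at p A" "card S < p"
    and "\<And>e. e \<in> E - S \<Longrightarrow> contract e A = 0"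
  shows "A = 0"
  using assms
proof (induction "card S" arbitrary: S p A)
  case 0
  then have "contract e A = 0" if "e \<in> E" for e using that by auto
  then have "scale_form (of_nat p) A = (\<Sum>e\<in>E. wedge (one_form (\<epsilon> e)) 0)"
    using euler_formula[OF 0(4,5)] by (metis (no_types, lifting) sum.cong)
  with \<open>card S < p\<close> show ?case by (simp add: fun_eq_iff scale_form_def sum_form_apply)
next
  case (Suc n)
  have "contract e A = 0" if e: "e \<in> E" for e
  proof (cases "e \<in> S")
    case True
    show ?thesis
    proof (rule Suc(1))
      show "n = card (S - {e})" using True Suc(2,3) by simp
      show "finite (S - {e})" "S - {e} \<subseteq> E" using Suc(3,4) by auto
      show "contract e A \<in> alt_forms L sc" by (intro contract_in_alt_forms Suc)
      show "supported_at (p - 1) (contract e A)" by (intro supported_at_contract Suc)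
      show "card (S - {e}) < p - 1" using True Suc(2,3,7) by simp
      fix e' assume "e' \<in> E - (S - {e})"
      then consider "e' = e" | "e' \<in> E - S" by blast
      then show "contract e' (contract e A) = 0"
      proof cases
        case 1 then show ?thesis using contract_contract_same[OF Suc(5)] by simp
      next
        case 2
        with Suc(8) have "contract e' A = 0" by blast
        then show ?thesis using contract_anticommute[OF Suc(5), of e' e] by simp
      qed
    qed
  qed (use e Suc(8) in auto)
  then have "scale_form (of_nat p) A = (\<Sum>e\<in>E. wedge (one_form (\<epsilon> e)) 0)"
    using euler_formula[OF Suc(5,6)] by (metis (no_types, lifting) sum.cong)
  with \<open>card S < p\<close> show ?case by (simp add: fun_eq_iff scale_form_def sum_form_apply)
qed

lemma alt_form_bounded:
  assumes A: "A \<in> alt_forms L sc" and "length xs > card E"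
  shows "A xs = 0"
proof -
  have "component (length xs) A \<in> alt_forms L sc" "supported_at (length xs) (component (length xs) A)"
    using component_in_homog_forms[OF A] by (simp_all add: homog_forms_iff)
  then have "component (length xs) A = 0"
    by (rule alt_form_zero_if_contract_zero[OF finite_E order_refl _ _ assms(2)]) simp
  from fun_cong[OF this, of xs] show ?thesis by (simp add: component_def)
qed

text \<open>
  In dual bases the Schouten bracket is \<open>[a \<bullet> b] = \<Sum>\<^sub>i\<^sub>j [\<epsilon>\<^sub>i, \<epsilon>\<^sub>j] \<and> \<iota>\<^sub>i a \<and> \<iota>\<^sub>j b\<close>; with the sign
  conventions of \<open>gerstenhaber_extension\<close> no sign depending on the degrees is needed.
\<close>

definition bracket_of :: "('l \<Rightarrow> 'l \<Rightarrow> 'l \<Rightarrow> complex) \<Rightarrow> 'l forms \<Rightarrow> 'l forms \<Rightarrow> 'l forms" where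
  "bracket_of \<beta> A B = (\<Sum>e\<in>E. \<Sum>f\<in>E. wedge (one_form (\<beta> e f)) (wedge (contract e A) (contract f B)))"

text \<open>Every summand is a product of contractions, so symmetry of the bracket reduces to graded
  commutativity of \<open>wedge\<close> and antisymmetry of \<open>\<beta>\<close>, and the Leibniz
  rule to the antiderivation rule for \<open>contract\<close>.\<close>

lemma gerstenhaber_extension_bracket_of:
  assumes alt: "\<And>e f. e \<in> E \<Longrightarrow> f \<in> E \<Longrightarrow> one_form (\<beta> e f) \<in> alt_forms L sc"
    and anti: "\<And>e f. e \<in> E \<Longrightarrow> f \<in> E \<Longrightarrow> \<beta> f e = (\<lambda>x. - \<beta> e f x)"
    and W: "\<And>F G x. F \<in> W \<Longrightarrow> G \<in> W \<Longrightarrow>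
      \<iota> (wb F G) x = (\<Sum>e\<in>E. \<Sum>f\<in>E. \<iota> F e * \<iota> G f * \<beta> e f x)"
  shows "gerstenhaber_extension L sc W wb \<iota> (bracket_of \<beta>)"
proof -
  have one: "bracket_of \<beta> (one_form (\<iota> F)) (one_form (\<iota> G)) = one_form (\<iota> (wb F G))"
    if "F \<in> W" "G \<in> W" for F G
  proof
    fix xs
    have "bracket_of \<beta> (one_form (\<iota> F)) (one_form (\<iota> G)) xs =
       (\<Sum>e\<in>E. \<Sum>f\<in>E. \<iota> F e * \<iota> G f * one_form (\<beta> e f) xs)"
      by (simp add: bracket_of_def sum_form_apply contract_one_form wedge_const_form_left
          wedge_const_form_right wedge_scale_right) (auto intro!: sum.cong simp: scale_form_def const_form_def one_form_def)
    also have "\<dots> = one_form (\<iota> (wb F G)) xs"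
      by (cases xs) (auto simp: one_form_def W[OF that] split: list.split)
    finally show "bracket_of \<beta> (one_form (\<iota> F)) (one_form (\<iota> G)) xs = one_form (\<iota> (wb F G)) xs" .
  qed
  have lin: "bracket_of \<beta> a (b + c) = bracket_of \<beta> a b + bracket_of \<beta> a c"
    "bracket_of \<beta> (a + b) c = bracket_of \<beta> a c + bracket_of \<beta> b c"
    "bracket_of \<beta> (scale_form k a) b = scale_form k (bracket_of \<beta> a b)"
    "bracket_of \<beta> a (scale_form k b) = scale_form k (bracket_of \<beta> a b)" for a b c k
    by (simp_all only: bracket_of_def contract_add contract_scale wedge_add_left wedge_add_right
        wedge_scale_left wedge_scale_right sum.distrib scale_form_sum)
  have alt_b: "bracket_of \<beta> a b \<in> alt_forms L sc" if "a \<in> alt_forms L sc" "b \<in> alt_forms L sc" for a b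
    unfolding bracket_of_def
    by (intro alt_forms_closed_sum wedge_in_alt_forms alt contract_in_alt_forms that)
  have deg: "if p + q = 0 then bracket_of \<beta> a b = 0 else bracket_of \<beta> a b \<in> homog_forms L sc (p + q - 1)"
    if "a \<in> homog_forms L sc p" "b \<in> homog_forms L sc q" for a b p q
  proof -
    have s: "supported_at p a" "supported_at q b" using that by (auto simp: homog_forms_iff)
    show ?thesis
    proof (cases "p = 0 \<or> q = 0")
      case True
      then have "wedge (contract e a) (contract f b) = 0" for e f
        using s contract_supported_at_0[of a e] contract_supported_at_0[of b f] by (elim disjE) simp_all
      then have "bracket_of \<beta> a b = (\<Sum>e\<in>E. \<Sum>f\<in>E. wedge (one_form (\<beta> e f)) 0)"
        by (simp only: bracket_of_def)
      then have "bracket_of \<beta> a b = 0" by (simp add: fun_eq_iff sum_form_apply)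
      then show ?thesis by (simp add: homog_forms_iff)
    next
      case False
      have "supported_at (1 + (p - 1 + (q - 1))) (bracket_of \<beta> a b)"
        unfolding bracket_of_def
        by (intro supported_at_sum supported_at_wedge supported_at_one_form supported_at_contract s)
      moreover have "1 + (p - 1 + (q - 1)) = p + q - 1" using False by auto
      ultimately show ?thesis using alt_b that False by (simp add: homog_forms_iff)
    qed
  qed
  have sym: "bracket_of \<beta> a b = - scale_form ((-1) ^ ((p + 1) * (q + 1))) (bracket_of \<beta> b a)"
    if "a \<in> homog_forms L sc p" "b \<in> homog_forms L sc q" for a b p q
  proof -
    have s: "supported_at p a" "supported_at q b" using that by (auto simp: homog_forms_iff)
    \<comment> \<open>The contractions have degrees p - 1 and q - 1, and (p - 1) (q - 1) has the
      parity of (p + 1) (q + 1). In degree 0 the contraction vanishes.\<close>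
    have c: "wedge (contract e a) (contract f b) =
        scale_form ((-1) ^ ((p + 1) * (q + 1))) (wedge (contract f b) (contract e a))" for e f
    proof (cases "p = 0 \<or> q = 0")
      case True
      then show ?thesis
        using s contract_supported_at_0[of a e] contract_supported_at_0[of b f] by (elim disjE) simp_all
    next
      case False
      then obtain p' q' where "p = Suc p'" "q = Suc q'" by (metis not0_implies_Suc)
      then show ?thesis
        using wedge_commute[OF supported_at_contract[OF s(1)] supported_at_contract[OF s(2)]]
        by (simp add: power_add power_mult)
    qed
    have b: "one_form (\<beta> e f) = - one_form (\<beta> f e)" if "e \<in> E" "f \<in> E" for e f
      using anti[OF that] by (auto simp: one_form_def fun_eq_iff split: list.split)
    have "bracket_of \<beta> a b = (\<Sum>e\<in>E. \<Sum>f\<in>E. - scale_form ((-1) ^ ((p + 1) * (q + 1)))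
        (wedge (one_form (\<beta> f e)) (wedge (contract f b) (contract e a))))"
      unfolding bracket_of_def
    proof (intro sum.cong refl)
      fix e f assume ef: "e \<in> E" "f \<in> E"
      show "wedge (one_form (\<beta> e f)) (wedge (contract e a) (contract f b)) =
        - scale_form ((-1) ^ ((p + 1) * (q + 1))) (wedge (one_form (\<beta> f e)) (wedge (contract f b) (contract e a)))"
        by (simp only: b[OF ef] c[of e f] wedge_minus_left wedge_scale_right scale_form_minus)
    qed
    also have "\<dots> = - scale_form ((-1) ^ ((p + 1) * (q + 1))) (bracket_of \<beta> b a)"
      unfolding bracket_of_def by (subst sum.swap) (simp only: sum_negf scale_form_sum)
    finally show ?thesis .
  qed
  have der: "bracket_of \<beta> a (wedge b c) = wedge (bracket_of \<beta> a b) c +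
      scale_form ((-1) ^ ((p + 1) * q)) (wedge b (bracket_of \<beta> a c))"
    if "a \<in> homog_forms L sc p" "b \<in> homog_forms L sc q" for a b c p q
  proof -
    have s: "supported_at p a" "supported_at q b" using that by (auto simp: homog_forms_iff)
    \<comment> \<open>\<open>bar_form\<close> contributes (-1)^q; moving \<open>b\<close> to the
      front, past a form of degree 1 + (p - 1), contributes (-1)^(p q).\<close>
    have m: "wedge (one_form (\<beta> e f)) (wedge (contract e a) (wedge (bar_form b) (contract f c))) =
      scale_form ((-1) ^ ((p + 1) * q)) (wedge b (wedge (one_form (\<beta> e f)) (wedge (contract e a) (contract f c))))" for e f
    proof (cases p)
      case 0
      with s(1) have "contract e a = 0" by (simp add: contract_supported_at_0)
      then show ?thesis
        by (simp only: wedge_zero_left wedge_zero_right scale_form_zero_right)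
    next
      case (Suc p')
      then have "supported_at p' (contract e a)" using supported_at_contract[OF s(1)] by simp
      from supported_at_wedge[OF supported_at_one_form this]
      have "supported_at p (wedge (one_form (\<beta> e f)) (contract e a))" using Suc by simp
      note w = wedge_commute[OF this s(2)]
      have "wedge (one_form (\<beta> e f)) (wedge (contract e a) (wedge (bar_form b) (contract f c))) =
          scale_form ((-1) ^ q) (wedge (wedge (wedge (one_form (\<beta> e f)) (contract e a)) b) (contract f c))"
        by (simp only: bar_form_supported_at[OF s(2)] wedge_assoc wedge_scale_left wedge_scale_right)
      also have "\<dots> = scale_form ((-1) ^ q * (-1) ^ (p * q))
          (wedge b (wedge (one_form (\<beta> e f)) (wedge (contract e a) (contract f c))))"
        unfolding w by (simp only: wedge_scale_left scale_form_scale_form wedge_assoc)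
      also have "(-1) ^ q * (-1) ^ (p * q) = ((-1) ^ ((p + 1) * q) :: complex)"
        by (simp add: power_add)
      finally show ?thesis .
    qed
    show ?thesis
      by (simp only: bracket_of_def contract_wedge wedge_add_right sum.distrib m wedge_sum_left
          wedge_sum_right wedge_assoc scale_form_sum)
  qed
  show ?thesis
    unfolding gerstenhaber_extension_def
    by (intro conjI ballI allI one lin deg sym der)
qed

text \<open>The Leibniz rule concerns the second argument. For a fixed homogeneous first argument,
  \<open>step\<close> reduces the second to coordinate forms; graded symmetry then exchanges the
  arguments, and \<open>step\<close> applies again. On coordinate forms the bracket is
  prescribed.\<close>

lemma gerstenhaber_extension_unique:
  assumes B: "gerstenhaber_extension L sc W wb \<iota> B" and B': "gerstenhaber_extension L sc W wb \<iota> B'"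
    and W: "\<And>e. e \<in> E \<Longrightarrow> \<exists>F\<in>W. \<iota> F = \<epsilon> e"
    and a: "a \<in> alt_forms L sc" and b: "b \<in> alt_forms L sc"
  shows "B a b = B' a b"
proof -
  have scale: "B a (scale_form k b) = scale_form k (B a b)"
    if "gerstenhaber_extension L sc W wb \<iota> B" "a \<in> alt_forms L sc" "b \<in> alt_forms L sc" for B a b k
    using that unfolding gerstenhaber_extension_def by blast
  have anti: "B a b = - scale_form ((-1) ^ ((p + 1) * (q + 1))) (B b a)"
    if "gerstenhaber_extension L sc W wb \<iota> B" "a \<in> homog_forms L sc p" "b \<in> homog_forms L sc q" for B a b p q
    using that unfolding gerstenhaber_extension_def by blast
  have der: "B a (wedge b c) = wedge (B a b) c + scale_form ((-1) ^ ((p + 1) * q)) (wedge b (B a c))"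
    if "gerstenhaber_extension L sc W wb \<iota> B" "a \<in> homog_forms L sc p" "b \<in> homog_forms L sc q" "c \<in> alt_forms L sc"
    for B a b c p q
    using that unfolding gerstenhaber_extension_def by blast
  have const: "B a (const_form k) = 0"
    if "gerstenhaber_extension L sc W wb \<iota> B" "a \<in> homog_forms L sc p" for B a p k
  proof -
    have h: "const_form 1 \<in> homog_forms L sc 0" by (simp add: homog_forms_iff) (simp add: supported_at_def const_form_def)
    have aa: "a \<in> alt_forms L sc" using that(2) by (simp add: homog_forms_iff)
    \<comment> \<open>The unit is idempotent, so the Leibniz rule writes its bracket as twice
      itself.\<close>
    have "B a (wedge (const_form 1) (const_form 1)) = B a (const_form 1) + B a (const_form 1)"
      using der[OF that(1,2) h const_form_in_alt_forms, of 1]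
      by (simp add: wedge_const_form_left wedge_const_form_right)
    then have "B a (const_form 1) = 0"
      by (simp add: wedge_const_form_left)
    then show ?thesis
      using scale[OF that(1) aa const_form_in_alt_forms, of k 1] const_form_eq_scale[of k] scale_form_zero_right[of k] by metis
  qed
  have step: "B a b = B' a b"
    if a: "a \<in> homog_forms L sc p" and gen: "\<And>e. e \<in> E \<Longrightarrow> B a (one_form (\<epsilon> e)) = B' a (one_form (\<epsilon> e))"
      and b: "b \<in> homog_forms L sc q" for a b p q
    using b
  proof (induction q arbitrary: b)
    case 0
    then have "b = const_form (b [])" by (simp add: homog_forms_iff supported_at_0_eq)
    then show ?case using const[OF B a] const[OF B' a] by metis
  next
    case (Suc q)
    have aa: "a \<in> alt_forms L sc" and bb: "b \<in> alt_forms L sc" "supported_at (Suc q) b"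
      using a Suc.prems by (auto simp: homog_forms_iff)
    have eb: "contract e b \<in> homog_forms L sc q" "contract e b \<in> alt_forms L sc" for e
      using bb supported_at_contract[of "Suc q" b e] contract_in_alt_forms[of b]
      by (auto simp: homog_forms_iff)
    have ee: "one_form (\<epsilon> e) \<in> homog_forms L sc 1" if "e \<in> E" for e
      using coord_form_in_alt_forms[OF that] supported_at_one_form by (simp add: homog_forms_iff)
    have w: "wedge (one_form (\<epsilon> e)) (contract e b) \<in> alt_forms L sc" if "e \<in> E" for e
      using wedge_in_alt_forms coord_form_in_alt_forms[OF that] eb by blast
    have "B a (wedge (one_form (\<epsilon> e)) (contract e b)) = B' a (wedge (one_form (\<epsilon> e)) (contract e b))"
      if e: "e \<in> E" for e
      by (simp only: der[OF B a ee[OF e] eb(2)] der[OF B' a ee[OF e] eb(2)] gen[OF e] Suc.IH[OF eb(1)])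
    \<comment> \<open>By the Euler formula the products add up to a nonzero multiple of
      \<open>b\<close>, which can be cancelled.\<close>
    then have "B a (scale_form (of_nat (Suc q)) b) = B' a (scale_form (of_nat (Suc q)) b)"
      unfolding euler_formula[OF bb, symmetric]
      using gerstenhaber_sum[OF B aa w finite_E] gerstenhaber_sum[OF B' aa w finite_E] by (auto intro!: sum.cong)
    then have "scale_form (of_nat (Suc q)) (B a b) = scale_form (of_nat (Suc q)) (B' a b)"
      by (simp only: scale[OF B aa bb(1)] scale[OF B' aa bb(1)])
    then show ?case by (simp add: scale_form_def fun_eq_iff del: of_nat_Suc)
  qed
  have ee: "one_form (\<epsilon> e) \<in> homog_forms L sc 1" if "e \<in> E" for e
    using coord_form_in_alt_forms[OF that] supported_at_one_form by (simp add: homog_forms_iff)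
  have gen: "B (one_form (\<epsilon> e)) (one_form (\<epsilon> f)) = B' (one_form (\<epsilon> e)) (one_form (\<epsilon> f))"
    if ef: "e \<in> E" "f \<in> E" for e f
  proof -
    obtain F G where "F \<in> W" "G \<in> W" "\<iota> F = \<epsilon> e" "\<iota> G = \<epsilon> f" using W[OF ef(1)] W[OF ef(2)] by blast
    then show ?thesis using B B' unfolding gerstenhaber_extension_def by metis
  qed
  have hom: "B a b = B' a b" if a: "a \<in> homog_forms L sc p" and b: "b \<in> homog_forms L sc q" for a b p q
  proof (rule step[OF a _ b])
    fix e assume e: "e \<in> E"
    have "B (one_form (\<epsilon> e)) a = B' (one_form (\<epsilon> e)) a"
      by (rule step[OF ee[OF e] gen[OF e] a])
    then show "B a (one_form (\<epsilon> e)) = B' a (one_form (\<epsilon> e))"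
      by (simp only: anti[OF B a ee[OF e]] anti[OF B' a ee[OF e]])
  qed
  have "B a b = (\<Sum>n\<le>card E. \<Sum>m\<le>card E. B (component n a) (component m b))"
    "B' a b = (\<Sum>n\<le>card E. \<Sum>m\<le>card E. B' (component n a) (component m b))"
    by (rule gerstenhaber_components[OF B] gerstenhaber_components[OF B'];
        use a b alt_form_bounded in blast)+
  moreover have "B (component n a) (component m b) = B' (component n a) (component m b)" for n m
    by (rule hom[OF component_in_homog_forms[OF a] component_in_homog_forms[OF b]])
  ultimately show ?thesis by (simp only:)
qed

end

section \<open>Isomorphisms of differential Gerstenhaber algebras\<close>

text \<open>The maps are inverse on the carriers only, since the types of forms also contain
  functions that are not alternating.\<close>

definition dga_isomorphic :: "'a::ab_group_add dga \<Rightarrow> 'b::ab_group_add dga \<Rightarrow> bool" where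
  "dga_isomorphic A B \<longleftrightarrow> (\<exists>\<phi> \<psi>. dga_hom A B \<phi> \<and> dga_hom B A \<psi> \<and>
     (\<forall>a\<in>dga_carrier A. \<psi> (\<phi> a) = a) \<and> (\<forall>b\<in>dga_carrier B. \<phi> (\<psi> b) = b))"

lemma dga_isomorphic_sym: "dga_isomorphic A B \<Longrightarrow> dga_isomorphic B A"
  unfolding dga_isomorphic_def by blast

lemma dga_hom_compose: "dga_hom A B f \<Longrightarrow> dga_hom B C g \<Longrightarrow> dga_hom A C (g \<circ> f)"
  unfolding dga_hom_def by simp

lemma dga_isomorphic_trans:
  assumes "dga_isomorphic A B" "dga_isomorphic B C"
  shows "dga_isomorphic A C"
proof -
  obtain f f' g g' where fg: "dga_hom A B f" "dga_hom B A f'" "dga_hom B C g" "dga_hom C B g'"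
    and "\<forall>a\<in>dga_carrier A. f' (f a) = a" "\<forall>b\<in>dga_carrier B. f (f' b) = b"
    "\<forall>b\<in>dga_carrier B. g' (g b) = b" "\<forall>c\<in>dga_carrier C. g (g' c) = c"
    using assms unfolding dga_isomorphic_def by blast
  moreover have "\<forall>a\<in>dga_carrier A. f a \<in> dga_carrier B" "\<forall>c\<in>dga_carrier C. g' c \<in> dga_carrier B"
    using fg by (auto simp: dga_hom_def)
  ultimately show ?thesis
    unfolding dga_isomorphic_def using dga_hom_compose[OF fg(1,3)] dga_hom_compose[OF fg(4,2)]
    by (intro exI[of _ "g \<circ> f"] exI[of _ "f' \<circ> g'"]) simp
qed

section \<open>Isomorphic algebras are quasi-isomorphic\<close>

definition additive_complex :: "'a::ab_group_add dga \<Rightarrow> bool" where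
  "additive_complex A \<longleftrightarrow> 0 \<in> dga_carrier A \<and>
     (\<forall>a\<in>dga_carrier A. - a \<in> dga_carrier A \<and>
        (\<forall>b\<in>dga_carrier A. a + b \<in> dga_carrier A \<and> dga_diff A (a + b) = dga_diff A a + dga_diff A b))"

lemma additive_complex_diff_zero: "additive_complex A \<Longrightarrow> dga_diff A 0 = 0"
proof -
  assume "additive_complex A"
  then have "dga_diff A (0 + 0) = dga_diff A 0 + dga_diff A 0" unfolding additive_complex_def by blast
  then show ?thesis by (simp only: add_0_right add_cancel_right_right)
qed

lemma additive_complex_diff_minus:
  assumes "additive_complex A" "a \<in> dga_carrier A"
  shows "dga_diff A (- a) = - dga_diff A a"
proof -
  have "dga_diff A (a + - a) = dga_diff A a + dga_diff A (- a)" using assms unfolding additive_complex_def by blast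
  then show ?thesis using additive_complex_diff_zero[OF assms(1)] by (simp add: add_eq_0_iff)
qed

lemma equiv_cohomologous:
  assumes A: "additive_complex A"
  shows "equiv (cocycles A) (cohomologous A)"
proof (rule equivI)
  show "cohomologous A \<subseteq> cocycles A \<times> cocycles A" by (auto simp: cohomologous_def)
  show "refl_on (cocycles A) (cohomologous A)"
  proof (rule refl_onI)
    have "0 = dga_diff A 0" "0 \<in> dga_carrier A"
      using A additive_complex_diff_zero[OF A] by (auto simp: additive_complex_def)
    then show "(a, a) \<in> cohomologous A" if "a \<in> cocycles A" for a
      using that unfolding cohomologous_def by (simp only: mem_Collect_eq case_prod_conv diff_self) blast
  qed
  show "sym (cohomologous A)"
  proof (rule symI)
    fix a b assume ab: "(a, b) \<in> cohomologous A"
    then obtain c where c: "c \<in> dga_carrier A" "a - b = dga_diff A c" by (auto simp: cohomologous_def)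
    have "b - a = dga_diff A (- c)"
      using additive_complex_diff_minus[OF A c(1)] c(2) by (metis minus_diff_eq)
    moreover have "- c \<in> dga_carrier A" using A c(1) by (simp add: additive_complex_def)
    ultimately show "(b, a) \<in> cohomologous A" using ab by (auto simp: cohomologous_def)
  qed
  show "trans (cohomologous A)"
  proof (rule transI)
    fix a b c assume ab: "(a, b) \<in> cohomologous A" and bc: "(b, c) \<in> cohomologous A"
    obtain x y where x: "x \<in> dga_carrier A" "a - b = dga_diff A x"
      and y: "y \<in> dga_carrier A" "b - c = dga_diff A y"
      using ab bc by (auto simp: cohomologous_def)
    have "a - c = (a - b) + (b - c)" by simp
    also have "\<dots> = dga_diff A (x + y)" using A x y unfolding additive_complex_def by simp
    finally have "a - c = dga_diff A (x + y)" .
    moreover have "x + y \<in> dga_carrier A" using A x(1) y(1) by (simp add: additive_complex_def)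
    ultimately show "(a, c) \<in> cohomologous A" using ab bc by (auto simp: cohomologous_def)
  qed
qed

lemma dga_hom_zero:
  assumes "dga_hom A B \<phi>" "additive_complex A"
  shows "\<phi> 0 = 0"
proof -
  have "\<phi> (0 + 0) = \<phi> 0 + \<phi> 0"
    using assms unfolding dga_hom_def additive_complex_def by blast
  then show ?thesis by (simp only: add_0_right add_cancel_right_right)
qed

lemma dga_hom_diff:
  assumes "dga_hom A B \<phi>" "additive_complex A" "a \<in> dga_carrier A" "b \<in> dga_carrier A"
  shows "\<phi> (a - b) = \<phi> a - \<phi> b" "a - b \<in> dga_carrier A"
proof -
  have "- b \<in> dga_carrier A" and ab: "a + - b \<in> dga_carrier A"
    using assms unfolding additive_complex_def by blast+
  have "\<phi> (a + - b) = \<phi> a + \<phi> (- b)" "\<phi> (b + - b) = \<phi> b + \<phi> (- b)"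
    using assms \<open>- b \<in> dga_carrier A\<close> unfolding dga_hom_def by blast+
  then show "\<phi> (a - b) = \<phi> a - \<phi> b"
    using dga_hom_zero[OF assms(1,2)] by (simp add: eq_neg_iff_add_eq_0 add.commute)
  show "a - b \<in> dga_carrier A" using ab by simp
qed

lemma dga_hom_cohomologous:
  assumes h: "dga_hom A B \<phi>" and A: "additive_complex A" and ab: "(a, b) \<in> cohomologous A"
  shows "(\<phi> a, \<phi> b) \<in> cohomologous B"
proof -
  from ab obtain c where c: "c \<in> dga_carrier A" "a - b = dga_diff A c"
    and a: "a \<in> dga_carrier A" "b \<in> dga_carrier A" and d: "dga_diff A a = 0" "dga_diff A b = 0"
    by (auto simp: cohomologous_def cocycles_def)
  have "\<phi> a - \<phi> b = dga_diff B (\<phi> c)" "\<phi> c \<in> dga_carrier B"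
    using dga_hom_diff[OF h A a] c h unfolding dga_hom_def by metis+
  moreover have "\<phi> x \<in> cocycles B" if "x \<in> dga_carrier A" "dga_diff A x = 0" for x
    using that h dga_hom_zero[OF h A] unfolding dga_hom_def cocycles_def by force
  ultimately show ?thesis using a d by (auto simp: cohomologous_def)
qed

text \<open>The inverse map also preserves cohomologous pairs, so the image of a class is a whole
  class. The induced map is therefore the plain image, and taking images under \<open>\<psi>\<close>
  inverts it.\<close>

lemma quasi_isomorphic_if_isomorphic:
  assumes "dga_isomorphic A B" "additive_complex A" "additive_complex B"
  shows "quasi_isomorphic A B"
proof -
  obtain \<phi> \<psi> where h: "dga_hom A B \<phi>" "dga_hom B A \<psi>"
    and inv: "\<And>a. a \<in> dga_carrier A \<Longrightarrow> \<psi> (\<phi> a) = a" "\<And>b. b \<in> dga_carrier B \<Longrightarrow> \<phi> (\<psi> b) = b"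
    using assms(1) unfolding dga_isomorphic_def by blast
  note c = dga_hom_cohomologous[OF h(1) assms(2)] dga_hom_cohomologous[OF h(2) assms(3)]
  have carr: "(a, b) \<in> cohomologous A \<Longrightarrow> a \<in> dga_carrier A \<and> b \<in> dga_carrier A"
    "(x, y) \<in> cohomologous B \<Longrightarrow> x \<in> dga_carrier B \<and> y \<in> dga_carrier B" for a b x y
    by (auto simp: cohomologous_def cocycles_def)
  note eA = equiv_cohomologous[OF assms(2)] and eB = equiv_cohomologous[OF assms(3)]
  have cls: "\<phi> ` (cohomologous A `` {a}) = cohomologous B `` {\<phi> a}" if a: "a \<in> cocycles A" for a
  proof (intro equalityI subsetI)
    fix y assume "y \<in> \<phi> ` (cohomologous A `` {a})"
    then show "y \<in> cohomologous B `` {\<phi> a}" using c(1) by blast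
  next
    fix y assume y: "y \<in> cohomologous B `` {\<phi> a}"
    then have "(\<psi> (\<phi> a), \<psi> y) \<in> cohomologous A" using c(2) by blast
    then have "(a, \<psi> y) \<in> cohomologous A" using a inv(1) by (simp add: cocycles_def)
    moreover have "y = \<phi> (\<psi> y)" using y carr(2) inv(2) by (metis Image_singleton_iff)
    ultimately show "y \<in> \<phi> ` (cohomologous A `` {a})" by blast
  qed
  have img: "cohomologous B `` (\<phi> ` X) = \<phi> ` X" if X: "X \<in> cohomology A" for X
  proof -
    obtain a where a: "a \<in> cocycles A" "X = cohomologous A `` {a}"
      using X unfolding cohomology_def by (rule quotientE)
    have t: "trans (cohomologous B)" and s: "sym (cohomologous B)" using eB by (auto elim: equivE)
    have "cohomologous B `` (cohomologous B `` {\<phi> a}) = cohomologous B `` {\<phi> a}"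
    proof (intro equalityI subsetI)
      fix z assume "z \<in> cohomologous B `` {\<phi> a}"
      then have z: "(\<phi> a, z) \<in> cohomologous B" by simp
      then have "(z, z) \<in> cohomologous B" using transD[OF t] symD[OF s] by blast
      with z show "z \<in> cohomologous B `` (cohomologous B `` {\<phi> a})" by blast
    qed (use transD[OF t] in blast)
    with a cls show ?thesis by simp
  qed
  have "bij_betw (\<lambda>X. cohomologous B `` (\<phi> ` X)) (cohomology A) (cohomology B)"
  proof (rule bij_betwI[where g = "\<lambda>Y. \<psi> ` Y"])
    have coc: "a \<in> cocycles A \<Longrightarrow> \<phi> a \<in> cocycles B" "b \<in> cocycles B \<Longrightarrow> \<psi> b \<in> cocycles A" for a b
    proof -
      have "(a, a) \<in> cohomologous A" if "a \<in> cocycles A"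
        using eA that by (auto elim!: equivE dest: refl_onD)
      then have "(\<phi> a, \<phi> a) \<in> cohomologous B" if "a \<in> cocycles A" using c(1) that by blast
      then show "a \<in> cocycles A \<Longrightarrow> \<phi> a \<in> cocycles B" unfolding cohomologous_def by blast
      have "(b, b) \<in> cohomologous B" if "b \<in> cocycles B"
        using eB that by (auto elim!: equivE dest: refl_onD)
      then have "(\<psi> b, \<psi> b) \<in> cohomologous A" if "b \<in> cocycles B" using c(2) that by blast
      then show "b \<in> cocycles B \<Longrightarrow> \<psi> b \<in> cocycles A" unfolding cohomologous_def by blast
    qed
    show "(\<lambda>X. cohomologous B `` (\<phi> ` X)) \<in> cohomology A \<rightarrow> cohomology B"
    proof
      fix X assume X: "X \<in> cohomology A"
      then obtain a where "a \<in> cocycles A" "X = cohomologous A `` {a}"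
        unfolding cohomology_def by (rule quotientE)
      with cls coc(1) show "cohomologous B `` (\<phi> ` X) \<in> cohomology B"
        unfolding img[OF X] by (auto simp: cohomology_def intro: quotientI)
    qed
    have sub: "X \<in> cohomology A \<Longrightarrow> X \<subseteq> dga_carrier A" "Y \<in> cohomology B \<Longrightarrow> Y \<subseteq> dga_carrier B" for X Y
      using carr by (auto simp: cohomology_def quotient_def)
    show "\<psi> ` (cohomologous B `` (\<phi> ` X)) = X" if "X \<in> cohomology A" for X
      unfolding img[OF that] using sub(1)[OF that] inv(1) by (force simp: image_image)
    have inve: "\<psi> ` Y \<in> cohomology A" if Y: "Y \<in> cohomology B" for Y
    proof -
      obtain b where b: "b \<in> cocycles B" "Y = cohomologous B `` {b}"
        using Y unfolding cohomology_def by (rule quotientE)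
      have "\<phi> ` (cohomologous A `` {\<psi> b}) = Y"
        using cls[OF coc(2)[OF b(1)]] b inv(2) by (simp add: cocycles_def)
      then have "\<psi> ` Y = (\<lambda>x. \<psi> (\<phi> x)) ` (cohomologous A `` {\<psi> b})" by (auto simp: image_image)
      also have "\<dots> = cohomologous A `` {\<psi> b}"
        using carr(1) inv(1) by (force simp: image_iff)
      finally show ?thesis using coc(2)[OF b(1)] by (auto simp: cohomology_def intro: quotientI)
    qed
    then show "(\<lambda>Y. \<psi> ` Y) \<in> cohomology B \<rightarrow> cohomology A" by blast
    show "cohomologous B `` (\<phi> ` \<psi> ` Y) = Y" if "Y \<in> cohomology B" for Y
      unfolding img[OF inve[OF that]] using sub(2)[OF that] inv(2) by (force simp: image_image)
  qed
  then show ?thesis using h(1) unfolding quasi_isomorphic_def quasi_isomorphism_def by blast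
qed

lemma ce_diff_add: "ce_diff L lb (A + B) = ce_diff L lb A + ce_diff L lb B"
  by (auto simp: ce_diff_def fun_eq_iff distrib_left sum.distrib case_prod_unfold)

lemma additive_complex_exterior_dga: "additive_complex (exterior_dga L sc lb W wb \<iota>)"
  by (simp add: additive_complex_def exterior_dga_def alt_forms_closed_add alt_forms_closed_minus ce_diff_add)

text \<open>The data that carry a whole algebra over: \<open>\<psi>\<close> transports the Lie
  algebra on which the forms live, \<open>\<theta>\<close> the one that prescribes the bracket in
  degree one, and \<open>iota_eq\<close> says that they respect the pairings. The maps run from the
  primed side to the unprimed one because forms are pulled back.\<close>

locale exterior_iso = A: complex_subspace L sc + A': complex_subspace L' sc'
  for L :: "'l::ab_group_add set" and sc and L' :: "'m::ab_group_add set" and sc' +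
  fixes lb :: "'l \<Rightarrow> 'l \<Rightarrow> 'l" and lb' :: "'m \<Rightarrow> 'm \<Rightarrow> 'm"
    and W :: "'w set" and wb and \<iota> :: "'w \<Rightarrow> 'l \<Rightarrow> complex"
    and W' :: "'u set" and wb' and \<iota>' :: "'u \<Rightarrow> 'm \<Rightarrow> complex" and \<psi> \<psi>' \<theta> \<theta>'
  assumes psi_mem: "x \<in> L' \<Longrightarrow> \<psi> x \<in> L" and psi'_mem: "z \<in> L \<Longrightarrow> \<psi>' z \<in> L'"
    and psi_inv: "x \<in> L' \<Longrightarrow> \<psi>' (\<psi> x) = x" and psi'_inv: "z \<in> L \<Longrightarrow> \<psi> (\<psi>' z) = z"
    and psi_add: "x \<in> L' \<Longrightarrow> y \<in> L' \<Longrightarrow> \<psi> (x + y) = \<psi> x + \<psi> y"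
    and psi_scale: "x \<in> L' \<Longrightarrow> \<psi> (sc' c x) = sc c (\<psi> x)"
    and lb_closed: "x \<in> L' \<Longrightarrow> y \<in> L' \<Longrightarrow> lb' x y \<in> L'"
    and psi_lb: "x \<in> L' \<Longrightarrow> y \<in> L' \<Longrightarrow> \<psi> (lb' x y) = lb (\<psi> x) (\<psi> y)"
    and theta_mem: "F \<in> W' \<Longrightarrow> \<theta> F \<in> W" and theta'_mem: "H \<in> W \<Longrightarrow> \<theta>' H \<in> W'"
    and theta_inv: "F \<in> W' \<Longrightarrow> \<theta>' (\<theta> F) = F" and theta'_inv: "H \<in> W \<Longrightarrow> \<theta> (\<theta>' H) = H"
    and wb_closed: "F \<in> W' \<Longrightarrow> G \<in> W' \<Longrightarrow> wb' F G \<in> W'"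
    and theta_wb: "F \<in> W' \<Longrightarrow> G \<in> W' \<Longrightarrow> \<theta> (wb' F G) = wb (\<theta> F) (\<theta> G)"
    and iota_out: "H \<in> W \<Longrightarrow> z \<notin> L \<Longrightarrow> \<iota> H z = 0" and iota'_out: "F \<in> W' \<Longrightarrow> x \<notin> L' \<Longrightarrow> \<iota>' F x = 0"
    and iota_eq: "F \<in> W' \<Longrightarrow> x \<in> L' \<Longrightarrow> \<iota>' F x = \<iota> (\<theta> F) (\<psi> x)"
begin

text \<open>Turns every fact about \<open>pull\<close> into one about its inverse, which appears
  below as \<open>R.pull\<close>.\<close>

lemma flip: "exterior_iso L' sc' L sc lb' lb W' wb' \<iota>' W wb \<iota> \<psi>' \<psi> \<theta>' \<theta>"
proof
  show "x \<in> L \<Longrightarrow> \<psi>' x \<in> L'" "x \<in> L \<Longrightarrow> \<psi> (\<psi>' x) = x" for x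
    using psi'_mem psi'_inv by blast+
  show "y \<in> L' \<Longrightarrow> \<psi> y \<in> L" "y \<in> L' \<Longrightarrow> \<psi>' (\<psi> y) = y" for y
    using psi_mem psi_inv by blast+
  show "F \<in> W \<Longrightarrow> \<theta>' F \<in> W'" "F \<in> W \<Longrightarrow> \<theta> (\<theta>' F) = F" "F \<in> W \<Longrightarrow> z \<notin> L \<Longrightarrow> \<iota> F z = 0" for F z
    using theta'_mem theta'_inv iota_out by blast+
  show "G \<in> W' \<Longrightarrow> \<theta> G \<in> W" "G \<in> W' \<Longrightarrow> \<theta>' (\<theta> G) = G" "G \<in> W' \<Longrightarrow> y \<notin> L' \<Longrightarrow> \<iota>' G y = 0" for G y
    using theta_mem theta_inv iota'_out by blast+
  fix x y c F G
  show "\<iota> F x = \<iota>' (\<theta>' F) (\<psi>' x)" if "F \<in> W" "x \<in> L"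
    using that iota_eq theta'_mem psi'_mem theta'_inv psi'_inv by metis
  show "\<psi>' (sc c x) = sc' c (\<psi>' x)" if "x \<in> L"
    using that psi_scale psi'_mem psi_inv psi'_inv A'.scale_closed by metis
  show "wb F G \<in> W" "\<theta>' (wb F G) = wb' (\<theta>' F) (\<theta>' G)" if "F \<in> W" "G \<in> W"
    using that theta_wb wb_closed theta'_mem theta_mem theta_inv theta'_inv by metis+
  assume xy: "x \<in> L" "y \<in> L"
  show "\<psi>' (x + y) = \<psi>' x + \<psi>' y"
    using xy psi_add psi'_mem psi_inv psi'_inv A'.add_closed by metis
  show "lb x y \<in> L" "\<psi>' (lb x y) = lb' (\<psi>' x) (\<psi>' y)"
    using xy psi_lb lb_closed psi'_mem psi_mem psi_inv psi'_inv by metis+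
qed

definition pull :: "'l forms \<Rightarrow> 'm forms" where
  "pull A = (\<lambda>xs. if set xs \<subseteq> L' then A (map \<psi> xs) else 0)"

lemma map_psi: "set xs \<subseteq> L' \<Longrightarrow> set (map \<psi> xs) \<subseteq> L"
  using psi_mem by auto

lemma pull_in_alt_forms:
  assumes "A \<in> alt_forms L sc"
  shows "pull A \<in> alt_forms L' sc'"
proof (rule A'.alt_formsI)
  fix xs ys x y c
  show "\<not> set xs \<subseteq> L' \<Longrightarrow> pull A xs = 0" by (simp add: pull_def)
  show "pull A (xs @ x # x # ys) = 0"
    using alt_forms_alternating[OF assms, of "map \<psi> xs" "\<psi> x" "[]" "map \<psi> ys"] by (simp add: pull_def)
  assume *: "x \<in> L'" "set xs \<subseteq> L'" "set ys \<subseteq> L'"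
  show "pull A (xs @ sc' c x # ys) = c * pull A (xs @ x # ys)"
    using * alt_forms_scale[OF assms psi_mem[OF *(1)] map_psi[OF *(2)] map_psi[OF *(3)]]
    by (simp add: pull_def A'.scale_closed psi_scale)
  assume **: "y \<in> L'"
  show "pull A (xs @ (x + y) # ys) = pull A (xs @ x # ys) + pull A (xs @ y # ys)"
    using * ** alt_forms_add[OF assms psi_mem[OF *(1)] psi_mem[OF **] map_psi[OF *(2)] map_psi[OF *(3)]]
    by (simp add: pull_def A'.add_closed psi_add)
qed

lemma pull_in_homog_forms: "A \<in> homog_forms L sc n \<Longrightarrow> pull A \<in> homog_forms L' sc' n"
  using pull_in_alt_forms by (auto simp: homog_forms_def pull_def)

lemma pull_add: "pull (A + B) = pull A + pull B"
  by (auto simp: pull_def fun_eq_iff)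

lemma pull_scale: "pull (scale_form c A) = scale_form c (pull A)"
  by (auto simp: pull_def scale_form_def)

lemma pull_minus: "pull (- A) = - pull A"
  by (auto simp: pull_def fun_eq_iff)

lemma pull_zero: "pull 0 = 0"
  by (auto simp: pull_def fun_eq_iff)

lemma set_nths_subset': "set xs \<subseteq> M \<Longrightarrow> set (nths xs S) \<subseteq> M"
  by (rule order_trans[OF set_nths_subset])

lemma pull_wedge: "pull (wedge A B) = wedge (pull A) (pull B)"
proof
  fix xs
  show "pull (wedge A B) xs = wedge (pull A) (pull B) xs"
  proof (cases "set xs \<subseteq> L'")
    case True
    then show ?thesis by (simp add: pull_def wedge_def nths_map[symmetric] set_nths_subset')
  next
    case False
    \<comment> \<open>Whatever the shuffle, an entry outside \<open>L'\<close> reaches one of the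
      two factors.\<close>
    then have "\<not> set (nths xs S) \<subseteq> L' \<or> \<not> set (nths xs (- S)) \<subseteq> L'" for S
      by (fastforce simp: set_nths in_set_conv_nth)
    then have "wedge (pull A) (pull B) xs = 0"
      unfolding wedge_def pull_def by (intro sum.neutral ballI) auto
    with False show ?thesis by (simp add: pull_def)
  qed
qed

lemma pull_ce_diff: "pull (ce_diff L lb A) = ce_diff L' lb' (pull A)"
proof
  fix xs
  show "pull (ce_diff L lb A) xs = ce_diff L' lb' (pull A) xs"
  proof (cases "set xs \<subseteq> L'")
    case True
    have "A (lb (\<psi> (xs ! i)) (\<psi> (xs ! j)) # nths (map \<psi> xs) (- {i, j})) =
      pull A (lb' (xs ! i) (xs ! j) # nths xs (- {i, j}))" if "i < j" "j < length xs" for i j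
    proof -
      have "xs ! i \<in> L'" "xs ! j \<in> L'" using True that by (auto simp: subset_eq)
      then show ?thesis using True by (simp add: pull_def psi_lb lb_closed set_nths_subset' nths_map)
    qed
    then show ?thesis using True map_psi[OF True] by (auto simp: pull_def ce_diff_def intro!: sum.cong)
  qed (simp add: pull_def ce_diff_def)
qed

lemma pull_one_form: "F \<in> W' \<Longrightarrow> pull (one_form (\<iota> (\<theta> F))) = one_form (\<iota>' F)"
  using iota_eq iota'_out by (auto simp: pull_def one_form_def fun_eq_iff split: list.split)

end

context exterior_iso
begin

sublocale R: exterior_iso L' sc' L sc lb' lb W' wb' \<iota>' W wb \<iota> \<psi>' \<psi> \<theta>' \<theta>
  by (rule flip)

lemma pull_R_pull: "A \<in> alt_forms L' sc' \<Longrightarrow> pull (R.pull A) = A"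
proof
  fix xs assume A: "A \<in> alt_forms L' sc'"
  show "pull (R.pull A) xs = A xs"
  proof (cases "set xs \<subseteq> L'")
    case True
    then have "map (\<psi>' \<circ> \<psi>) xs = xs" using psi_inv by (auto intro!: map_idI)
    then show ?thesis using True map_psi[OF True] by (simp add: pull_def R.pull_def)
  qed (simp add: pull_def alt_forms_outside[OF A])
qed

end

context exterior_iso
begin

lemma R_pull_pull: "A \<in> alt_forms L sc \<Longrightarrow> R.pull (pull A) = A"
proof
  fix xs assume A: "A \<in> alt_forms L sc"
  show "R.pull (pull A) xs = A xs"
  proof (cases "set xs \<subseteq> L")
    case True
    then have "map (\<psi> \<circ> \<psi>') xs = xs" using psi'_inv by (auto intro!: map_idI)
    then show ?thesis using True R.map_psi[OF True] by (simp add: pull_def R.pull_def)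
  qed (simp add: R.pull_def alt_forms_outside[OF A])
qed

lemma gerstenhaber_extension_transport:
  assumes B: "gerstenhaber_extension L sc W wb \<iota> B"
  shows "gerstenhaber_extension L' sc' W' wb' \<iota>' (\<lambda>a b. pull (B (R.pull a) (R.pull b)))"
  unfolding gerstenhaber_extension_def
proof (intro conjI ballI allI)
  fix F G assume F: "F \<in> W'" and G: "G \<in> W'"
  have "R.pull (one_form (\<iota>' F)) = one_form (\<iota> (\<theta> F))" if "F \<in> W'" for F
    using R.pull_one_form[OF theta_mem[OF that]] theta_inv[OF that] by simp
  moreover have "B (one_form (\<iota> (\<theta> F))) (one_form (\<iota> (\<theta> G))) = one_form (\<iota> (wb (\<theta> F) (\<theta> G)))"
    using B theta_mem[OF F] theta_mem[OF G] unfolding gerstenhaber_extension_def by blast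
  ultimately show "pull (B (R.pull (one_form (\<iota>' F))) (R.pull (one_form (\<iota>' G)))) = one_form (\<iota>' (wb' F G))"
    using F G pull_one_form[OF wb_closed[OF F G]] theta_wb[OF F G] by simp
next
  fix a b c k assume "a \<in> alt_forms L' sc'" "b \<in> alt_forms L' sc'" "c \<in> alt_forms L' sc'"
  note m = this[THEN R.pull_in_alt_forms]
  have "B (R.pull a) (R.pull b + R.pull c) = B (R.pull a) (R.pull b) + B (R.pull a) (R.pull c)"
    "B (R.pull a + R.pull b) (R.pull c) = B (R.pull a) (R.pull c) + B (R.pull b) (R.pull c)"
    "B (scale_form k (R.pull a)) (R.pull b) = scale_form k (B (R.pull a) (R.pull b))"
    "B (R.pull a) (scale_form k (R.pull b)) = scale_form k (B (R.pull a) (R.pull b))"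
    using B m unfolding gerstenhaber_extension_def by blast+
  then show "pull (B (R.pull a) (R.pull (b + c))) = pull (B (R.pull a) (R.pull b)) + pull (B (R.pull a) (R.pull c))"
    "pull (B (R.pull (a + b)) (R.pull c)) = pull (B (R.pull a) (R.pull c)) + pull (B (R.pull b) (R.pull c))"
    "pull (B (R.pull (scale_form k a)) (R.pull b)) = scale_form k (pull (B (R.pull a) (R.pull b)))"
    "pull (B (R.pull a) (R.pull (scale_form k b))) = scale_form k (pull (B (R.pull a) (R.pull b)))"
    by (simp_all only: R.pull_add R.pull_scale pull_add pull_scale)
next
  fix p q a b assume ab: "a \<in> homog_forms L' sc' p" "b \<in> homog_forms L' sc' q"
  note m = ab[THEN R.pull_in_homog_forms]
  have deg: "if p + q = 0 then B (R.pull a) (R.pull b) = 0 else B (R.pull a) (R.pull b) \<in> homog_forms L sc (p + q - 1)"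
    using B m unfolding gerstenhaber_extension_def by blast
  then show "if p + q = 0 then pull (B (R.pull a) (R.pull b)) = 0
     else pull (B (R.pull a) (R.pull b)) \<in> homog_forms L' sc' (p + q - 1)"
    using pull_in_homog_forms pull_zero by (cases "p + q = 0") (simp_all only: if_True if_False pull_zero simp_thms)
  have "B (R.pull a) (R.pull b) = - scale_form ((-1) ^ ((p + 1) * (q + 1))) (B (R.pull b) (R.pull a))"
    using B m unfolding gerstenhaber_extension_def by blast
  then show "pull (B (R.pull a) (R.pull b)) = - scale_form ((-1) ^ ((p + 1) * (q + 1))) (pull (B (R.pull b) (R.pull a)))"
    by (metis pull_scale pull_minus)
  fix c assume c: "c \<in> alt_forms L' sc'"
  note mc = R.pull_in_alt_forms[OF c]
  have ma: "a \<in> alt_forms L' sc'" "b \<in> alt_forms L' sc'" using ab by (auto simp: homog_forms_iff)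
  note mb = ma[THEN R.pull_in_alt_forms]
  have "B (R.pull a) (wedge (R.pull b) (R.pull c)) = wedge (B (R.pull a) (R.pull b)) (R.pull c) +
      scale_form ((-1) ^ ((p + 1) * q)) (wedge (R.pull b) (B (R.pull a) (R.pull c)))"
    using B m mc unfolding gerstenhaber_extension_def by blast
  then show "pull (B (R.pull a) (R.pull (wedge b c))) = wedge (pull (B (R.pull a) (R.pull b))) c +
      scale_form ((-1) ^ ((p + 1) * q)) (wedge b (pull (B (R.pull a) (R.pull c))))"
    using pull_R_pull[OF ma(2)] pull_R_pull[OF c] by (simp only: R.pull_wedge pull_wedge pull_add pull_scale)
qed

end

context exterior_iso
begin

text \<open>The brackets of the two algebras are unrelated choices. They match because the bracket
  chosen on the primed side, carried over, is one more extension on the unprimed side, where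
  uniqueness is assumed. The degree bound is what shows that the values of both brackets are
  alternating, so that \<open>pull\<close> and \<open>R.pull\<close> invert each other on
  them.\<close>

lemma exterior_dga_isomorphic:
  assumes B: "gerstenhaber_extension L sc W wb \<iota> B"
    and unique: "\<And>B B' a b. gerstenhaber_extension L sc W wb \<iota> B \<Longrightarrow> gerstenhaber_extension L sc W wb \<iota> B' \<Longrightarrow>
      a \<in> alt_forms L sc \<Longrightarrow> b \<in> alt_forms L sc \<Longrightarrow> B a b = B' a b"
    and bounded: "\<And>A xs. A \<in> alt_forms L sc \<Longrightarrow> length xs > N \<Longrightarrow> A xs = 0"
  shows "dga_isomorphic (exterior_dga L sc lb W wb \<iota>) (exterior_dga L' sc' lb' W' wb' \<iota>')"
proof -
  define C where "C = (SOME B. gerstenhaber_extension L sc W wb \<iota> B)"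
  define C' where "C' = (SOME B. gerstenhaber_extension L' sc' W' wb' \<iota>' B)"
  have C: "gerstenhaber_extension L sc W wb \<iota> C"
    unfolding C_def by (rule someI[where P = "gerstenhaber_extension L sc W wb \<iota>", OF B])
  have C': "gerstenhaber_extension L' sc' W' wb' \<iota>' C'"
    unfolding C'_def
    by (rule someI[where P = "gerstenhaber_extension L' sc' W' wb' \<iota>'", OF gerstenhaber_extension_transport[OF B]])
  have bounded': "A xs = 0" if "A \<in> alt_forms L' sc'" "length xs > N" for A xs
  proof -
    have "pull (R.pull A) xs = 0"
      using bounded[OF R.pull_in_alt_forms[OF that(1)], of "map \<psi> xs"] that(2) by (simp add: pull_def)
    then show ?thesis by (simp add: pull_R_pull[OF that(1)])
  qed
  have CC': "pull (C a b) = C' (pull a) (pull b)" if ab: "a \<in> alt_forms L sc" "b \<in> alt_forms L sc" for a b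
  proof -
    note p = ab[THEN pull_in_alt_forms]
    have "C' (pull a) (pull b) \<in> alt_forms L' sc'"
      by (rule gerstenhaber_closed[OF C' p(1) bounded'[OF p(1)] p(2) bounded'[OF p(2)]])
    moreover have "C a b = R.pull (C' (pull a) (pull b))"
      using unique[OF C R.gerstenhaber_extension_transport[OF C'] ab] .
    ultimately show ?thesis by (simp add: pull_R_pull)
  qed
  have CC: "R.pull (C' a b) = C (R.pull a) (R.pull b)" if ab: "a \<in> alt_forms L' sc'" "b \<in> alt_forms L' sc'" for a b
  proof -
    note p = ab[THEN R.pull_in_alt_forms]
    have "C (R.pull a) (R.pull b) \<in> alt_forms L sc"
      by (rule gerstenhaber_closed[OF C p(1) bounded[OF p(1)] p(2) bounded[OF p(2)]])
    moreover have "pull (C (R.pull a) (R.pull b)) = C' a b"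
      using CC'[OF p] ab by (simp add: pull_R_pull)
    ultimately show ?thesis by (metis R_pull_pull)
  qed
  show ?thesis
    unfolding dga_isomorphic_def dga_hom_def exterior_dga_def C_def[symmetric] C'_def[symmetric] dga.simps
    by (intro exI[of _ pull] exI[of _ R.pull] conjI ballI allI pull_in_alt_forms R.pull_in_alt_forms
      pull_scale R.pull_scale pull_ce_diff R.pull_ce_diff pull_in_homog_forms R.pull_in_homog_forms
      pull_add R.pull_add pull_wedge R.pull_wedge CC CC' pull_R_pull R_pull_pull)
qed

end

section \<open>The algebra of a symplectic structure\<close>

text \<open>The vector spaces of the theorem are bare types of class \<open>real_vector\<close>;
  finiteness is a property that has to be recovered from the hypothesis on
  \<open>dim\<close>.\<close>

definition finite_dimensional :: "'a::real_vector itself \<Rightarrow> bool" where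
  "finite_dimensional _ \<longleftrightarrow> (\<exists>S :: 'a set. finite S \<and> span S = UNIV)"

lemma finite_dimensional_basis:
  assumes "finite_dimensional TYPE('a::real_vector)"
  obtains S :: "'a::real_vector set" where "finite S" "independent S" "span S = UNIV"
proof -
  obtain T :: "'a set" where T: "finite T" "span T = UNIV" using assms by (auto simp: finite_dimensional_def)
  obtain S where S: "S \<subseteq> T" "independent S" "T \<subseteq> span S" by (rule maximal_independent_subset)
  have "span S = UNIV" using T(2) span_mono[OF S(3)] span_span by blast
  then show ?thesis using that S T(1) finite_subset by blast
qed

lemma finite_dimensional_prod:
  assumes "finite_dimensional TYPE('a::real_vector)" "finite_dimensional TYPE('b::real_vector)"
  shows "finite_dimensional TYPE('a::real_vector \<times> 'b::real_vector)"
proof -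
  obtain S :: "'a set" and T :: "'b set" where S: "finite S" "span S = UNIV" and T: "finite T" "span T = UNIV"
    using assms by (auto simp: finite_dimensional_def)
  let ?U = "(\<lambda>x. (x, 0 :: 'b)) ` S \<union> (\<lambda>y. (0 :: 'a, y)) ` T"
  have l: "linear (\<lambda>x. (x, 0 :: 'b))" "linear (\<lambda>y. (0 :: 'a, y))" by (auto simp: linear_iff)
  have "(x, 0) \<in> span ?U" for x
  proof -
    have "(x, 0 :: 'b) \<in> (\<lambda>x. (x, 0)) ` span S" using S by auto
    then show ?thesis unfolding linear_span_image[OF l(1), symmetric] by (meson Un_upper1 span_mono subsetD)
  qed
  moreover have "(0, y) \<in> span ?U" for y
  proof -
    have "(0 :: 'a, y) \<in> (\<lambda>y. (0, y)) ` span T" using T by auto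
    then show ?thesis unfolding linear_span_image[OF l(2), symmetric] by (meson Un_upper2 span_mono subsetD)
  qed
  ultimately have "(x, 0) + (0, y) \<in> span ?U" for x y by (intro span_add)
  then have "span ?U = UNIV" by auto
  then show ?thesis unfolding finite_dimensional_def using S(1) T(1) by (intro exI[of _ ?U]) simp
qed

lemma finite_dimensional_surj:
  assumes "finite_dimensional TYPE('a::real_vector)" "linear (f :: 'a::real_vector \<Rightarrow> 'b::real_vector)" "surj f"
  shows "finite_dimensional TYPE('b::real_vector)"
proof -
  obtain S :: "'a set" where "finite S" "span S = UNIV" using assms(1) by (auto simp: finite_dimensional_def)
  then show ?thesis
    unfolding finite_dimensional_def using linear_span_image[OF assms(2), of S] assms(3)
    by (intro exI[of _ "f ` S"]) auto
qed

lemma finite_dimensional_eq_on_basis: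
  fixes f g :: "'a::real_vector \<Rightarrow> 'b::real_vector"
  assumes "linear f" "linear g" "span S = UNIV" "\<And>s. s \<in> S \<Longrightarrow> f s = g s"
  shows "f = g"
  using linear_eq_on_span[OF assms(1,2), of S] assms(3,4) by auto

text \<open>The values of \<open>\<omega> x\<close> on a basis are stored as the coordinates of a
  vector of the same space. This makes \<open>x \<mapsto> \<omega> x\<close> an injective
  endomorphism \<open>T\<close>, hence a surjective one.\<close>

lemma bilinear_form_represents:
  fixes \<omega> :: "'a::real_vector \<Rightarrow> 'a \<Rightarrow> real"
  assumes fin: "finite_dimensional TYPE('a)" and bil: "bilinear \<omega>"
    and nondeg: "\<forall>x. (\<forall>y. \<omega> x y = 0) \<longrightarrow> x = 0" and \<alpha>: "linear \<alpha>"
  obtains x where "\<omega> x = \<alpha>"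
proof -
  obtain S :: "'a set" where S: "finite S" "independent S" "span S = UNIV"
    using finite_dimensional_basis[OF fin] by blast
  interpret fd: finite_dimensional_vector_space scaleR S
    by unfold_locales (use S in \<open>auto simp: algebra_simps dependent_raw_def span_raw_def\<close>)
  have lin: "linear (\<omega> x)" "linear (\<lambda>x. \<omega> x y)" for x y using bil by (auto simp: bilinear_def)
  define T where "T x = (\<Sum>b\<in>S. \<omega> x b *\<^sub>R b)" for x
  have coeff: "c = d" if "(\<Sum>b\<in>S. c b *\<^sub>R b) = (\<Sum>b\<in>S. d b *\<^sub>R b)" "\<And>b. b \<notin> S \<Longrightarrow> c b = d b" for c d :: "'a \<Rightarrow> real"
  proof
    fix b
    have "(\<Sum>b\<in>S. (c b - d b) *\<^sub>R b) = 0" using that(1) by (simp add: scaleR_diff_left sum_subtractf)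
    from independentD[OF S(2,1) order_refl this] show "c b = d b"
      using that(2)[of b] by (cases "b \<in> S") auto
  qed
  have "linear T" unfolding T_def
    by (intro linear_compose_sum ballI linear_compose_scale_right[of "\<lambda>x. \<omega> x _", unfolded real_scaleR_def])
      (auto simp: linear_iff linear_add[OF lin(2)] linear_scale[OF lin(2)] algebra_simps)
  have "inj T"
  proof (rule linear_injective_0[THEN iffD2, OF \<open>linear T\<close>, rule_format])
    fix x assume "T x = 0"
    then have "(\<Sum>b\<in>S. (if b \<in> S then \<omega> x b else 0) *\<^sub>R b) = (\<Sum>b\<in>S. 0 *\<^sub>R b)" by (simp add: T_def)
    from coeff[OF this] have "\<omega> x b = 0" if "b \<in> S" for b using that by (metis (mono_tags, lifting))
    then have "\<omega> x = (\<lambda>_. 0)" by (intro finite_dimensional_eq_on_basis[OF lin(1) _ S(3)]) (auto simp: linear_iff)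
    then show "x = 0" using nondeg by metis
  qed
  then have "surj T" using fd.linear_inj_imp_surj \<open>linear T\<close> by (simp add: linear_def)
  then obtain x where "T x = (\<Sum>b\<in>S. \<alpha> b *\<^sub>R b)" by (metis surjD)
  then have "(\<Sum>b\<in>S. (if b \<in> S then \<omega> x b else 0) *\<^sub>R b) = (\<Sum>b\<in>S. (if b \<in> S then \<alpha> b else 0) *\<^sub>R b)"
    by (simp add: T_def)
  from coeff[OF this] have "\<omega> x b = \<alpha> b" if "b \<in> S" for b using that by (metis (mono_tags, lifting))
  then have "\<omega> x = \<alpha>" by (intro finite_dimensional_eq_on_basis[OF lin(1) \<alpha> S(3)])
  then show ?thesis by (rule that)
qed

section \<open>Complexified forms and brackets\<close>

lemma vector_space_cpx_scale: "vector_space cpx_scale"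
  by unfold_locales (auto simp: algebra_simps scaleR_add_left scaleR_diff_left)

lemma mem_cpx_dual:
  "\<alpha> \<in> cpx_dual \<longleftrightarrow> (\<forall>x y. \<alpha> (x + y) = \<alpha> x + \<alpha> y) \<and> (\<forall>c x. \<alpha> (cpx_scale c x) = c * \<alpha> x)"
proof -
  have v: "vector_space ((*) :: complex \<Rightarrow> _)" by unfold_locales (auto simp: algebra_simps)
  show ?thesis
    by (simp only: v vector_space_cpx_scale cpx_dual_def mem_Collect_eq Vector_Spaces.linear_def module_hom_iff module_iff_vector_space simp_thms)
qed

lemma cpx_dual_add: "\<alpha> \<in> cpx_dual \<Longrightarrow> \<alpha> (x + y) = \<alpha> x + \<alpha> y"
  and cpx_dual_scale: "\<alpha> \<in> cpx_dual \<Longrightarrow> \<alpha> (cpx_scale c x) = c * \<alpha> x"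
  using mem_cpx_dual by blast+

lemma cpx_dual_pair:
  assumes "\<alpha> \<in> cpx_dual"
  shows "\<alpha> (x, y) = \<alpha> (x, 0) + \<i> * \<alpha> (y, 0)"
proof -
  have "\<alpha> (x, y) = \<alpha> ((x, 0) + cpx_scale \<i> (y, 0))" by simp
  then show ?thesis by (simp only: cpx_dual_add[OF assms] cpx_dual_scale[OF assms])
qed

lemma cpx_dual_real_linear:
  assumes "\<alpha> \<in> cpx_dual"
  shows "linear (\<lambda>x. Re (\<alpha> (x, 0)))" "linear (\<lambda>x. Im (\<alpha> (x, 0)))"
proof -
  have "\<alpha> (x + y, 0) = \<alpha> (x, 0) + \<alpha> (y, 0)" for x y using cpx_dual_add[OF assms, of "(x, 0)" "(y, 0)"] by simp
  moreover have "\<alpha> (r *\<^sub>R x, 0) = of_real r * \<alpha> (x, 0)" for r x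
    using cpx_dual_scale[OF assms, of "of_real r" "(x, 0)"] by simp
  ultimately show "linear (\<lambda>x. Re (\<alpha> (x, 0)))" "linear (\<lambda>x. Im (\<alpha> (x, 0)))" by (auto simp: linear_iff)
qed

lemma cpx_form_in_cpx_dual:
  assumes "bilinear \<omega>"
  shows "cpx_form \<omega> z \<in> cpx_dual"
proof -
  note b = bilinear_ladd[OF assms] bilinear_radd[OF assms] bilinear_rmul[OF assms] bilinear_lmul[OF assms]
    bilinear_rsub[OF assms]
  obtain p q where "z = (p, q)" by fastforce
  then show ?thesis by (auto simp: mem_cpx_dual b complex_eq_iff algebra_simps)
qed

lemma cpx_form_left:
  assumes "bilinear \<omega>"
  shows "cpx_form \<omega> (x + y) z = cpx_form \<omega> x z + cpx_form \<omega> y z"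
    "cpx_form \<omega> (cpx_scale c x) z = c * cpx_form \<omega> x z"
proof -
  note b = bilinear_ladd[OF assms] bilinear_radd[OF assms] bilinear_rmul[OF assms] bilinear_lmul[OF assms]
    bilinear_lsub[OF assms]
  obtain p q p' q' r s where "z = (p, q)" "x = (p', q')" "y = (r, s)" by (metis surj_pair)
  then show "cpx_form \<omega> (x + y) z = cpx_form \<omega> x z + cpx_form \<omega> y z"
    "cpx_form \<omega> (cpx_scale c x) z = c * cpx_form \<omega> x z" by (auto simp: b complex_eq_iff algebra_simps)
qed

lemma cpx_bracket_bilinear:
  assumes "bilinear br"
  shows "cpx_bracket br (x + y) z = cpx_bracket br x z + cpx_bracket br y z"
    "cpx_bracket br z (x + y) = cpx_bracket br z x + cpx_bracket br z y"
    "cpx_bracket br (cpx_scale c x) z = cpx_scale c (cpx_bracket br x z)"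
    "cpx_bracket br z (cpx_scale c x) = cpx_scale c (cpx_bracket br z x)"
proof -
  note b = bilinear_ladd[OF assms] bilinear_radd[OF assms] bilinear_rmul[OF assms] bilinear_lmul[OF assms]
    bilinear_lsub[OF assms] bilinear_rsub[OF assms]
  obtain p q p' q' r s where e: "z = (p, q)" "x = (p', q')" "y = (r, s)" by (metis surj_pair)
  show "cpx_bracket br (x + y) z = cpx_bracket br x z + cpx_bracket br y z"
    "cpx_bracket br z (x + y) = cpx_bracket br z x + cpx_bracket br z y"
    "cpx_bracket br (cpx_scale c x) z = cpx_scale c (cpx_bracket br x z)"
    "cpx_bracket br z (cpx_scale c x) = cpx_scale c (cpx_bracket br z x)"
    unfolding e by (auto simp: b algebra_simps scaleR_diff_right scaleR_add_right)
qed

text \<open>A complex linear form is determined by its restriction to real vectors, whose real and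
  imaginary parts are represented separately. This is what gives
  \<open>inv (cpx_form \<omega>)\<close> a meaning on \<open>cpx_dual\<close>.\<close>

lemma cpx_form_inverse:
  assumes fin: "finite_dimensional TYPE('a::real_vector)" and bil: "bilinear (\<omega> :: 'a::real_vector \<Rightarrow> 'a \<Rightarrow> real)"
    and nondeg: "\<forall>x. (\<forall>y. \<omega> x y = 0) \<longrightarrow> x = 0"
  shows "\<alpha> \<in> cpx_dual \<Longrightarrow> cpx_form \<omega> (inv (cpx_form \<omega>) \<alpha>) = \<alpha>"
    and "cpx_form \<omega> z = cpx_form \<omega> w \<Longrightarrow> z = w"
proof -
  assume \<alpha>: "\<alpha> \<in> cpx_dual"
  obtain p where p: "\<omega> p = (\<lambda>x. Re (\<alpha> (x, 0)))"
    using bilinear_form_represents[OF fin bil nondeg cpx_dual_real_linear(1)[OF \<alpha>]] by blast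
  obtain q where q: "\<omega> q = (\<lambda>x. Im (\<alpha> (x, 0)))"
    using bilinear_form_represents[OF fin bil nondeg cpx_dual_real_linear(2)[OF \<alpha>]] by blast
  have "cpx_form \<omega> (p, q) = \<alpha>"
  proof
    fix z :: "'a cpx" obtain x y where z: "z = (x, y)" by fastforce
    show "cpx_form \<omega> (p, q) z = \<alpha> z"
      using cpx_dual_pair[OF \<alpha>, of x y] by (simp add: z p q complex_eq_iff)
  qed
  then show "cpx_form \<omega> (inv (cpx_form \<omega>) \<alpha>) = \<alpha>" by (metis f_inv_into_f rangeI)
next
  assume e: "cpx_form \<omega> z = cpx_form \<omega> w"
  obtain p q p' q' where z: "z = (p, q)" "w = (p', q')" by fastforce
  have "cpx_form \<omega> (p, q) (y, 0) = cpx_form \<omega> (p', q') (y, 0)" for y using e z by simp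
  then have "\<omega> (p - p') y = 0" "\<omega> (q - q') y = 0" for y
    by (auto simp: bilinear_rzero[OF bil] bilinear_lsub[OF bil])
  then show "z = w" using nondeg z by fastforce
qed

text \<open>A real basis is a complex basis of the complexification.\<close>

lemma finite_complex_space_cpx:
  assumes "finite_dimensional TYPE('a::real_vector)"
  obtains E \<epsilon> where "finite_complex_space (UNIV :: 'a::real_vector cpx set) cpx_scale E \<epsilon>"
    "\<And>e. e \<in> E \<Longrightarrow> \<epsilon> e \<in> cpx_dual"
proof -
  obtain S :: "'a set" where S: "finite S" "independent S" "span S = UNIV"
    using finite_dimensional_basis[OF assms] by blast
  define \<epsilon> :: "'a cpx \<Rightarrow> 'a cpx \<Rightarrow> complex" where
    "\<epsilon> e z = Complex (representation S (fst z) (fst e)) (representation S (snd z) (fst e))" for e z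
  let ?E = "(\<lambda>b. (b, 0 :: 'a)) ` S"
  have mem: "x \<in> span S" for x using S(3) by simp
  note r = representation_add[OF S(2) mem mem] representation_scale[OF S(2) mem] representation_diff[OF S(2) mem mem]
  have lin: "\<epsilon> e (x + y) = \<epsilon> e x + \<epsilon> e y" "\<epsilon> e (cpx_scale c x) = c * \<epsilon> e x" for e x y c
    by (cases x; cases y; auto simp: \<epsilon>_def r complex_eq_iff)+
  have "finite_complex_space (UNIV :: 'a cpx set) cpx_scale ?E \<epsilon>"
  proof unfold_locales
    fix e e' assume e: "e \<in> ?E" "e' \<in> ?E"
    then show "\<epsilon> e e' = (if e = e' then 1 else 0)"
      using representation_basis[OF S(2)] by (auto simp: \<epsilon>_def complex_eq_iff representation_zero split: if_splits)
  next
    fix z :: "'a cpx" obtain x y where z: "z = (x, y)" by fastforce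
    have "(\<Sum>e\<in>?E. cpx_scale (\<epsilon> e z) e) = (\<Sum>b\<in>S. (representation S x b *\<^sub>R b, representation S y b *\<^sub>R b))"
      by (subst sum.reindex) (auto simp: inj_on_def \<epsilon>_def z)
    also have "\<dots> = ((\<Sum>b\<in>S. representation S x b *\<^sub>R b), (\<Sum>b\<in>S. representation S y b *\<^sub>R b))"
      by (simp add: sum_prod)
    also have "\<dots> = z"
      using sum_representation_eq[OF S(2) mem S(1) order_refl] z by simp
    finally show "z = (\<Sum>e\<in>?E. cpx_scale (\<epsilon> e z) e)" by simp
  qed (use S(1) lin in auto)
  moreover have "\<epsilon> e \<in> cpx_dual" for e using lin by (simp add: mem_cpx_dual)
  ultimately show ?thesis using that by blast
qed

lemma omega_bracket_in_cpx_dual: "bilinear \<omega> \<Longrightarrow> omega_bracket br \<omega> \<alpha> \<beta> \<in> cpx_dual"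
  by (simp add: omega_bracket_def cpx_form_in_cpx_dual)

text \<open>The table fed to \<open>bracket_of\<close> consists of the brackets of the dual basis.
  Expanding the preimages of \<open>F\<close> and \<open>G\<close> under
  \<open>cpx_form \<omega>\<close> in those of the dual basis gives the bilinear expansion that
  \<open>gerstenhaber_extension_bracket_of\<close> asks for.\<close>

lemma gerstenhaber_extension_symplectic:
  assumes fin: "finite_dimensional TYPE('a::real_vector)" and br: "bilinear (br :: 'a \<Rightarrow> 'a \<Rightarrow> 'a::real_vector)"
    and anti: "\<And>x. br x x = 0" and \<omega>: "bilinear (\<omega> :: 'a::real_vector \<Rightarrow> 'a \<Rightarrow> real)"
    and nondeg: "\<forall>x. (\<forall>y. \<omega> x y = 0) \<longrightarrow> x = 0"
  obtains B where "gerstenhaber_extension UNIV cpx_scale cpx_dual (omega_bracket br \<omega>) (\<lambda>\<alpha>. \<alpha>) B"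
proof -
  obtain E \<epsilon> where "finite_complex_space (UNIV :: 'a cpx set) cpx_scale E \<epsilon>"
    and \<epsilon>: "\<And>e. e \<in> E \<Longrightarrow> \<epsilon> e \<in> cpx_dual" using finite_complex_space_cpx[OF fin] by blast
  then interpret finite_complex_space UNIV cpx_scale E \<epsilon> by simp
  let ?i = "inv (cpx_form \<omega>)"
  note inv = cpx_form_inverse[OF fin \<omega> nondeg]
  have antis: "br y x = - br x y" for x y
  proof -
    have "br x x + br x y + (br y x + br y y) = br (x + y) (x + y)"
      by (simp add: bilinear_ladd[OF br] bilinear_radd[OF br])
    then show ?thesis by (simp add: anti eq_neg_iff_add_eq_0 add.commute)
  qed
  have canti: "cpx_bracket br w z = cpx_scale (-1) (cpx_bracket br z w)" for z w
  proof -
    obtain p q r s where "z = (p, q)" "w = (r, s)" by fastforce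
    then show ?thesis by (simp add: antis[of p r] antis[of p s] antis[of q r] antis[of q s])
  qed
  have sum1: "f (\<Sum>e\<in>I. g e) = (\<Sum>e\<in>I. f (g e))" if "\<And>x y. f (x + y) = f x + f y"
    for f :: "'x::ab_group_add \<Rightarrow> 'y::ab_group_add" and g :: "'z \<Rightarrow> 'x" and I
  proof -
    have "f 0 = 0" using that[of 0 0] by simp
    then show ?thesis by (induction I rule: infinite_finite_induct) (simp_all add: that)
  qed
  have dual_expand: "F z = (\<Sum>e\<in>E. F e * \<epsilon> e z)" if "F \<in> cpx_dual" for F z
  proof -
    have "F z = F (\<Sum>e\<in>E. cpx_scale (\<epsilon> e z) e)" using expand[of z] by simp
    also have "\<dots> = (\<Sum>e\<in>E. F (cpx_scale (\<epsilon> e z) e))" by (rule sum1) (rule cpx_dual_add[OF that])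
    finally show ?thesis by (simp add: cpx_dual_scale[OF that] mult.commute)
  qed
  have inv_expand: "?i F = (\<Sum>e\<in>E. cpx_scale (F e) (?i (\<epsilon> e)))" if F: "F \<in> cpx_dual" for F
  proof (rule inv(2), rule ext)
    fix z
    have "cpx_form \<omega> (\<Sum>e\<in>E. cpx_scale (F e) (?i (\<epsilon> e))) z = (\<Sum>e\<in>E. cpx_form \<omega> (cpx_scale (F e) (?i (\<epsilon> e))) z)"
      by (rule sum1[of "\<lambda>x. cpx_form \<omega> x z"]) (rule cpx_form_left[OF \<omega>])
    also have "\<dots> = (\<Sum>e\<in>E. F e * \<epsilon> e z)"
      by (intro sum.cong refl) (simp add: cpx_form_left[OF \<omega>] inv(1) \<epsilon>)
    finally show "cpx_form \<omega> (?i F) z = cpx_form \<omega> (\<Sum>e\<in>E. cpx_scale (F e) (?i (\<epsilon> e))) z"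
      using dual_expand[OF F, of z] inv(1)[OF F] by simp
  qed
  have "gerstenhaber_extension UNIV cpx_scale cpx_dual (omega_bracket br \<omega>) (\<lambda>\<alpha>. \<alpha>)
     (bracket_of (\<lambda>e f. omega_bracket br \<omega> (\<epsilon> e) (\<epsilon> f)))"
  proof (rule gerstenhaber_extension_bracket_of)
    fix e f
    show "one_form (omega_bracket br \<omega> (\<epsilon> e) (\<epsilon> f)) \<in> alt_forms UNIV cpx_scale"
      using omega_bracket_in_cpx_dual[OF \<omega>] by (intro one_form_in_alt_forms) (auto simp: mem_cpx_dual)
    show "omega_bracket br \<omega> (\<epsilon> f) (\<epsilon> e) = (\<lambda>x. - omega_bracket br \<omega> (\<epsilon> e) (\<epsilon> f) x)"
      unfolding omega_bracket_def by (subst canti) (simp only: cpx_form_left[OF \<omega>] fun_eq_iff mult_minus1 simp_thms)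
  next
    fix F G :: "'a cpx \<Rightarrow> complex" and x assume F: "F \<in> cpx_dual" and G: "G \<in> cpx_dual"
    have "cpx_bracket br (?i F) (?i G) =
        (\<Sum>e\<in>E. \<Sum>f\<in>E. cpx_scale (G f) (cpx_scale (F e) (cpx_bracket br (?i (\<epsilon> e)) (?i (\<epsilon> f)))))"
      unfolding inv_expand[OF F] inv_expand[OF G]
      by (subst sum1[of "\<lambda>x. cpx_bracket br x _"], rule cpx_bracket_bilinear[OF br],
          rule sum.cong, rule refl,
          subst sum1[of "\<lambda>x. cpx_bracket br _ x"], rule cpx_bracket_bilinear[OF br],
          simp only: cpx_bracket_bilinear[OF br])
    then show "omega_bracket br \<omega> F G x = (\<Sum>e\<in>E. \<Sum>f\<in>E. F e * G f * omega_bracket br \<omega> (\<epsilon> e) (\<epsilon> f) x)"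
      unfolding omega_bracket_def
      by (simp only: sum1[of "\<lambda>y. cpx_form \<omega> y x", OF cpx_form_left(1)[OF \<omega>]] cpx_form_left(2)[OF \<omega>] mult_ac)
  qed
  then show ?thesis by (rule that)
qed

lemma gerstenhaber_extension_symplectic_unique:
  assumes fin: "finite_dimensional TYPE('a::real_vector)"
    and "gerstenhaber_extension (UNIV :: 'a::real_vector cpx set) cpx_scale cpx_dual wb (\<lambda>\<alpha>. \<alpha>) B"
    "gerstenhaber_extension (UNIV :: 'a::real_vector cpx set) cpx_scale cpx_dual wb (\<lambda>\<alpha>. \<alpha>) B'"
    "a \<in> alt_forms UNIV cpx_scale" "b \<in> alt_forms UNIV cpx_scale"
  shows "B a b = B' a b"
proof -
  obtain E \<epsilon> where "finite_complex_space (UNIV :: 'a cpx set) cpx_scale E \<epsilon>"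
    and \<epsilon>: "\<And>e. e \<in> E \<Longrightarrow> \<epsilon> e \<in> cpx_dual" using finite_complex_space_cpx[OF fin] by blast
  then show ?thesis
    by (intro finite_complex_space.gerstenhaber_extension_unique[OF _ assms(2,3) _ assms(4,5)]) auto
qed

lemma bounded_cpx_forms:
  assumes fin: "finite_dimensional TYPE('a::real_vector)"
  obtains N where "\<And>A xs. A \<in> alt_forms (UNIV :: 'a::real_vector cpx set) cpx_scale \<Longrightarrow> length xs > N \<Longrightarrow> A xs = 0"
proof -
  obtain E \<epsilon> where "finite_complex_space (UNIV :: 'a cpx set) cpx_scale E \<epsilon>"
    using finite_complex_space_cpx[OF fin] by blast
  then show ?thesis using that[of "card E"] finite_complex_space.alt_form_bounded by blast
qed

text \<open>Existence and uniqueness of the bracket are established on the symplectic side; an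
  isomorphism with the algebra of a complex structure is therefore obtained from this side.\<close>

lemma DGA_symplectic_isomorphicI:
  fixes br :: "'a::real_vector \<Rightarrow> 'a \<Rightarrow> 'a" and lb :: "'m::ab_group_add \<Rightarrow> 'm \<Rightarrow> 'm"
  assumes fin: "finite_dimensional TYPE('a)" and br: "bilinear br" "\<And>x. br x x = 0"
    and \<omega>: "bilinear \<omega>" "\<forall>x. (\<forall>y. \<omega> x y = 0) \<longrightarrow> x = 0"
    and iso: "exterior_iso UNIV cpx_scale L sc (cpx_bracket br) lb cpx_dual (omega_bracket br \<omega>) (\<lambda>\<alpha>. \<alpha>) W wb \<iota> \<psi> \<psi>' \<theta> \<theta>'"
  shows "dga_isomorphic (DGA_symplectic br \<omega>) (exterior_dga L sc lb W wb \<iota>)"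
proof -
  obtain B where B: "gerstenhaber_extension UNIV cpx_scale cpx_dual (omega_bracket br \<omega>) (\<lambda>\<alpha>. \<alpha>) B"
    using gerstenhaber_extension_symplectic[OF fin br \<omega>] by blast
  obtain N where N: "\<And>A xs. A \<in> alt_forms (UNIV :: 'a cpx set) cpx_scale \<Longrightarrow> length xs > N \<Longrightarrow> A xs = 0"
    using bounded_cpx_forms[OF fin] by blast
  show ?thesis
    unfolding DGA_symplectic_def
    by (rule exterior_iso.exterior_dga_isomorphic[OF iso B, where N = N])
      (use gerstenhaber_extension_symplectic_unique[OF fin] N in blast)+
qed

section \<open>Symplectomorphisms induce isomorphisms of algebras\<close>

definition cpx_map :: "('a \<Rightarrow> 'b) \<Rightarrow> 'a cpx \<Rightarrow> 'b cpx" where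
  "cpx_map f = map_prod f f"

lemma cpx_map_simps [simp]: "cpx_map f (x, y) = (f x, f y)"
  by (simp add: cpx_map_def)

lemma cpx_map_linear:
  assumes "linear f"
  shows "cpx_map f (z + w) = cpx_map f z + cpx_map f w" "cpx_map f (cpx_scale c z) = cpx_scale c (cpx_map f z)"
  by (cases z; cases w; simp add: linear_add[OF assms] linear_diff[OF assms] linear_scale[OF assms])+

lemma lie_isomorphism_inv:
  assumes "lie_isomorphism br br' f"
  shows "lie_isomorphism br' br (inv f)" "\<And>x. inv f (f x) = x" "\<And>y. f (inv f y) = y"
proof -
  have f: "linear f" "bij f" "\<And>x y. f (br x y) = br' (f x) (f y)" using assms by (auto simp: lie_isomorphism_def)
  show i: "inv f (f x) = x" "f (inv f y) = y" for x y
    using f(2) by (auto simp: bij_def surj_f_inv_f)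
  have "linear (inv f)"
    by (rule linearI; rule injD[OF bij_is_inj[OF f(2)]]) (simp_all add: i linear_add[OF f(1)] linear_scale[OF f(1)])
  moreover have "inv f (br' x y) = br (inv f x) (inv f y)" for x y
    by (metis f(3) i)
  ultimately show "lie_isomorphism br' br (inv f)" using f(2) by (simp add: lie_isomorphism_def bij_imp_bij_inv)
qed

lemma DGA_symplectic_isomorphic:
  fixes br :: "'a::real_vector \<Rightarrow> 'a \<Rightarrow> 'a" and br' :: "'b::real_vector \<Rightarrow> 'b \<Rightarrow> 'b"
  assumes fin: "finite_dimensional TYPE('a)" and br: "bilinear br" "\<And>x. br x x = 0"
    and \<omega>: "bilinear \<omega>" "\<forall>x. (\<forall>y. \<omega> x y = 0) \<longrightarrow> x = 0"
    and f: "lie_isomorphism br br' f" "\<And>x y. \<omega>' (f x) (f y) = \<omega> x y"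
  shows "dga_isomorphic (DGA_symplectic br \<omega>) (DGA_symplectic br' \<omega>')"
proof -
  let ?g = "inv f"
  note g = lie_isomorphism_inv[OF f(1)]
  have lf: "linear f" "\<And>x y. f (br x y) = br' (f x) (f y)" "bij f"
    and lg: "linear ?g" "\<And>x y. ?g (br' x y) = br (?g x) (?g y)"
    using f(1) g(1) by (auto simp: lie_isomorphism_def)
  have fin': "finite_dimensional TYPE('b)" by (rule finite_dimensional_surj[OF fin lf(1) bij_is_surj[OF lf(3)]])
  \<comment> \<open>As the transport of \<open>\<omega>\<close> along \<open>f\<close>, the form
    \<open>\<omega>'\<close> inherits bilinearity and nondegeneracy.\<close>
  have \<omega>': "\<omega>' = (\<lambda>x y. \<omega> (?g x) (?g y))" using f(2) g(3) by metis
  have \<omega>'b: "bilinear \<omega>'"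
    unfolding \<omega>' using \<omega>(1) lg(1) unfolding bilinear_def
    by (auto intro: linear_compose[OF lg(1), unfolded o_def])
  have \<omega>'n: "\<forall>x. (\<forall>y. \<omega>' x y = 0) \<longrightarrow> x = 0"
  proof (intro allI impI)
    fix x assume that: "\<forall>y. \<omega>' x y = 0"
    have "?g x = 0" by (rule \<omega>(2)[rule_format]) (metis that f(2) g(3))
    then show "x = 0" using g(3)[of x] linear_0[OF lf(1)] by simp
  qed
  note inv = cpx_form_inverse[OF fin \<omega>] and inv' = cpx_form_inverse[OF fin' \<omega>'b \<omega>'n]
  have gf: "cpx_map ?g (cpx_map f z) = z" "cpx_map f (cpx_map ?g w) = w" for z w
    by (cases z; cases w; simp add: g)+
  have cf: "cpx_form \<omega>' (cpx_map f z) (cpx_map f w) = cpx_form \<omega> z w" for z w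
    by (cases z; cases w) (simp add: f(2))
  have cb: "cpx_map ?g (cpx_bracket br' z w) = cpx_bracket br (cpx_map ?g z) (cpx_map ?g w)" for z w
    by (cases z; cases w) (simp add: lg(2) linear_add[OF lg(1)] linear_diff[OF lg(1)])
  have dual: "\<alpha> \<circ> cpx_map f \<in> cpx_dual" if "\<alpha> \<in> cpx_dual" for \<alpha>
    using that by (simp add: mem_cpx_dual cpx_map_linear[OF lf(1)])
  have dual': "\<alpha> \<circ> cpx_map ?g \<in> cpx_dual" if "\<alpha> \<in> cpx_dual" for \<alpha>
    using that by (simp add: mem_cpx_dual cpx_map_linear[OF lg(1)])
  have i: "inv (cpx_form \<omega>) (\<alpha> \<circ> cpx_map f) = cpx_map ?g (inv (cpx_form \<omega>') \<alpha>)" if "\<alpha> \<in> cpx_dual" for \<alpha>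
  proof (rule inv(2), rule ext)
    fix z
    have "cpx_form \<omega> (cpx_map ?g (inv (cpx_form \<omega>') \<alpha>)) z = cpx_form \<omega>' (inv (cpx_form \<omega>') \<alpha>) (cpx_map f z)"
      by (simp only: cf[symmetric] gf)
    then show "cpx_form \<omega> (inv (cpx_form \<omega>) (\<alpha> \<circ> cpx_map f)) z = cpx_form \<omega> (cpx_map ?g (inv (cpx_form \<omega>') \<alpha>)) z"
      by (simp add: inv(1)[OF dual[OF that]] inv'(1)[OF that])
  qed
  have ob: "omega_bracket br' \<omega>' \<alpha> \<beta> \<circ> cpx_map f = omega_bracket br \<omega> (\<alpha> \<circ> cpx_map f) (\<beta> \<circ> cpx_map f)"
    if "\<alpha> \<in> cpx_dual" "\<beta> \<in> cpx_dual" for \<alpha> \<beta>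
    by (simp only: omega_bracket_def i[OF that(1)] i[OF that(2)] cb[symmetric] fun_eq_iff o_apply cf[symmetric] gf) simp
  have ci: "\<alpha> \<circ> cpx_map f \<circ> cpx_map ?g = \<alpha>" "\<beta> \<circ> cpx_map ?g \<circ> cpx_map f = \<beta>"
    for \<alpha> :: "'b cpx \<Rightarrow> complex" and \<beta> :: "'a cpx \<Rightarrow> complex" by (auto simp: gf fun_eq_iff)
  have "exterior_iso UNIV cpx_scale UNIV cpx_scale (cpx_bracket br) (cpx_bracket br') cpx_dual (omega_bracket br \<omega>) (\<lambda>\<alpha>. \<alpha>)
      cpx_dual (omega_bracket br' \<omega>') (\<lambda>\<alpha>. \<alpha>) (cpx_map ?g) (cpx_map f) (\<lambda>\<alpha>. \<alpha> \<circ> cpx_map f) (\<lambda>\<alpha>. \<alpha> \<circ> cpx_map ?g)"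
    by unfold_locales
      (simp_all add: gf cpx_map_linear[OF lg(1)] cb dual dual' ob ci omega_bracket_in_cpx_dual[OF \<omega>'b])
  from DGA_symplectic_isomorphicI[OF fin br \<omega> this] show ?thesis by (simp add: DGA_symplectic_def)
qed

section \<open>The algebra of a complex structure\<close>

lemma exterior_iso_trans:
  assumes "exterior_iso L sc L' sc' lb lb' W wb \<iota> W' wb' \<iota>' \<psi> \<psi>' \<theta> \<theta>'"
    and "exterior_iso L' sc' L'' sc'' lb' lb'' W' wb' \<iota>' W'' wb'' \<iota>'' \<phi> \<phi>' \<eta> \<eta>'"
  shows "exterior_iso L sc L'' sc'' lb lb'' W wb \<iota> W'' wb'' \<iota>''
    (\<lambda>x. \<psi> (\<phi> x)) (\<lambda>x. \<phi>' (\<psi>' x)) (\<lambda>F. \<theta> (\<eta> F)) (\<lambda>F. \<eta>' (\<theta>' F))"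
proof -
  interpret P: exterior_iso L sc L' sc' lb lb' W wb \<iota> W' wb' \<iota>' \<psi> \<psi>' \<theta> \<theta>' by fact
  interpret Q: exterior_iso L' sc' L'' sc'' lb' lb'' W' wb' \<iota>' W'' wb'' \<iota>'' \<phi> \<phi>' \<eta> \<eta>' by fact
  show ?thesis
    by unfold_locales
      (simp_all add: P.psi_mem P.psi'_mem P.psi_inv P.psi'_inv P.psi_add P.psi_scale P.psi_lb P.theta_mem P.theta'_mem
        P.theta_inv P.theta'_inv P.theta_wb P.iota_out P.iota_eq
        Q.psi_mem Q.psi'_mem Q.psi_inv Q.psi'_inv Q.psi_add Q.psi_scale Q.psi_lb Q.theta_mem Q.theta'_mem
        Q.theta_inv Q.theta'_inv Q.theta_wb Q.iota'_out Q.iota_eq Q.lb_closed Q.wb_closed)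
qed

lemma complex_subspace_f1_bar:
  assumes J: "linear J"
  shows "complex_subspace (f1_bar J) gt_scale"
proof
  fix x y c
  have z: "map_prod J J (a + b) = map_prod J J a + map_prod J J b"
    "map_prod J J (cpx_scale c a) = cpx_scale c (map_prod J J a)" for a b
    by (cases a; cases b; simp add: linear_add[OF J] linear_diff[OF J] linear_scale[OF J])+
  have cs: "cpx_scale c (a + b) = cpx_scale c a + cpx_scale c b" "cpx_scale c (cpx_scale d a) = cpx_scale d (cpx_scale c a)"
    for a b :: "'a cpx" and c d by (cases a; cases b; simp add: algebra_simps)+
  show "x \<in> f1_bar J \<Longrightarrow> y \<in> f1_bar J \<Longrightarrow> x + y \<in> f1_bar J"
    by (cases x; cases y) (auto simp: f1_bar_def antiholo_def holo_dual_def mem_cpx_dual z cs algebra_simps)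
  show "x \<in> f1_bar J \<Longrightarrow> gt_scale c x \<in> f1_bar J"
    by (cases x) (auto simp: f1_bar_def antiholo_def holo_dual_def mem_cpx_dual z cs(2)[of c] algebra_simps)
  show "0 \<in> f1_bar J"
    by (auto simp: f1_bar_def antiholo_def holo_dual_def mem_cpx_dual zero_prod_def linear_0[OF J])
qed

text \<open>Closure under the Schouten bracket, a form of integrability, is assumed for
  \<open>J'\<close>: in the application this is \<open>model_J\<close>, where
  \<open>schouten_closed\<close> supplies it.\<close>

lemma exterior_iso_complex:
  assumes f: "lie_isomorphism br br' f" and fJ: "\<And>x. f (J x) = J' (f x)" and J: "linear J" and J': "linear J'"
    and closed: "\<And>F G. F \<in> f1 J' \<Longrightarrow> G \<in> f1 J' \<Longrightarrow> schouten br' F G \<in> f1 J'"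
      "\<And>F G. F \<in> f1_bar J' \<Longrightarrow> G \<in> f1_bar J' \<Longrightarrow> schouten br' F G \<in> f1_bar J'"
  shows "exterior_iso (f1_bar J) gt_scale (f1_bar J') gt_scale (schouten br) (schouten br')
     (f1 J) (schouten br) (\<lambda>F G. if G \<in> f1_bar J then gt_pairing F G else 0)
     (f1 J') (schouten br') (\<lambda>F G. if G \<in> f1_bar J' then gt_pairing F G else 0)
     (\<lambda>(z, \<alpha>). (cpx_map (inv f) z, \<alpha> \<circ> cpx_map f)) (\<lambda>(z, \<alpha>). (cpx_map f z, \<alpha> \<circ> cpx_map (inv f)))
     (\<lambda>(z, \<alpha>). (cpx_map (inv f) z, \<alpha> \<circ> cpx_map f)) (\<lambda>(z, \<alpha>). (cpx_map f z, \<alpha> \<circ> cpx_map (inv f)))"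
proof -
  let ?g = "inv f"
  note g = lie_isomorphism_inv[OF f]
  have lf: "linear f" "\<And>x y. f (br x y) = br' (f x) (f y)" "bij f"
    and lg: "linear ?g" "\<And>x y. ?g (br' x y) = br (?g x) (?g y)"
    using f g(1) by (auto simp: lie_isomorphism_def)
  have gJ: "?g (J' y) = J (?g y)" for y by (metis fJ g(2,3))
  have gf: "cpx_map ?g (cpx_map f z) = z" "cpx_map f (cpx_map ?g w) = w" for z w
    by (cases z; cases w; simp add: g)+
  have dual: "\<alpha> \<circ> cpx_map f \<in> cpx_dual" if "\<alpha> \<in> cpx_dual" for \<alpha>
    using that by (simp add: mem_cpx_dual cpx_map_linear[OF lf(1)])
  have dual': "\<alpha> \<circ> cpx_map ?g \<in> cpx_dual" if "\<alpha> \<in> cpx_dual" for \<alpha>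
    using that by (simp add: mem_cpx_dual cpx_map_linear[OF lg(1)])
  have cb: "cpx_map ?g (cpx_bracket br' z w) = cpx_bracket br (cpx_map ?g z) (cpx_map ?g w)" for z w
    by (cases z; cases w) (simp add: lg(2) linear_add[OF lg(1)] linear_diff[OF lg(1)])
  have cb': "cpx_bracket br' z (cpx_map f w) = cpx_map f (cpx_bracket br (cpx_map ?g z) w)" for z w
    by (metis cb gf)
  have h: "z \<in> holo J \<Longrightarrow> cpx_map f z \<in> holo J'" "z \<in> antiholo J \<Longrightarrow> cpx_map f z \<in> antiholo J'" for z
    by (cases z; auto simp: holo_def antiholo_def fJ[symmetric] linear_neg[OF lf(1)])+
  have h': "z \<in> holo J' \<Longrightarrow> cpx_map ?g z \<in> holo J" "z \<in> antiholo J' \<Longrightarrow> cpx_map ?g z \<in> antiholo J" for z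
    by (cases z; auto simp: holo_def antiholo_def gJ[symmetric] linear_neg[OF lg(1)])+
  have ci: "\<alpha> \<circ> cpx_map f \<circ> cpx_map ?g = \<alpha>" "\<beta> \<circ> cpx_map ?g \<circ> cpx_map f = \<beta>"
    for \<alpha> :: "'b cpx \<Rightarrow> complex" and \<beta> :: "'a cpx \<Rightarrow> complex" by (auto simp: gf fun_eq_iff)
  let ?p = "\<lambda>(z, \<alpha>). (cpx_map ?g z, \<alpha> \<circ> cpx_map f)" and ?q = "\<lambda>(z, \<alpha>). (cpx_map f z, \<alpha> \<circ> cpx_map ?g)"
  have hd: "\<alpha> \<circ> cpx_map f \<in> holo_dual J" if "\<alpha> \<in> holo_dual J'" for \<alpha>
    using that dual h(2) unfolding holo_dual_def by simp
  have ad: "\<alpha> \<circ> cpx_map f \<in> antiholo_dual J" if "\<alpha> \<in> antiholo_dual J'" for \<alpha>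
    using that dual h(1) unfolding antiholo_dual_def by simp
  have hd': "\<alpha> \<circ> cpx_map ?g \<in> holo_dual J'" if "\<alpha> \<in> holo_dual J" for \<alpha>
    using that dual' h'(2) unfolding holo_dual_def by simp
  have ad': "\<alpha> \<circ> cpx_map ?g \<in> antiholo_dual J'" if "\<alpha> \<in> antiholo_dual J" for \<alpha>
    using that dual' h'(1) unfolding antiholo_dual_def by simp
  have p: "?p F \<in> f1_bar J" if "F \<in> f1_bar J'" for F
    using that h'(2)[of "fst F"] hd[of "snd F"] unfolding f1_bar_def case_prod_beta mem_Times_iff fst_conv snd_conv by blast
  have p1: "?p F \<in> f1 J" if "F \<in> f1 J'" for F
    using that h'(1)[of "fst F"] ad[of "snd F"] unfolding f1_def case_prod_beta mem_Times_iff fst_conv snd_conv by blast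
  have q: "?q F \<in> f1_bar J'" if "F \<in> f1_bar J" for F
    using that h(2)[of "fst F"] hd'[of "snd F"] unfolding f1_bar_def case_prod_beta mem_Times_iff fst_conv snd_conv by blast
  have q1: "?q F \<in> f1 J'" if "F \<in> f1 J" for F
    using that h(1)[of "fst F"] ad'[of "snd F"] unfolding f1_def case_prod_beta mem_Times_iff fst_conv snd_conv by blast
  have pq: "?p (?q F) = F" "?q (?p G) = G"
    for F :: "'a gtangent" and G :: "'b gtangent"
    by (cases F; cases G; simp add: gf ci)+
  have ps: "?p (schouten br' F G) = schouten br (?p F) (?p G)" for F G
    by (cases F; cases G) (auto simp: cb d_one_def fun_eq_iff cb')
  have pp: "gt_pairing F G = gt_pairing (?p F) (?p G)" for F G
    by (cases F; cases G) (simp add: gf)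
  interpret A: complex_subspace "f1_bar J" gt_scale by (rule complex_subspace_f1_bar[OF J])
  interpret A': complex_subspace "f1_bar J'" gt_scale by (rule complex_subspace_f1_bar[OF J'])
  show ?thesis
  proof unfold_locales
    fix x y :: "'b gtangent" and c
    show "?p (x + y) = ?p x + ?p y" by (cases x; cases y) (auto simp: cpx_map_linear[OF lg(1)])
    show "?p (gt_scale c x) = gt_scale c (?p x)" by (cases x) (auto simp: cpx_map_linear[OF lg(1)])
    assume x: "x \<in> f1_bar J'"
    show "?p x \<in> f1_bar J" by (rule p[OF x])
    show "?q (?p x) = x" by (rule pq)
    assume y: "y \<in> f1_bar J'"
    show "schouten br' x y \<in> f1_bar J'" by (rule closed(2)[OF x y])
    show "?p (schouten br' x y) = schouten br (?p x) (?p y)" by (rule ps)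
  next
    fix x :: "'a gtangent" assume x: "x \<in> f1_bar J"
    show "?q x \<in> f1_bar J'" by (rule q[OF x])
    show "?p (?q x) = x" by (rule pq)
  next
    fix F :: "'b gtangent" assume F: "F \<in> f1 J'"
    show "?p F \<in> f1 J" by (rule p1[OF F])
    show "?q (?p F) = F" by (rule pq)
    show "x \<notin> f1_bar J' \<Longrightarrow> (if x \<in> f1_bar J' then gt_pairing F x else 0) = 0" for x by (simp only: if_False)
    show "(if x \<in> f1_bar J' then gt_pairing F x else 0) = (if ?p x \<in> f1_bar J then gt_pairing (?p F) (?p x) else 0)"
      if "x \<in> f1_bar J'" for x
      by (simp only: that p[OF that] if_True pp[of F x])
    fix G assume G: "G \<in> f1 J'"
    show "schouten br' F G \<in> f1 J'" by (rule closed(1)[OF F G])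
    show "?p (schouten br' F G) = schouten br (?p F) (?p G)" by (rule ps)
  next
    fix F :: "'a gtangent" assume F: "F \<in> f1 J"
    show "?q F \<in> f1 J'" by (rule q1[OF F])
    show "?p (?q F) = F" by (rule pq)
    show "x \<notin> f1_bar J \<Longrightarrow> (if x \<in> f1_bar J then gt_pairing F x else 0) = 0" for x by (simp only: if_False)
  qed
qed

text \<open>
  With \<open>a = x + i x'\<close>, \<open>c = u + i u'\<close> in \<open>\<gg>\<^sub>\<complex>\<close>, \<open>mirror_psi\<close> sends \<open>a + c\<close> to \<open>a + i J a\<close> together with the
  \<open>(1,0)\<close>-form \<open>Y + J V \<mapsto> B(c, Y + i V) / 2\<close>, and \<open>mirror_phi\<close> is its counterpart for the conjugate
  algebra. The constants are chosen so that the pairing becomes the symplectic form of the mirror.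
\<close>

definition mirror_psi :: "('g::real_vector \<Rightarrow> 'g \<Rightarrow> real) \<Rightarrow> ('g \<times> 'g) cpx \<Rightarrow> ('g \<times> 'g) gtangent" where
  "mirror_psi B = (\<lambda>((x, u), (x', u')). (((x, - x'), (x', x)),
     \<lambda>((y, v), (y', v')). cpx_form B (u, u') (y - v', y' + v) / 2))"

definition mirror_phi :: "('g::real_vector \<Rightarrow> 'g \<Rightarrow> real) \<Rightarrow> ('g \<times> 'g) cpx \<Rightarrow> ('g \<times> 'g) gtangent" where
  "mirror_phi B = (\<lambda>((x, u), (x', u')). (((x, x'), (x', - x)),
     \<lambda>((y, v), (y', v')). - cpx_form B (u, u') (y + v', y' - v) / 2))"

definition model_J :: "'g::real_vector \<times> 'g \<Rightarrow> 'g \<times> 'g" where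
  "model_J = (\<lambda>(x, u). (- u, x))"

definition model_omega :: "('g \<Rightarrow> 'g \<Rightarrow> real) \<Rightarrow> 'g \<times> 'g \<Rightarrow> 'g \<times> 'g \<Rightarrow> real" where
  "model_omega B = (\<lambda>(x, u) (y, v). B x v - B u y)"

lemma model_J_simp [simp]: "model_J (x, u) = (- u, x)"
  by (simp add: model_J_def)

lemma model_omega_simp [simp]: "model_omega B (x, u) (y, v) = B x v - B u y"
  by (simp add: model_omega_def)

lemma linear_model_J: "linear model_J"
  by (rule linearI) (auto simp: model_J_def)

lemma mem_antiholo_model: "z \<in> antiholo model_J \<longleftrightarrow> (\<exists>x x'. z = ((x, - x'), (x', x)))"
  by (cases z) (auto simp: antiholo_def)

lemma mem_holo_model: "z \<in> holo model_J \<longleftrightarrow> (\<exists>x x'. z = ((x, x'), (x', - x)))"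
  by (cases z) (auto simp: holo_def)

lemma bilinear_model_omega:
  assumes "bilinear B"
  shows "bilinear (model_omega B)"
  unfolding bilinear_def model_omega_def
  by (auto intro!: linearI simp: bilinear_ladd[OF assms] bilinear_radd[OF assms] bilinear_lmul[OF assms]
      bilinear_rmul[OF assms] algebra_simps)

lemma model_omega_nondegenerate:
  assumes B: "bilinear B" and nondeg: "\<forall>x. (\<forall>y. B x y = 0) \<longrightarrow> x = 0"
  shows "\<forall>z. (\<forall>w. model_omega B z w = 0) \<longrightarrow> z = 0"
proof (intro allI impI)
  fix z assume *: "\<forall>w. model_omega B z w = 0"
  obtain x u where z: "z = (x, u)" by fastforce
  have "B x y = 0" "B u y = 0" for y
    using *[rule_format, of "(0, y)"] *[rule_format, of "(y, 0)"]
    by (simp_all add: z bilinear_rzero[OF B])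
  then show "z = 0" using nondeg by (simp add: z zero_prod_def)
qed

text \<open>\<open>m\<close> describes the complex side and \<open>m'\<close> the symplectic side of
  a mirror pair; the same locale with the two products exchanged describes the opposite
  direction.\<close>

locale dual_products =
  fixes br :: "'g::real_vector \<Rightarrow> 'g \<Rightarrow> 'g" and m m' :: "'g \<Rightarrow> 'g \<Rightarrow> 'g" and B :: "'g \<Rightarrow> 'g \<Rightarrow> real"
  assumes fin: "finite_dimensional TYPE('g)"
    and m: "bilinear m" and m': "bilinear m'" and B: "bilinear B"
    and nondeg: "\<forall>x. (\<forall>y. B x y = 0) \<longrightarrow> x = 0"
    and br: "br x y = m x y - m y x"
    and sym: "B x y = B y x"
    and dual: "B (m' x y) z = - B y (m x z)"
begin

lemma bil: "m (x + y) z = m x z + m y z" "m x (y + z) = m x y + m x z" "m (x - y) z = m x z - m y z"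
  "m x (y - z) = m x y - m x z" "m (- x) y = - m x y" "m x (- y) = - m x y"
  "m (c *\<^sub>R x) y = c *\<^sub>R m x y" "m x (c *\<^sub>R y) = c *\<^sub>R m x y" "m 0 x = 0" "m x 0 = 0"
  "B (x + y) z = B x z + B y z" "B x (y + z) = B x y + B x z" "B (x - y) z = B x z - B y z"
  "B x (y - z) = B x y - B x z" "B (- x) y = - B x y" "B x (- y) = - B x y"
  "B (c *\<^sub>R x) y = c *\<^sub>R B x y" "B x (c *\<^sub>R y) = c *\<^sub>R B x y" "B 0 x = 0" "B x 0 = 0"
  using m B by (simp_all add: bilinear_ladd bilinear_radd bilinear_lsub bilinear_rsub bilinear_lneg bilinear_rneg
    bilinear_lmul bilinear_rmul bilinear_lzero bilinear_rzero)

lemma mirror_psi_add: "mirror_psi B (z + w) = mirror_psi B z + mirror_psi B w"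
  by (cases z; cases w) (auto simp: mirror_psi_def bil fun_eq_iff complex_eq_iff algebra_simps add_divide_distrib diff_divide_distrib)

lemma mirror_psi_scale: "mirror_psi B (cpx_scale c z) = gt_scale c (mirror_psi B z)"
  by (cases z) (auto simp: mirror_psi_def bil fun_eq_iff complex_eq_iff algebra_simps add_divide_distrib diff_divide_distrib)

lemma half_cpx_form_in_cpx_dual:
  "(\<lambda>((y, v), (y', v')). cpx_form B (u, u') (y - v', y' + v) / 2) \<in> cpx_dual"
  "(\<lambda>((y, v), (y', v')). - cpx_form B (u, u') (y + v', y' - v) / 2) \<in> cpx_dual"
  by (auto simp: mem_cpx_dual bil complex_eq_iff algebra_simps add_divide_distrib diff_divide_distrib)

lemma mirror_psi_mem: "mirror_psi B z \<in> f1_bar model_J"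
  using half_cpx_form_in_cpx_dual
  by (cases z) (auto simp: mirror_psi_def f1_bar_def mem_antiholo_model holo_dual_def bil complex_eq_iff)

lemma mirror_phi_mem: "mirror_phi B z \<in> f1 model_J"
  using half_cpx_form_in_cpx_dual
  by (cases z) (auto simp: mirror_phi_def f1_def mem_holo_model antiholo_dual_def bil complex_eq_iff)

lemma pairing_mirror: "gt_pairing (mirror_phi B w) (mirror_psi B z) = cpx_form (model_omega B) w z"
  by (cases z; cases w) (auto simp: mirror_phi_def mirror_psi_def bil sym complex_eq_iff algebra_simps add_divide_distrib diff_divide_distrib)

text \<open>When a form is evaluated on the bracket of a + i J a with a vector z, the two terms in
  which z multiplies a cancel, because \<open>br\<close> is the commutator of \<open>m\<close>. What
  remains is - B(c, m a z) up to the factor 1 / 2, and \<open>dual\<close> turns it into B(m' a c,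
  z), the action in the mirror.\<close>

lemma mirror_psi_bracket:
  "mirror_psi B (cpx_bracket (semidirect br m') z w) = schouten (semidirect br m) (mirror_psi B z) (mirror_psi B w)"
  by (cases z; cases w)
    (auto simp: mirror_psi_def d_one_def br bil dual fun_eq_iff complex_eq_iff algebra_simps add_divide_distrib diff_divide_distrib)

lemma mirror_phi_bracket:
  "mirror_phi B (cpx_bracket (semidirect br m') z w) = schouten (semidirect br m) (mirror_phi B z) (mirror_phi B w)"
  by (cases z; cases w)
    (auto simp: mirror_phi_def d_one_def br bil dual fun_eq_iff complex_eq_iff algebra_simps add_divide_distrib diff_divide_distrib)

text \<open>By \<open>pairing_mirror\<close> the value of \<open>mirror_psi\<close> determines all
  pairings with the mirror form, which is nondegenerate.\<close>

lemma inj_mirror_psi: "inj (mirror_psi B)"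
proof (rule injI)
  fix z w assume e: "mirror_psi B z = mirror_psi B w"
  have a1: "cpx_form (model_omega B) v z = cpx_form (model_omega B) v w" for v
    unfolding pairing_mirror[symmetric] e ..
  have a2: "cpx_form (model_omega B) v z = - cpx_form (model_omega B) z v" for v z
  proof -
    obtain p q where v: "v = (p, q)" by (cases v)
    obtain p' q' where z: "z = (p', q')" by (cases z)
    from v z show ?thesis
      by (cases p; cases q; cases p'; cases q') (simp add: complex_eq_iff sym algebra_simps)
  qed
  have "- cpx_form (model_omega B) z v = - cpx_form (model_omega B) w v" for v
    by (simp only: a2[symmetric] a1)
  then have "cpx_form (model_omega B) z = cpx_form (model_omega B) w" by (simp add: fun_eq_iff)
  then show "z = w"
    using cpx_form_inverse(2)[OF finite_dimensional_prod[OF fin fin] bilinear_model_omega[OF B]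
      model_omega_nondegenerate[OF B nondeg]] by blast
qed

lemma surj_mirror_psi:
  assumes "F \<in> f1_bar model_J"
  obtains z where "mirror_psi B z = F"
proof -
  obtain x x' \<beta> where F: "F = (((x, - x'), (x', x)), \<beta>)" and \<beta>: "\<beta> \<in> holo_dual model_J"
    using assms by (auto simp: f1_bar_def mem_antiholo_model)
  have d: "\<beta> \<in> cpx_dual" and zero: "\<beta> ((s, - s'), (s', s)) = 0" for s s'
    using \<beta> by (auto simp: holo_dual_def mem_antiholo_model)
  \<comment> \<open>The restriction of \<open>\<beta>\<close> to the complexification of
    \<open>\<gg>\<close>; it determines \<open>\<beta>\<close>, since antiholomorphic vectors are a
    complement on which \<open>\<beta>\<close> vanishes. The 2 undoes the 1 / 2 in
    \<open>mirror_psi\<close>.\<close>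
  define \<gamma> where "\<gamma> = (\<lambda>(y, y'). 2 * \<beta> ((y, 0), (y', 0)))"
  have "\<gamma> (z + w) = \<gamma> z + \<gamma> w" "\<gamma> (cpx_scale c z) = c * \<gamma> z" for z w c
    using cpx_dual_add[OF d, of "((fst z, 0), (snd z, 0))" "((fst w, 0), (snd w, 0))"]
      cpx_dual_scale[OF d, of c "((fst z, 0), (snd z, 0))"]
    by (cases z; cases w; simp add: \<gamma>_def)+
  then have "\<gamma> \<in> cpx_dual" by (simp add: mem_cpx_dual)
  then obtain u u' where u: "cpx_form B (u, u') = \<gamma>"
    using cpx_form_inverse(1)[OF fin B nondeg] by (metis surj_pair)
  have "\<beta> = (\<lambda>((y, v), (y', v')). cpx_form B (u, u') (y - v', y' + v) / 2)"
  proof (rule ext)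
    fix z :: "('g \<times> 'g) cpx" obtain a b where ab: "z = (a, b)" by (cases z)
    obtain y v where "a = (y, v)" by (cases a)
    moreover obtain y' v' where "b = (y', v')" by (cases b)
    ultimately have z: "z = ((y, v), (y', v'))" using ab by simp
    \<comment> \<open>The second summand is the antiholomorphic vector with s = v' and s' = - v, so
      \<open>zero\<close> removes it.\<close>
    have "\<beta> z = \<beta> (((y - v', 0), (y' + v, 0)) + ((v', - (- v)), (- v, v')))" by (simp add: z)
    also have "\<dots> = \<beta> ((y - v', 0), (y' + v, 0))" by (simp only: cpx_dual_add[OF d] zero add_0_right)
    finally show "\<beta> z = (\<lambda>((y, v), (y', v')). cpx_form B (u, u') (y - v', y' + v) / 2) z"
      by (simp add: z u \<gamma>_def del: cpx_form.simps)
  qed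
  then have "mirror_psi B ((x, u), (x', u')) = F" by (simp add: F mirror_psi_def del: cpx_form.simps)
  then show ?thesis by (rule that)
qed

lemma surj_mirror_phi:
  assumes "F \<in> f1 model_J"
  obtains z where "mirror_phi B z = F"
proof -
  obtain x x' \<beta> where F: "F = (((x, x'), (x', - x)), \<beta>)" and \<beta>: "\<beta> \<in> antiholo_dual model_J"
    using assms by (auto simp: f1_def mem_holo_model)
  have d: "\<beta> \<in> cpx_dual" and zero: "\<beta> ((s, s'), (s', - s)) = 0" for s s'
    using \<beta> by (auto simp: antiholo_dual_def mem_holo_model)
  define \<gamma> where "\<gamma> = (\<lambda>(y, y'). - 2 * \<beta> ((y, 0), (y', 0)))"
  have "\<gamma> (z + w) = \<gamma> z + \<gamma> w" "\<gamma> (cpx_scale c z) = c * \<gamma> z" for z w c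
    using cpx_dual_add[OF d, of "((fst z, 0), (snd z, 0))" "((fst w, 0), (snd w, 0))"]
      cpx_dual_scale[OF d, of c "((fst z, 0), (snd z, 0))"]
    by (cases z; cases w; simp add: \<gamma>_def)+
  then have "\<gamma> \<in> cpx_dual" by (simp add: mem_cpx_dual)
  then obtain u u' where u: "cpx_form B (u, u') = \<gamma>"
    using cpx_form_inverse(1)[OF fin B nondeg] by (metis surj_pair)
  have "\<beta> = (\<lambda>((y, v), (y', v')). - cpx_form B (u, u') (y + v', y' - v) / 2)"
  proof (rule ext)
    fix z :: "('g \<times> 'g) cpx" obtain a b where ab: "z = (a, b)" by (cases z)
    obtain y v where "a = (y, v)" by (cases a)
    moreover obtain y' v' where "b = (y', v')" by (cases b)
    ultimately have z: "z = ((y, v), (y', v'))" using ab by simp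
    have "\<beta> z = \<beta> (((y + v', 0), (y' - v, 0)) + ((- v', v), (v, - (- v'))))" by (simp add: z)
    also have "\<dots> = \<beta> ((y + v', 0), (y' - v, 0))" by (simp only: cpx_dual_add[OF d] zero add_0_right)
    finally show "\<beta> z = (\<lambda>((y, v), (y', v')). - cpx_form B (u, u') (y + v', y' - v) / 2) z"
      by (simp add: z u \<gamma>_def del: cpx_form.simps)
  qed
  then have "mirror_phi B ((x, u), (x', u')) = F" by (simp add: F mirror_phi_def del: cpx_form.simps)
  then show ?thesis by (rule that)
qed

text \<open>Both algebras are images of the complexified mirror under maps that respect the
  brackets, so closure is inherited from there.\<close>

lemma schouten_closed:
  "F \<in> f1 model_J \<Longrightarrow> G \<in> f1 model_J \<Longrightarrow> schouten (semidirect br m) F G \<in> f1 model_J"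
  "F \<in> f1_bar model_J \<Longrightarrow> G \<in> f1_bar model_J \<Longrightarrow> schouten (semidirect br m) F G \<in> f1_bar model_J"
  by (metis surj_mirror_phi mirror_phi_bracket mirror_phi_mem)
    (metis surj_mirror_psi mirror_psi_bracket mirror_psi_mem)

text \<open>\<open>mirror_psi\<close> identifies the Lie algebra that carries the forms. By
  \<open>pairing_mirror\<close>, \<open>mirror_phi\<close> identifies \<open>f1\<close> with the
  dual through the mirror symplectic form, which is exactly how \<open>omega_bracket\<close>
  transports the Lie bracket to one-forms.\<close>

lemma exterior_iso_mirror:
  "exterior_iso (f1_bar model_J) gt_scale UNIV cpx_scale (schouten (semidirect br m)) (cpx_bracket (semidirect br m'))
     (f1 model_J) (schouten (semidirect br m)) (\<lambda>F G. if G \<in> f1_bar model_J then gt_pairing F G else 0)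
     cpx_dual (omega_bracket (semidirect br m') (model_omega B)) (\<lambda>\<alpha>. \<alpha>)
     (mirror_psi B) (inv (mirror_psi B))
     (\<lambda>\<alpha>. mirror_phi B (inv (cpx_form (model_omega B)) \<alpha>)) (\<lambda>F z. gt_pairing F (mirror_psi B z))"
proof -
  interpret A: complex_subspace "f1_bar model_J" gt_scale by (rule complex_subspace_f1_bar[OF linear_model_J])
  note \<omega> = bilinear_model_omega[OF B]
  note inv = cpx_form_inverse[OF finite_dimensional_prod[OF fin fin] \<omega> model_omega_nondegenerate[OF B nondeg]]
  have i: "inv (cpx_form (model_omega B)) (cpx_form (model_omega B) w) = w" for w
    using inv(1)[OF cpx_form_in_cpx_dual[OF \<omega>]] by (rule inv(2))
  have p: "(\<lambda>z. gt_pairing (mirror_phi B w) (mirror_psi B z)) = cpx_form (model_omega B) w" for w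
    by (simp add: pairing_mirror fun_eq_iff)
  show ?thesis
  proof unfold_locales
    fix x y c
    show "mirror_psi B (x + y) = mirror_psi B x + mirror_psi B y" by (rule mirror_psi_add)
    show "mirror_psi B (cpx_scale c x) = gt_scale c (mirror_psi B x)" by (rule mirror_psi_scale)
    show "mirror_psi B x \<in> f1_bar model_J" by (rule mirror_psi_mem)
    show "inv (mirror_psi B) (mirror_psi B x) = x" by (rule inv_f_f[OF inj_mirror_psi])
    show "mirror_psi B (cpx_bracket (semidirect br m') x y) = schouten (semidirect br m) (mirror_psi B x) (mirror_psi B y)"
      by (rule mirror_psi_bracket)
  next
    fix z :: "('g \<times> 'g) gtangent" assume "z \<in> f1_bar model_J"
    then show "mirror_psi B (inv (mirror_psi B) z) = z" by (metis surj_mirror_psi f_inv_into_f rangeI)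
  next
    fix F :: "('g \<times> 'g) gtangent" assume F: "F \<in> f1 model_J"
    then obtain w where w: "F = mirror_phi B w" using surj_mirror_phi by metis
    show "(\<lambda>z. gt_pairing F (mirror_psi B z)) \<in> cpx_dual" unfolding w p by (rule cpx_form_in_cpx_dual[OF \<omega>])
    show "mirror_phi B (inv (cpx_form (model_omega B)) (\<lambda>z. gt_pairing F (mirror_psi B z))) = F"
      unfolding w p i ..
  next
    fix \<alpha> :: "('g \<times> 'g) cpx \<Rightarrow> complex" assume \<alpha>: "\<alpha> \<in> cpx_dual"
    show "mirror_phi B (inv (cpx_form (model_omega B)) \<alpha>) \<in> f1 model_J" by (rule mirror_phi_mem)
    show "(\<lambda>z. gt_pairing (mirror_phi B (inv (cpx_form (model_omega B)) \<alpha>)) (mirror_psi B z)) = \<alpha>"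
      unfolding p by (rule inv(1)[OF \<alpha>])
    from fun_cong[OF this]
    show "\<alpha> x = (if mirror_psi B x \<in> f1_bar model_J
        then gt_pairing (mirror_phi B (inv (cpx_form (model_omega B)) \<alpha>)) (mirror_psi B x) else 0)" for x
      by (simp only: mirror_psi_mem if_True)
  next
    fix \<alpha> \<beta> :: "('g \<times> 'g) cpx \<Rightarrow> complex" assume "\<alpha> \<in> cpx_dual" "\<beta> \<in> cpx_dual"
    show "omega_bracket (semidirect br m') (model_omega B) \<alpha> \<beta> \<in> cpx_dual"
      by (rule omega_bracket_in_cpx_dual[OF \<omega>])
    show "mirror_phi B (inv (cpx_form (model_omega B)) (omega_bracket (semidirect br m') (model_omega B) \<alpha> \<beta>)) =
      schouten (semidirect br m) (mirror_phi B (inv (cpx_form (model_omega B)) \<alpha>)) (mirror_phi B (inv (cpx_form (model_omega B)) \<beta>))"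
      unfolding omega_bracket_def i mirror_phi_bracket ..
  qed auto
qed

lemma bilinear_semidirect: "bilinear (semidirect br m')"
  unfolding bilinear_def
  by (auto intro!: linearI simp: br bil bilinear_ladd[OF m'] bilinear_radd[OF m'] bilinear_lmul[OF m'] bilinear_rmul[OF m'] algebra_simps)

lemma DGA_complex_isomorphic_mirror:
  assumes f: "lie_isomorphism br0 (semidirect br m) f" "\<And>x. f (J x) = model_J (f x)" and J: "linear J"
  shows "dga_isomorphic (DGA_complex br0 J) (DGA_symplectic (semidirect br m') (model_omega B))"
proof -
  note e = exterior_iso_trans[OF exterior_iso_complex[OF f J linear_model_J schouten_closed] exterior_iso_mirror]
  have "dga_isomorphic (DGA_symplectic (semidirect br m') (model_omega B)) (DGA_complex br0 J)"
    unfolding DGA_complex_def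
    by (rule DGA_symplectic_isomorphicI[OF finite_dimensional_prod[OF fin fin] bilinear_semidirect _
        bilinear_model_omega[OF B] model_omega_nondegenerate[OF B nondeg] exterior_iso.flip[OF e]])
      (auto simp: br zero_prod_def)
  then show ?thesis by (rule dga_isomorphic_sym)
qed

end

section \<open>Hessian structures\<close>

text \<open>A flat torsion-free connection \<open>m\<close> on the Lie algebra \<open>br\<close> with a compatible Hessian metric \<open>B\<close>.\<close>

definition hessian_structure ::
  "('g::real_vector \<Rightarrow> 'g \<Rightarrow> 'g) \<Rightarrow> ('g \<Rightarrow> 'g \<Rightarrow> 'g) \<Rightarrow> ('g \<Rightarrow> 'g \<Rightarrow> real) \<Rightarrow> bool" where
  "hessian_structure br m B \<longleftrightarrow> bilinear m \<and> bilinear B \<and> (\<forall>x y. B x y = B y x) \<and>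
     (\<forall>x. (\<forall>y. B x y = 0) \<longrightarrow> x = 0) \<and> (\<forall>x y. br x y = m x y - m y x) \<and>
     (\<forall>x y z. m (br x y) z = m x (m y z) - m y (m x z)) \<and>
     (\<forall>x y z. B (br x y) z = B x (m y z) - B y (m x z))"

lemma hessian_structureD:
  assumes "hessian_structure br m B"
  shows "bilinear m" "bilinear B" "B x y = B y x" "\<forall>x. (\<forall>y. B x y = 0) \<longrightarrow> x = 0" "br x y = m x y - m y x"
    "m (br x y) z = m x (m y z) - m y (m x z)" "B (br x y) z = B x (m y z) - B y (m x z)"
  using assms unfolding hessian_structure_def by metis+

text \<open>
  The isomorphism \<open>j : \<gg> \<rightarrow> V\<close> is the restriction of \<open>J\<close>; it turns \<open>\<rho>\<close> into \<open>m\<close> and \<open>\<omega>(x, J y)\<close> into \<open>B(x, y)\<close>.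
\<close>

definition modelled_by ::
  "('g::real_vector \<Rightarrow> 'g \<Rightarrow> 'g) \<Rightarrow> ('g \<Rightarrow> 'v::real_vector \<Rightarrow> 'v) \<Rightarrow> ('g \<times> 'v \<Rightarrow> 'g \<times> 'v) \<Rightarrow>
   ('g \<times> 'v \<Rightarrow> 'g \<times> 'v \<Rightarrow> real) \<Rightarrow> ('g \<Rightarrow> 'v) \<Rightarrow> ('g \<Rightarrow> 'g \<Rightarrow> 'g) \<Rightarrow> ('g \<Rightarrow> 'g \<Rightarrow> real) \<Rightarrow> bool" where
  "modelled_by br \<rho> J \<omega> j m B \<longleftrightarrow> linear j \<and> bij j \<and> hessian_structure br m B \<and>
     (\<forall>x y. \<rho> x (j y) = j (m x y)) \<and> (\<forall>x u. J (x, j u) = (- u, j x)) \<and>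
     (\<forall>x u y v. \<omega> (x, j u) (y, j v) = B x v - B u y)"

lemma bilinear_simps:
  assumes "bilinear h"
  shows "h (x + x') y = h x y + h x' y" "h x (y + y') = h x y + h x y'" "h (x - x') y = h x y - h x' y"
    "h x (y - y') = h x y - h x y'" "h (- x) y = - h x y" "h x (- y) = - h x y"
    "h (c *\<^sub>R x) y = c *\<^sub>R h x y" "h x (c *\<^sub>R y) = c *\<^sub>R h x y" "h 0 y = 0" "h x 0 = 0"
  using assms by (simp_all add: bilinear_ladd bilinear_radd bilinear_lsub bilinear_rsub bilinear_lneg bilinear_rneg
    bilinear_lmul bilinear_rmul bilinear_lzero bilinear_rzero)

lemma linear_inv_bij:
  assumes "linear f" "bij f"
  shows "linear (inv f)"
proof -
  have i: "f (inv f y) = y" for y using assms(2) by (simp add: bij_is_surj surj_f_inv_f)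
  show ?thesis
    by (rule linearI; rule injD[OF bij_is_inj[OF assms(2)]]) (simp_all add: i linear_add[OF assms(1)] linear_scale[OF assms(1)])
qed

text \<open>Each axiom is one hypothesis read on the two Lagrangian summands: invariance of
  \<open>\<omega>\<close> under \<open>J\<close> makes \<open>B\<close> symmetric, integrability on
  two elements of \<open>\<gg>\<close> makes \<open>br\<close> the commutator of \<open>m\<close>,
  the representation property is left-symmetry, and closedness on two elements of
  \<open>\<gg>\<close> and one of \<open>V\<close> is the equation for \<open>B\<close>.\<close>

lemma modelled_by_if_special_lagrangian:
  assumes "special_lagrangian br \<rho> J \<omega>"
  obtains j m B where "modelled_by br \<rho> J \<omega> j m B"
proof -
  from assms have la: "lie_algebra br" and rep: "bilinear \<rho>" "\<And>x y v. \<rho> (br x y) v = \<rho> x (\<rho> y v) - \<rho> y (\<rho> x v)"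
    and sy: "symplectic (semidirect br \<rho>) \<omega>" and ic: "integrable_complex_structure (semidirect br \<rho>) J"
    and inv: "\<And>x y. \<omega> (J x) (J y) = \<omega> x y"
    and JV: "J ` (UNIV \<times> {0}) = {0} \<times> UNIV" and lag: "lagrangian \<omega> (UNIV \<times> {0})" "lagrangian \<omega> ({0} \<times> UNIV)"
    by (auto simp: special_lagrangian_def lie_representation_def pseudo_kaehler_def)
  have brb: "bilinear br" using la by (simp add: lie_algebra_def)
  have J: "linear J" "\<And>x. J (J x) = - x"
    and int: "\<And>x y. semidirect br \<rho> x y - semidirect br \<rho> (J x) (J y) + J (semidirect br \<rho> x (J y) + semidirect br \<rho> (J x) y) = 0"
    using ic by (auto simp: integrable_complex_structure_def)
  have \<omega>: "bilinear \<omega>" "\<And>x. \<omega> x x = 0" "\<And>x. (\<forall>y. \<omega> x y = 0) \<Longrightarrow> x = 0"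
    and closed: "\<And>x y z. \<omega> (semidirect br \<rho> x y) z + \<omega> (semidirect br \<rho> y z) x + \<omega> (semidirect br \<rho> z x) y = 0"
    using sy by (auto simp: symplectic_def)
  have z: "\<rho> 0 v = 0" "\<rho> x 0 = 0" "br x 0 = 0" "br 0 x = 0" for x v
    using rep(1) brb by (simp_all add: bilinear_lzero bilinear_rzero)
  have w: "\<omega> (p + q) r = \<omega> p r + \<omega> q r" "\<omega> p (q + r) = \<omega> p q + \<omega> p r" "\<omega> (- p) q = - \<omega> p q" "\<omega> p (- q) = - \<omega> p q"
    "\<omega> 0 q = 0" "\<omega> q 0 = 0" for p q r
    using \<omega>(1) by (simp_all add: bilinear_ladd bilinear_radd bilinear_lneg bilinear_rneg bilinear_lzero bilinear_rzero)
  have anti: "\<omega> p q = - \<omega> q p" for p q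
  proof -
    have "\<omega> p p + \<omega> p q + (\<omega> q p + \<omega> q q) = \<omega> (p + q) (p + q)" by (simp add: w)
    then show ?thesis by (simp add: \<omega>(2))
  qed
  define j where "j x = snd (J (x, 0))" for x
  have Jx: "J (x, 0) = (0, j x)" for x
  proof -
    have "J (x, 0) \<in> J ` (UNIV \<times> {0})" by auto
    then show ?thesis unfolding JV by (auto simp: j_def)
  qed
  have lj: "linear j"
    unfolding j_def using linear_add[OF J(1), of "(_, 0)" "(_, 0)"] linear_scale[OF J(1), of _ "(_, 0)"]
    by (auto intro!: linearI)
  have "surj j"
  proof (unfold surj_def, rule allI)
    fix v :: 'b
    have "(0, v) \<in> J ` (UNIV \<times> {0})" unfolding JV by auto
    then show "\<exists>x. v = j x" by (auto simp: Jx)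
  qed
  moreover have "inj j"
  proof (rule linear_injective_0[OF lj, THEN iffD2], intro allI impI)
    fix x assume "j x = 0"
    then have "J (x, 0) = 0" by (simp add: Jx zero_prod_def)
    then have "- (x, 0 :: 'b) = 0" using J(2)[of "(x, 0)"] linear_0[OF J(1)] by simp
    then show "x = 0" by (simp add: zero_prod_def)
  qed
  ultimately have bj: "bij j" by (simp add: bij_def)
  have k: "inv j (j x) = x" "j (inv j v) = v" for x v
    using bj by (simp_all add: bij_is_inj bij_is_surj surj_f_inv_f inv_f_f)
  have lk: "linear (inv j)" by (rule linear_inv_bij[OF lj bj])
  have Jv: "J (0, j u) = (- u, 0)" for u
    using J(2)[of "(u, 0)"] by (simp add: Jx)
  have JJ: "J (x, j u) = (- u, j x)" for x u
    using linear_add[OF J(1), of "(x, 0)" "(0, j u)"] by (simp add: Jx Jv)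
  define m where "m x y = inv j (\<rho> x (j y))" for x y
  define B where "B x y = \<omega> (x, 0) (0, j y)" for x y
  have rj: "\<rho> x (j y) = j (m x y)" for x y by (simp add: m_def k)
  have isog: "\<omega> (x, 0) (y, 0) = 0" "\<omega> (0, u) (0, v) = 0" for x y u v
  proof -
    have "(x, 0) \<in> {p. \<forall>q\<in>UNIV \<times> {0}. \<omega> p q = 0}" "(0, u) \<in> {p. \<forall>q\<in>{0} \<times> UNIV. \<omega> p q = 0}"
      unfolding lag[unfolded lagrangian_def] by auto
    then show "\<omega> (x, 0) (y, 0) = 0" "\<omega> (0, u) (0, v) = 0" by auto
  qed
  have Bsym: "B x y = B y x" for x y
    using inv[of "(x, 0)" "(0, j y)"] w(4)[of "(0, j x)" "(y, 0)"] anti[of "(0, j x)" "(y, 0)"]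
    by (simp add: Jx Jv B_def)
  have om: "\<omega> (x, j u) (y, j v) = B x v - B u y" for x u y v
  proof -
    have "\<omega> (x, j u) (y, j v) = \<omega> ((x, 0) + (0, j u)) ((y, 0) + (0, j v))" by simp
    also have "\<dots> = B x v + \<omega> (0, j u) (y, 0)" unfolding w isog by (simp add: B_def)
    also have "\<omega> (0, j u) (y, 0) = - B y u" using anti[of "(0, j u)" "(y, 0)"] by (simp add: B_def)
    finally show ?thesis by (simp add: Bsym)
  qed
  have bm: "bilinear m"
    unfolding bilinear_def m_def
    by (auto intro!: linearI simp: linear_add[OF lj] linear_add[OF lk] linear_scale[OF lj] linear_scale[OF lk]
      bilinear_simps[OF rep(1)])
  have bB: "bilinear B"
    unfolding bilinear_def B_def
    using w(1)[of "(_, 0)" "(_, 0)"] w(2)[of _ "(0, _)" "(0, _)"] bilinear_lmul[OF \<omega>(1), of _ "(_, 0)"]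
      bilinear_rmul[OF \<omega>(1), of _ _ "(0, _)"]
    by (auto intro!: linearI simp: linear_add[OF lj] linear_scale[OF lj])
  have brm: "br x y = m x y - m y x" for x y
    using int[of "(x, 0)" "(y, 0)"]
    by (simp add: Jx z rj linear_diff[OF lj, symmetric] Jv bilinear_simps[OF bm] linear_0[OF lj] zero_prod_def
        add_eq_0_iff)
      (metis minus_diff_eq minus_minus)
  have "hessian_structure br m B"
    unfolding hessian_structure_def
  proof (intro conjI allI impI)
    fix x y z'
    show "bilinear m" "bilinear B" "B x y = B y x" "br x y = m x y - m y x" by fact+
    have "\<rho> (br x y) (j z') = \<rho> x (\<rho> y (j z')) - \<rho> y (\<rho> x (j z'))" by (rule rep)
    then show "m (br x y) z' = m x (m y z') - m y (m x z')"
      by (simp add: rj linear_diff[OF lj, symmetric] inj_eq[OF bij_is_inj[OF bj]])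
    have "\<omega> (br x y, j 0) (0, j z') + \<omega> (0, j (m y z')) (x, j 0) + \<omega> (0, j (- m x z')) (y, j 0) = 0"
      using closed[of "(x, 0)" "(y, 0)" "(0, j z')"] by (simp add: z rj linear_0[OF lj] linear_neg[OF lj])
    then show "B (br x y) z' = B x (m y z') - B y (m x z')"
      unfolding om by (simp add: bilinear_simps[OF bB] Bsym)
  next
    fix x assume "\<forall>y. B x y = 0"
    then have "\<omega> (x, j 0) (y, j v) = 0" for y v unfolding om by (simp add: bilinear_lzero[OF bB])
    then have "\<forall>q. \<omega> (x, 0) q = 0" using k(2) by (metis linear_0[OF lj] surj_pair)
    then show "x = 0" using \<omega>(3)[of "(x, 0)"] by (simp add: zero_prod_def)
  qed
  then have "modelled_by br \<rho> J \<omega> j m B"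
    unfolding modelled_by_def using lj bj rj JJ om by simp
  then show ?thesis by (rule that)
qed

text \<open>This is how the mirror is recognised as special Lagrangian, once it has a model. The
  Jacobi identity of \<open>br\<close> is the cyclic sum of left-symmetry.\<close>

lemma special_lagrangian_if_modelled_by:
  assumes "modelled_by br \<rho> J \<omega> j m B"
  shows "special_lagrangian br \<rho> J \<omega>"
proof -
  from assms have j: "linear j" "bij j" and rj: "\<And>x y. \<rho> x (j y) = j (m x y)"
    and JJ: "\<And>x u. J (x, j u) = (- u, j x)" and om: "\<And>x u y v. \<omega> (x, j u) (y, j v) = B x v - B u y"
    and h: "hessian_structure br m B" unfolding modelled_by_def by auto
  from h have m: "bilinear m" and B: "bilinear B" and sym: "\<And>x y. B x y = B y x"
    and nd: "\<And>x. (\<forall>y. B x y = 0) \<Longrightarrow> x = 0" and br: "\<And>x y. br x y = m x y - m y x"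
    and rep: "\<And>x y z. m (m x y) z - m (m y x) z = m x (m y z) - m y (m x z)"
    and cl: "\<And>x y z. B (m x y) z - B (m y x) z = B x (m y z) - B y (m x z)"
    unfolding hessian_structure_def by (auto simp: bilinear_simps)
  note bm = bilinear_simps[OF m] and bB = bilinear_simps[OF B]
  note lj = linear_add[OF j(1)] linear_diff[OF j(1)] linear_scale[OF j(1)] linear_neg[OF j(1)] linear_0[OF j(1)]
  have ex: "\<exists>u. v = j u" for v using j(2) by (metis bij_pointE)
  have rbil: "bilinear \<rho>"
    unfolding bilinear_def
  proof (intro conjI allI linearI)
    fix x y v v' c
    obtain u u' where u: "v = j u" "v' = j u'" using ex by metis
    show "\<rho> x (v + v') = \<rho> x v + \<rho> x v'" "\<rho> x (c *\<^sub>R v) = c *\<^sub>R \<rho> x v"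
      "\<rho> (x + y) v = \<rho> x v + \<rho> y v" "\<rho> (c *\<^sub>R x) v = c *\<^sub>R \<rho> x v"
      by (simp_all add: u rj lj[symmetric] bm)
  qed
  have brr: "bilinear br" by (auto simp: bilinear_def br bm algebra_simps intro!: linearI)
  have "br x (br y z) = m x (m y z) - m x (m z y) - (m y (m z x) - m z (m y x))" for x y z
    by (simp only: br bm rep)
  then have "br x (br y z) + br y (br z x) + br z (br x y) = 0" for x y z
    by simp
  then have 1: "lie_algebra br" by (simp add: lie_algebra_def brr) (simp add: br)
  have 2: "lie_representation br \<rho>"
    unfolding lie_representation_def
  proof (intro conjI allI rbil)
    fix x y v obtain u where "v = j u" using ex by metis
    then show "\<rho> (br x y) v = \<rho> x (\<rho> y v) - \<rho> y (\<rho> x v)" using rep[of x y u]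
      by (simp add: rj lj(2)[symmetric] br bm)
  qed
  have split: "\<exists>x u. p = (x, j u)" for p using ex by (metis surj_pair)
  have sd: "semidirect br \<rho> (x, j u) (y, j v) = (m x y - m y x, j (m x v - m y u))" for x u y v
    by (simp add: rj br lj)
  have add: "(x, j u) + (y, j v) = (x + y, j (u + v))" "(x, j u) - (y, j v) = (x - y, j (u - v))"
    "c *\<^sub>R (x, j u) = (c *\<^sub>R x, j (c *\<^sub>R u))" "- (x, j u) = (- x, j (- u))" "(0, 0) = (0, j 0)" for x y u v c
    by (simp_all add: lj)
  have 3: "symplectic (semidirect br \<rho>) \<omega>"
    unfolding symplectic_def
  proof (intro conjI allI impI)
    show "bilinear \<omega>"
      unfolding bilinear_def
    proof (intro conjI allI linearI)
      fix p q r :: "'a \<times> 'b" and c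
      obtain x u y v z w where p: "p = (x, j u)" "q = (y, j v)" "r = (z, j w)" using split by metis
      show "\<omega> p (q + r) = \<omega> p q + \<omega> p r" "\<omega> p (c *\<^sub>R q) = c *\<^sub>R \<omega> p q"
        "\<omega> (p + q) r = \<omega> p r + \<omega> q r" "\<omega> (c *\<^sub>R p) q = c *\<^sub>R \<omega> p q"
        unfolding p add om by (simp_all add: bB algebra_simps)
    qed
    fix p q r :: "'a \<times> 'b"
    obtain x u y v z w where p: "p = (x, j u)" "q = (y, j v)" "r = (z, j w)" using split by metis
    show "\<omega> p p = 0" unfolding p om by (simp add: sym)
    show "\<omega> (semidirect br \<rho> p q) r + \<omega> (semidirect br \<rho> q r) p + \<omega> (semidirect br \<rho> r p) q = 0"
      unfolding p sd om bB cl by (simp add: sym)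
    assume "\<forall>q. \<omega> p q = 0"
    then have 0: "\<omega> p (y, j v) = 0" for y v by simp
    have "B x v = 0" "B u y = 0" for v y
      using 0[of 0 v] 0[of y 0] unfolding p om by (simp_all add: bB)
    then show "p = 0" unfolding p using nd[of x] nd[of u] by (simp add: lj zero_prod_def)
  qed
  have 4: "integrable_complex_structure (semidirect br \<rho>) J"
    unfolding integrable_complex_structure_def
  proof (intro conjI allI linearI)
    fix p q :: "'a \<times> 'b" and c
    obtain x u y v where p: "p = (x, j u)" "q = (y, j v)" using split by metis
    show "J (p + q) = J p + J q" "J (c *\<^sub>R p) = c *\<^sub>R J p" "J (J p) = - p"
      unfolding p add JJ by (simp_all add: lj)
    show "semidirect br \<rho> p q - semidirect br \<rho> (J p) (J q) + J (semidirect br \<rho> p (J q) + semidirect br \<rho> (J p) q) = 0"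
      unfolding p JJ sd add by (simp add: bm lj zero_prod_def)
  qed
  have 5: "\<omega> (J p) (J q) = \<omega> p q" for p q
  proof -
    obtain x u y v where p: "p = (x, j u)" "q = (y, j v)" using split by metis
    show ?thesis unfolding p JJ om by (simp add: bB sym)
  qed
  have J0: "J (x, 0) = (0, j x)" for x using JJ[of x 0] by (simp add: lj)
  have 6: "J ` (UNIV \<times> {0}) = {0} \<times> UNIV"
    using ex by (force simp: J0 image_iff)
  have 7: "lagrangian \<omega> (UNIV \<times> {0})"
    unfolding lagrangian_def
  proof (intro equalityI subsetI)
    fix p assume "p \<in> {x. \<forall>y\<in>UNIV \<times> {0}. \<omega> x y = 0}"
    then have 0: "\<omega> p (y, j 0) = 0" for y by (simp add: lj)
    obtain x u where p: "p = (x, j u)" using split by metis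
    have "B u y = 0" for y using 0[of y] unfolding p om by (simp add: bB)
    then show "p \<in> UNIV \<times> {0}" using nd[of u] by (simp add: p lj)
  next
    fix p :: "'a \<times> 'b" assume "p \<in> UNIV \<times> {0}"
    then obtain x where "p = (x, j 0)" by (auto simp: lj)
    moreover have "\<omega> (x, j 0) (y, j 0) = 0" for y unfolding om by (simp add: bB)
    ultimately show "p \<in> {x. \<forall>y\<in>UNIV \<times> {0}. \<omega> x y = 0}" by (auto simp: lj)
  qed
  have 8: "lagrangian \<omega> ({0} \<times> UNIV)"
    unfolding lagrangian_def
  proof (intro equalityI subsetI)
    fix p assume "p \<in> {x. \<forall>y\<in>{0} \<times> UNIV. \<omega> x y = 0}"
    then have 0: "\<omega> p (0, j v) = 0" for v by simp
    obtain x u where p: "p = (x, j u)" using split by metis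
    have "B x v = 0" for v using 0[of v] unfolding p om by (simp add: bB)
    then show "p \<in> {0} \<times> UNIV" using nd[of x] by (simp add: p)
  next
    fix p :: "'a \<times> 'b" assume "p \<in> {0} \<times> UNIV"
    then obtain u where "p = (0, j u)" using ex by auto
    moreover have "\<omega> (0, j u) (0, j v) = 0" for v unfolding om by (simp add: bB)
    ultimately show "p \<in> {x. \<forall>y\<in>{0} \<times> UNIV. \<omega> x y = 0}" using ex by (auto; metis)
  qed
  show ?thesis
    unfolding special_lagrangian_def pseudo_kaehler_def using 1 2 3 4 5 6 7 8 by blast
qed

text \<open>In terms of connections, \<open>m'\<close> is the conjugate of \<open>m\<close> with
  respect to the metric \<open>B\<close>.\<close>

definition dual_product :: "('g \<Rightarrow> 'g \<Rightarrow> 'g) \<Rightarrow> ('g \<Rightarrow> 'g \<Rightarrow> 'g) \<Rightarrow> ('g \<Rightarrow> 'g \<Rightarrow> real) \<Rightarrow> bool" where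
  "dual_product m m' B \<longleftrightarrow> (\<forall>x y z. B (m' x y) z = - B y (m x z))"

lemma nondegenerate_eqI:
  assumes "bilinear B" "\<forall>x. (\<forall>y. B x y = 0) \<longrightarrow> x = 0" "\<And>z. B x z = B y z"
  shows "x = y"
  using assms(2)[rule_format, of "x - y"] assms(3) by (simp add: bilinear_simps[OF assms(1)])

text \<open>Passing to minus the adjoint keeps flatness and exchanges the other two conditions:
  closedness of \<open>B\<close> for \<open>m\<close> says that \<open>br\<close> is the commutator
  of \<open>m'\<close>, and the commutator property of \<open>m\<close> says that \<open>B\<close>
  is closed for \<open>m'\<close>.\<close>

lemma dual_product_exists:
  assumes fin: "finite_dimensional TYPE('g::real_vector)" and h: "hessian_structure br m (B :: 'g \<Rightarrow> 'g \<Rightarrow> real)"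
  obtains m' where "hessian_structure br m' B" "dual_product m m' B"
proof -
  have m: "bilinear m" and B: "bilinear B" and sym: "\<And>x y. B x y = B y x"
    and nd: "\<forall>x. (\<forall>y. B x y = 0) \<longrightarrow> x = 0" and br: "\<And>x y. br x y = m x y - m y x"
    and rep: "\<And>x y z. m (br x y) z = m x (m y z) - m y (m x z)"
    and cl: "\<And>x y z. B (br x y) z = B x (m y z) - B y (m x z)"
    by (rule hessian_structureD[OF h])+
  note bm = bilinear_simps[OF m] and bB = bilinear_simps[OF B] and eqI = nondegenerate_eqI[OF B nd]
  have "\<exists>w. B w = (\<lambda>z. - B y (m x z))" for x y
  proof -
    have "linear (\<lambda>z. - B y (m x z))" by (rule linearI) (simp_all add: bB bm)
    from bilinear_form_represents[OF fin B nd this] show ?thesis by blast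
  qed
  note ex = this
  define m' where "m' x y = (SOME w. B w = (\<lambda>z. - B y (m x z)))" for x y
  have m': "B (m' x y) z = - B y (m x z)" for x y z
    using someI_ex[OF ex[of y x]] unfolding m'_def by simp
  have "hessian_structure br m' B"
    unfolding hessian_structure_def
  proof (intro conjI allI B)
    show "bilinear m'"
      unfolding bilinear_def
      by (intro conjI allI linearI; rule eqI; simp add: m' bB bm)
    fix x y z
    show "(\<forall>y. B x y = 0) \<longrightarrow> x = 0" by (rule spec[OF nd])
    show "B x y = B y x" by (rule sym)
    show "br x y = m' x y - m' y x" by (rule eqI) (simp add: m' bB cl)
    show "m' (br x y) z = m' x (m' y z) - m' y (m' x z)" by (rule eqI) (simp add: m' bB rep)
    show "B (br x y) z = B x (m' y z) - B y (m' x z)"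
      unfolding sym[of x "m' y z"] sym[of y "m' x z"] m' br bB by (simp add: sym)
  qed
  then show ?thesis using that m' by (auto simp: dual_product_def)
qed

section \<open>The model of the mirror structure\<close>

lemma dual_apply_Dual: "linear f \<Longrightarrow> dual_apply (Dual f) = f"
  by (simp add: Dual_inverse)

lemma dual_eqI: "(\<And>v. dual_apply a v = dual_apply b v) \<Longrightarrow> a = b"
  by (metis dual_apply_inject ext)

lemma linear_dual_apply: "linear (dual_apply a)"
  using dual_apply by blast

lemma modelled_by_mirror:
  assumes fin: "finite_dimensional TYPE('g::real_vector)"
    and mod: "modelled_by (br :: 'g \<Rightarrow> 'g \<Rightarrow> 'g) (\<rho> :: 'g \<Rightarrow> 'v::real_vector \<Rightarrow> 'v) J \<omega> j m B"
    and h': "hessian_structure br m' B" and dual: "dual_product m m' B"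
  shows "modelled_by br (dual_rep \<rho>) (mirror_J \<omega>) (mirror_omega J) (omega_iso \<omega>) m' B"
proof -
  from mod have j: "linear j" "bij j" and rj: "\<And>x y. \<rho> x (j y) = j (m x y)"
    and JJ: "\<And>x u. J (x, j u) = (- u, j x)" and om: "\<And>x u y v. \<omega> (x, j u) (y, j v) = B x v - B u y"
    and h: "hessian_structure br m B" unfolding modelled_by_def by auto
  have "special_lagrangian br \<rho> J \<omega>" by (rule special_lagrangian_if_modelled_by[OF mod])
  then have rbil: "bilinear \<rho>" by (simp add: special_lagrangian_def lie_representation_def)
  have m: "bilinear m" and B: "bilinear B" and sym: "\<And>x y. B x y = B y x"
    and nd: "\<forall>x. (\<forall>y. B x y = 0) \<longrightarrow> x = 0"
    by (rule hessian_structureD[OF h])+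
  note bm = bilinear_simps[OF m] and bB = bilinear_simps[OF B]
  let ?k = "omega_iso \<omega>"
  note lj = linear_add[OF j(1)] linear_diff[OF j(1)] linear_scale[OF j(1)] linear_neg[OF j(1)] linear_0[OF j(1)]
  have ex: "\<exists>u. v = j u" for v using j(2) by (metis bij_pointE)
  have om0: "\<omega> (x, 0) (0, j v) = B x v" for x v using om[of x 0 0 v] by (simp add: lj bB)
  have "linear (\<lambda>v. \<omega> (x, 0) (0, v))" for x
  proof (rule linearI)
    fix v v' c obtain u u' where u: "v = j u" "v' = j u'" using ex by metis
    show "\<omega> (x, 0) (0, v + v') = \<omega> (x, 0) (0, v) + \<omega> (x, 0) (0, v')"
      "\<omega> (x, 0) (0, c *\<^sub>R v) = c *\<^sub>R \<omega> (x, 0) (0, v)"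
      unfolding u lj(1,3)[symmetric] om0 by (simp_all add: bB)
  qed
  \<comment> \<open>In the model \<open>omega_iso\<close> is the map given by the metric
    \<open>B\<close>; its bijectivity and the identification of the dual representation with
    \<open>m'\<close> are both read off from this evaluation.\<close>
  then have ka: "dual_apply (?k x) (j v) = B x v" for x v
    by (simp add: omega_iso_def dual_apply_Dual om0)
  have eqI: "a = b" if "\<And>z. dual_apply a (j z) = dual_apply b (j z)" for a b
    by (rule dual_eqI) (metis that ex)
  have lk: "linear ?k"
    by (rule linearI; rule eqI) (simp_all add: ka bB plus_dual.rep_eq scaleR_dual.rep_eq)
  have "inj ?k"
    by (rule injI, rule nondegenerate_eqI[OF B nd]) (metis ka)
  moreover have "surj ?k"
  proof (unfold surj_def, rule allI)
    fix a :: "'v dual"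
    have "linear (\<lambda>y. dual_apply a (j y))" using linear_compose[OF j(1) linear_dual_apply] by (simp add: o_def)
    then obtain x where "B x = (\<lambda>y. dual_apply a (j y))"
      using bilinear_form_represents[OF fin B nd] by blast
    then have "?k x = a" by (intro eqI) (simp add: ka)
    then show "\<exists>x. a = ?k x" by blast
  qed
  ultimately have bk: "bij ?k" by (simp add: bij_def)
  have dr: "dual_rep \<rho> x (?k y) = ?k (m' x y)" for x y
  proof (rule eqI)
    fix z
    have "linear (\<lambda>u. - dual_apply (?k y) (\<rho> x u))"
      using linear_dual_apply[of "?k y"] bilinear_simps[OF rbil]
      by (intro linearI) (simp_all add: linear_add linear_scale)
    then show "dual_apply (dual_rep \<rho> x (?k y)) (j z) = dual_apply (?k (m' x y)) (j z)"
      using dual by (simp add: dual_rep_def dual_apply_Dual rj ka dual_product_def)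
  qed
  have i: "inv ?k (?k u) = u" for u using bk by (simp add: bij_is_inj)
  have J0: "J (x, 0) = (0, j x)" for x using JJ[of x 0] by (simp add: lj)
  show ?thesis
    unfolding modelled_by_def using lk bk h' dr by (simp add: i J0 ka sym)
qed

lemma modelled_by_equivalence:
  assumes mod: "modelled_by (br :: 'g::real_vector \<Rightarrow> 'g \<Rightarrow> 'g) \<rho> J \<omega> j m B"
  shows "\<exists>f. lie_isomorphism (semidirect br \<rho>) (semidirect br m) f \<and>
    (\<forall>p. f (J p) = model_J (f p)) \<and> (\<forall>p q. model_omega B (f p) (f q) = \<omega> p q)"
proof -
  from mod have j: "linear j" "bij j" and rj: "\<And>x y. \<rho> x (j y) = j (m x y)"
    and JJ: "\<And>x u. J (x, j u) = (- u, j x)" and om: "\<And>x u y v. \<omega> (x, j u) (y, j v) = B x v - B u y"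
    unfolding modelled_by_def by auto
  note lk = linear_inv_bij[OF j]
  have k: "inv j (j x) = x" "j (inv j v) = v" for x v
    using j(2) by (simp_all add: bij_is_inj bij_is_surj surj_f_inv_f inv_f_f)
  define f where "f = (\<lambda>(x :: 'g, v). (x, inv j v))"
  have fj: "f (x, j u) = (x, u)" for x u by (simp add: f_def k)
  have split: "\<exists>x u. p = (x, j u)" for p using k(2) by (metis surj_pair)
  have "linear f" by (auto simp: f_def intro!: linearI simp: linear_add[OF lk] linear_scale[OF lk])
  moreover have "bij f"
    by (rule o_bij[of "\<lambda>(x, u). (x, j u)"]) (auto simp: f_def k fun_eq_iff)
  moreover have "f (semidirect br \<rho> p q) = semidirect br m (f p) (f q)" for p q
  proof -
    obtain x u y v where p: "p = (x, j u)" "q = (y, j v)" using split by metis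
    show ?thesis by (simp add: p fj rj linear_diff[OF j(1), symmetric])
  qed
  ultimately have "lie_isomorphism (semidirect br \<rho>) (semidirect br m) f" by (simp add: lie_isomorphism_def)
  moreover have "f (J p) = model_J (f p)" for p
  proof -
    obtain x u where p: "p = (x, j u)" using split by metis
    show ?thesis by (simp add: p JJ fj)
  qed
  moreover have "model_omega B (f p) (f q) = \<omega> p q" for p q
  proof -
    obtain x u y v where p: "p = (x, j u)" "q = (y, j v)" using split by metis
    show ?thesis by (simp add: p om fj)
  qed
  ultimately show ?thesis by blast
qed

section \<open>Normal forms in dimension three\<close>

definition frame :: "'g::real_vector \<Rightarrow> 'g \<Rightarrow> 'g \<Rightarrow> bool" where
  "frame v1 v2 v3 \<longleftrightarrow> (\<forall>x y z. x *\<^sub>R v1 + y *\<^sub>R v2 + z *\<^sub>R v3 = 0 \<longrightarrow> x = 0 \<and> y = 0 \<and> z = 0) \<and>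
     (\<forall>v. \<exists>x y z. v = x *\<^sub>R v1 + y *\<^sub>R v2 + z *\<^sub>R v3)"

lemma frameI:
  assumes "\<And>x y z. x *\<^sub>R v1 + y *\<^sub>R v2 + z *\<^sub>R v3 = 0 \<Longrightarrow> x = 0 \<and> y = 0 \<and> z = 0"
    and "\<And>v. \<exists>x y z. v = x *\<^sub>R v1 + y *\<^sub>R v2 + z *\<^sub>R v3"
  shows "frame v1 v2 v3"
  using assms by (simp add: frame_def)

lemma frame_zero: "frame v1 v2 v3 \<Longrightarrow> x *\<^sub>R v1 + y *\<^sub>R v2 + z *\<^sub>R v3 = 0 \<Longrightarrow> x = 0 \<and> y = 0 \<and> z = 0"
  by (simp add: frame_def)

lemma frame_span: "frame v1 v2 v3 \<Longrightarrow> \<exists>x y z. v = x *\<^sub>R v1 + y *\<^sub>R v2 + z *\<^sub>R v3"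
  by (simp add: frame_def)

text \<open>Since \<open>\<rho>\<close> becomes left multiplication, the images of these sets under
  \<open>j\<close> lie in the lower central series of the semidirect product. No spans are taken:
  only containment in subspaces will be asked.\<close>

primrec left_powers :: "('g \<Rightarrow> 'g \<Rightarrow> 'g) \<Rightarrow> nat \<Rightarrow> 'g set" where
  "left_powers m 0 = UNIV"
| "left_powers m (Suc n) = {m x y | x y. y \<in> left_powers m n}"

lemma left_powers_modelled_by:
  assumes mod: "modelled_by br \<rho> J \<omega> j m B" and v: "v \<in> left_powers m n"
  shows "(0, j v) \<in> lower_central (semidirect br \<rho>) n"
  using v
proof (induction n arbitrary: v)
  case (Suc n)
  have j: "linear j" and rj: "\<And>x y. \<rho> x (j y) = j (m x y)" and h: "hessian_structure br m B"
    using mod unfolding modelled_by_def by auto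
  have m: "bilinear m" and br: "\<And>x y. br x y = m x y - m y x" by (rule hessian_structureD[OF h])+
  obtain x y where v: "v = m x y" "y \<in> left_powers m n" using Suc.prems by auto
  have "semidirect br \<rho> (x, j 0) (0, j y) = (0, j v)"
    by (simp only: semidirect.simps rj) (simp add: br bilinear_simps[OF m] v linear_0[OF j])
  moreover have "semidirect br \<rho> (x, j 0) (0, j y) \<in> lower_central (semidirect br \<rho>) (Suc n)"
    unfolding lower_central.simps using Suc.IH[OF v(2)] by (intro span_base) blast
  ultimately show ?case by simp
qed simp

lemma nilpotent_left_powers:
  assumes mod: "modelled_by br \<rho> J \<omega> j m B" and "nilpotent_lie (semidirect br \<rho>)"
  obtains n where "left_powers m n \<subseteq> {0}"
proof -
  obtain n where n: "lower_central (semidirect br \<rho>) n = {0}" using assms(2) by (auto simp: nilpotent_lie_def)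
  have j: "linear j" "inj j" using mod by (auto simp: modelled_by_def bij_is_inj)
  have "v = 0" if "v \<in> left_powers m n" for v
  proof -
    have "j v = 0" using left_powers_modelled_by[OF mod that] n by (simp add: zero_prod_def)
    then show ?thesis using j by (metis injD linear_0)
  qed
  then show ?thesis using that by blast
qed

text \<open>An Engel type argument: the last left power that is not contained in \<open>V\<close>
  supplies \<open>f\<close>.\<close>

lemma exists_invariant_modulo:
  assumes "left_powers m n \<subseteq> {0}" "0 \<in> V" "V \<noteq> UNIV"
  obtains f where "f \<notin> V" "\<And>x. m x f \<in> V"
proof -
  have "\<exists>n. left_powers m n \<subseteq> V" using assms by blast
  define k where "k = (LEAST n. left_powers m n \<subseteq> V)"
  have k: "left_powers m k \<subseteq> V" unfolding k_def by (rule LeastI_ex) fact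
  have "k \<noteq> 0" using k assms(3) by auto
  then obtain l where l: "k = Suc l" using not0_implies_Suc by blast
  have "\<not> left_powers m l \<subseteq> V" using not_less_Least[of l "\<lambda>n. left_powers m n \<subseteq> V"] l k_def by auto
  then obtain f where f: "f \<in> left_powers m l" "f \<notin> V" by blast
  moreover have "m x f \<in> V" for x using k f(1) unfolding l by auto
  ultimately show ?thesis using that by blast
qed

text \<open>Three applications of \<open>exists_invariant_modulo\<close>, to 0 and to the spans of
  \<open>v3\<close> and of \<open>v2\<close>, \<open>v3\<close>, make all left multiplications
  strictly triangular at once. That these subspaces are proper is the dimension count.\<close>

lemma exists_flag:
  assumes nil: "left_powers m n \<subseteq> {0 :: 'g::real_vector}"
    and S: "finite (S :: 'g set)" "independent S" "span S = UNIV" "card S = 3"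
  obtains v1 v2 v3 where "frame v1 v2 v3" "\<And>x. m x v3 = 0" "\<And>x. \<exists>b. m x v2 = b *\<^sub>R v3"
    "\<And>x. \<exists>a c. m x v1 = a *\<^sub>R v2 + c *\<^sub>R v3"
proof -
  have small: "span T \<noteq> UNIV" if "finite T" "card T < 3" for T :: "'g set"
  proof
    assume "span T = UNIV"
    then have "S \<subseteq> span T" by simp
    from independent_span_bound[OF that(1) S(2) this] S(4) that(2) show False by simp
  qed
  have "{0 :: 'g} \<noteq> UNIV" using small[of "{}"] by simp
  from exists_invariant_modulo[OF nil _ this] obtain v3 where v3: "v3 \<noteq> 0" "\<And>x. m x v3 = 0" by auto
  have "span {v3} \<noteq> UNIV" by (rule small) auto
  from exists_invariant_modulo[OF nil span_zero this]
  obtain v2 where v2: "v2 \<notin> span {v3}" "\<And>x. m x v2 \<in> span {v3}" by blast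
  have "card {v2, v3} \<le> 2" by (simp add: card_insert_if)
  then have "span {v2, v3} \<noteq> UNIV" by (intro small) auto
  from exists_invariant_modulo[OF nil span_zero this]
  obtain v1 where v1: "v1 \<notin> span {v2, v3}" "\<And>x. m x v1 \<in> span {v2, v3}" by blast
  have mem1: "\<exists>k. x = k *\<^sub>R v3" if "x \<in> span {v3}" for x using that by (auto simp: span_singleton)
  have mem2: "\<exists>a c. x = a *\<^sub>R v2 + c *\<^sub>R v3" if x: "x \<in> span {v2, v3}" for x
  proof -
    obtain a where "x - a *\<^sub>R v2 \<in> span {v3}" using span_breakdown_eq[THEN iffD1, OF x] by blast
    with mem1 obtain c where "x - a *\<^sub>R v2 = c *\<^sub>R v3" by blast
    then have "x = a *\<^sub>R v2 + c *\<^sub>R v3" by (simp add: algebra_simps)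
    then show ?thesis by blast
  qed
  have i3: "independent {v3}" using v3(1) by (simp add: dependent_single)
  have i2: "independent {v2, v3}" using independent_insert[of v2 "{v3}"] i3 v2(1) by auto
  have i1: "independent {v1, v2, v3}" using independent_insert[of v1 "{v2, v3}"] i2 v1(1) by auto
  have ne: "v1 \<noteq> v2" "v1 \<noteq> v3" "v2 \<noteq> v3" using v1(1) v2(1) by (auto simp: span_base)
  have sp: "span {v1, v2, v3} = UNIV"
  proof (rule ccontr)
    assume "span {v1, v2, v3} \<noteq> UNIV"
    then obtain v where v: "v \<notin> span {v1, v2, v3}" by blast
    then have "v \<noteq> v1" "v \<noteq> v2" "v \<noteq> v3" using span_base[of _ "{v1, v2, v3}"] by (metis insertCI)+
    then have "card (insert v {v1, v2, v3}) = 4" using ne by simp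
    moreover have "card (insert v {v1, v2, v3}) \<le> card S"
      using independent_span_bound[OF S(1) independent_insertI[OF v i1]] S(3) by simp
    ultimately have "4 \<le> card S" by simp
    with S(4) show False by simp
  qed
  have "frame v1 v2 v3"
  proof (rule frameI)
    fix v
    obtain a where "v - a *\<^sub>R v1 \<in> span {v2, v3}" using sp by (metis UNIV_I span_breakdown_eq)
    with mem2 obtain b c where "v - a *\<^sub>R v1 = b *\<^sub>R v2 + c *\<^sub>R v3" by blast
    then have "v = a *\<^sub>R v1 + b *\<^sub>R v2 + c *\<^sub>R v3" by (simp add: algebra_simps)
    then show "\<exists>x y z. v = x *\<^sub>R v1 + y *\<^sub>R v2 + z *\<^sub>R v3" by blast
  next
    fix x y z assume 0: "x *\<^sub>R v1 + y *\<^sub>R v2 + z *\<^sub>R v3 = 0"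
    define u where "u v = (if v = v1 then x else if v = v2 then y else z)" for v
    have "(\<Sum>v\<in>{v1, v2, v3}. u v *\<^sub>R v) = 0" using 0 ne by (simp add: u_def add.assoc)
    from independentD[OF i1 _ order_refl this] have "u v1 = 0" "u v2 = 0" "u v3 = 0" by auto
    then show "x = 0 \<and> y = 0 \<and> z = 0" using ne by (auto simp: u_def)
  qed
  then show ?thesis using that v3(2) mem1[OF v2(2)] mem2[OF v1(2)] by blast
qed

text \<open>The entry \<open>d\<close> may be nonzero for a flag adapted to nilpotency alone. It
  disappears in \<open>normal_formI\<close>, where \<open>v3\<close> is null and orthogonal to
  \<open>v2\<close>.\<close>

definition product_table ::
  "('g::real_vector \<Rightarrow> 'g \<Rightarrow> 'g) \<Rightarrow> 'g \<Rightarrow> 'g \<Rightarrow> 'g \<Rightarrow> real \<Rightarrow> real \<Rightarrow> real \<Rightarrow> real \<Rightarrow> real \<Rightarrow> bool" where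
  "product_table m v1 v2 v3 a c1 b c d \<longleftrightarrow>
     m v1 v1 = a *\<^sub>R v2 + c1 *\<^sub>R v3 \<and> m v1 v2 = b *\<^sub>R v3 \<and> m v2 v1 = c *\<^sub>R v3 \<and> m v2 v2 = d *\<^sub>R v3 \<and>
     m v1 v3 = 0 \<and> m v2 v3 = 0 \<and> m v3 v1 = 0 \<and> m v3 v2 = 0 \<and> m v3 v3 = 0"

text \<open>Left-symmetry on the vectors of a flag forces left multiplication by \<open>v3\<close>
  to vanish, unless \<open>m v3 v1\<close> leaves the line of \<open>v3\<close>. In that case the
  flag was badly chosen, and this product becomes its last vector.\<close>

lemma exists_product_table:
  assumes h: "hessian_structure br m (B :: 'g::real_vector \<Rightarrow> 'g \<Rightarrow> real)" and nil: "left_powers m n \<subseteq> {0}"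
    and S: "finite (S :: 'g set)" "independent S" "span S = UNIV" "card S = 3"
  obtains v1 v2 v3 a c1 b c d where "frame v1 v2 v3" "product_table m v1 v2 v3 a c1 b c d" "d * a = 0"
proof -
  have m: "bilinear m" and br: "\<And>x y. br x y = m x y - m y x"
    and rep: "\<And>x y z. m (br x y) z = m x (m y z) - m y (m x z)"
    by (rule hessian_structureD[OF h])+
  note bm = bilinear_simps[OF m]
  obtain v1 v2 v3 where fr: "frame v1 v2 v3" and v3: "\<And>x. m x v3 = 0" and v2: "\<And>x. \<exists>b. m x v2 = b *\<^sub>R v3"
    and v1: "\<And>x. \<exists>a c. m x v1 = a *\<^sub>R v2 + c *\<^sub>R v3"
    using exists_flag[OF nil S] by blast
  obtain b1 b2 b3 where b: "m v1 v2 = b1 *\<^sub>R v3" "m v2 v2 = b2 *\<^sub>R v3" "m v3 v2 = b3 *\<^sub>R v3"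
    using v2 by meson
  obtain a1 c1 a2 c2 a3 c3 where a: "m v1 v1 = a1 *\<^sub>R v2 + c1 *\<^sub>R v3" "m v2 v1 = a2 *\<^sub>R v2 + c2 *\<^sub>R v3"
    "m v3 v1 = a3 *\<^sub>R v2 + c3 *\<^sub>R v3" using v1 by meson
  note t = b a v3
  have z: "x = 0 \<and> y = 0" if "x *\<^sub>R v2 + y *\<^sub>R v3 = 0" for x y
    using frame_zero[OF fr, of 0 x y] that by simp
  have "(- (b3 * b3)) *\<^sub>R v3 = 0" using rep[of v2 v3 v2] by (simp add: br t bm)
  then have b3: "b3 = 0" using z[of 0 "- (b3 * b3)"] by simp
  have "(- (a3 * b2)) *\<^sub>R v3 = 0" using rep[of v1 v3 v2] by (simp add: br t bm b3)
  then have e1: "a3 * b2 = 0" using z[of 0 "- (a3 * b2)"] by simp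
  have "(- (a3 * a2 + c3 * a3)) *\<^sub>R v2 + (- (a3 * c2 + c3 * c3) - a3 * b1) *\<^sub>R v3 = 0"
    using rep[of v1 v3 v1] by (simp add: br t bm b3 algebra_simps)
  from z[OF this] have e2: "a3 * (a2 + c3) = 0" "a3 * c2 + c3 * c3 = - (a3 * b1)" by (auto simp: algebra_simps)
  have "(- (a2 * a2) + (b1 - c2) * a3) *\<^sub>R v2 + (- (a2 * c2) + (b1 - c2) * c3 - (a2 * b1 - a1 * b2)) *\<^sub>R v3 = 0"
    using rep[of v1 v2 v1] by (simp add: br t bm b3 algebra_simps)
  from z[OF this] have e3: "a2 * a2 = (b1 - c2) * a3" "- (a2 * c2) + (b1 - c2) * c3 = a2 * b1 - a1 * b2"
    by (auto simp: algebra_simps)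
  show ?thesis
  proof (cases "a3 = 0")
    case True
    then have "a2 = 0" "c3 = 0" using e2 e3 by auto
    with True e3 have "b2 * a1 = 0" by (simp add: mult.commute)
    moreover have "product_table m v1 v2 v3 a1 c1 b1 c2 b2"
      unfolding product_table_def using t True \<open>a2 = 0\<close> \<open>c3 = 0\<close> b3 by simp
    ultimately show ?thesis using that fr by blast
  next
    case False
    then have c3: "c3 = - a2" using e2(1) by (simp add: add_eq_0_iff)
    have "a3 * (2 * b1) = 0" using e2(2) e3(1) unfolding c3 by (simp add: algebra_simps)
    then have b1: "b1 = 0" using False by simp
    have b2: "b2 = 0" using False e1 by simp
    have c2: "a2 * a2 = - (c2 * a3)" using e3(1) b1 by simp
    \<comment> \<open>This is \<open>m v3 v1\<close>. In the new flag \<open>v3\<close> moves to the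
      second place and \<open>f\<close> to the third, so the entry \<open>c\<close> becomes
      1.\<close>
    define f where "f = a3 *\<^sub>R v2 + c3 *\<^sub>R v3"
    have v2: "v2 = (1 / a3) *\<^sub>R f + (- c3 / a3) *\<^sub>R v3" using False by (simp add: f_def algebra_simps)
    have "frame v1 v3 f"
    proof (rule frameI)
      fix x y z assume "x *\<^sub>R v1 + y *\<^sub>R v3 + z *\<^sub>R f = 0"
      then have "x *\<^sub>R v1 + (z * a3) *\<^sub>R v2 + (y + z * c3) *\<^sub>R v3 = 0" by (simp add: f_def algebra_simps)
      from frame_zero[OF fr this] show "x = 0 \<and> y = 0 \<and> z = 0" using False by auto
    next
      fix v obtain x y z where "v = x *\<^sub>R v1 + y *\<^sub>R v2 + z *\<^sub>R v3" using frame_span[OF fr] by blast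
      then have "v = x *\<^sub>R v1 + (z - y * c3 / a3) *\<^sub>R v3 + (y / a3) *\<^sub>R f"
        by (subst (asm) v2) (simp add: algebra_simps)
      then show "\<exists>x y z. v = x *\<^sub>R v1 + y *\<^sub>R v3 + z *\<^sub>R f" by blast
    qed
    moreover have "product_table m v1 v3 f (c1 - a1 * c3 / a3) (a1 / a3) 0 1 0"
    proof -
      have "m v1 v1 = (c1 - a1 * c3 / a3) *\<^sub>R v3 + (a1 / a3) *\<^sub>R f"
        unfolding a(1) by (subst v2) (simp add: algebra_simps)
      moreover have "m f v1 = 0"
      proof -
        have "m f v1 = (a3 * a2 + c3 * a3) *\<^sub>R v2 + (a3 * c2 + c3 * c3) *\<^sub>R v3"
          unfolding f_def by (simp add: t bm algebra_simps)
        moreover have "a3 * a2 + c3 * a3 = 0" using e2(1) by (simp add: algebra_simps)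
        ultimately show ?thesis using e2(2) b1 by simp
      qed
      ultimately show ?thesis
        unfolding product_table_def using t b1 b2 b3 by (simp add: f_def bm)
    qed
    ultimately show ?thesis using that[of v1 v3 f] by simp
  qed
qed

text \<open>Given the two zeros of the Gram matrix, nondegeneracy amounts to the two inequalities.
  The last equation is closedness on \<open>v1\<close>, \<open>v2\<close>, \<open>v1\<close>; it
  decides the vanishing of \<open>a\<close> in terms of \<open>b\<close> and
  \<open>c\<close>.\<close>

definition normal_form ::
  "('g::real_vector \<Rightarrow> 'g \<Rightarrow> 'g) \<Rightarrow> ('g \<Rightarrow> 'g \<Rightarrow> real) \<Rightarrow> 'g \<Rightarrow> 'g \<Rightarrow> 'g \<Rightarrow> real \<Rightarrow> real \<Rightarrow> real \<Rightarrow> real \<Rightarrow> bool" where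
  "normal_form m B v1 v2 v3 a k b c \<longleftrightarrow> frame v1 v2 v3 \<and> product_table m v1 v2 v3 a k b c 0 \<and>
     B v2 v3 = 0 \<and> B v3 v3 = 0 \<and> B v1 v3 \<noteq> 0 \<and> B v2 v2 \<noteq> 0 \<and> (2 * c - b) * B v1 v3 = a * B v2 v2"

lemma normal_formI:
  assumes h: "hessian_structure br m B" and fr: "frame v1 v2 v3"
    and tab: "product_table m v1 v2 v3 a k b c d" "d * a = 0" and B23: "B v2 v3 = 0" and B33: "B v3 v3 = 0"
  shows "normal_form m B v1 v2 v3 a k b c"
proof -
  have m: "bilinear m" and B: "bilinear B" and br: "\<And>x y. br x y = m x y - m y x" and sym: "\<And>x y. B x y = B y x"
    and nd: "\<forall>x. (\<forall>y. B x y = 0) \<longrightarrow> x = 0" and cl: "\<And>x y z. B (br x y) z = B x (m y z) - B y (m x z)"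
    by (rule hessian_structureD[OF h])+
  note bm = bilinear_simps[OF m] and bB = bilinear_simps[OF B]
  note s = sym[of v3 v1] sym[of v3 v2] sym[of v2 v1]
  have t: "m v1 v1 = a *\<^sub>R v2 + k *\<^sub>R v3" "m v1 v2 = b *\<^sub>R v3" "m v2 v1 = c *\<^sub>R v3" "m v2 v2 = d *\<^sub>R v3"
     "m v1 v3 = 0" "m v2 v3 = 0" "m v3 v1 = 0" "m v3 v2 = 0" "m v3 v3 = 0"
    using tab(1) by (auto simp: product_table_def)
  have orth: "v = 0" if "B v v1 = 0" "B v v2 = 0" "B v v3 = 0" for v
  proof (rule nd[rule_format])
    fix w obtain x y z where "w = x *\<^sub>R v1 + y *\<^sub>R v2 + z *\<^sub>R v3" using frame_span[OF fr] by blast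
    then show "B v w = 0" using that by (simp add: bB)
  qed
  have ne: "v2 \<noteq> 0" "v3 \<noteq> 0" "x *\<^sub>R v2 + y *\<^sub>R v3 = 0 \<Longrightarrow> x = 0" for x y
    using frame_zero[OF fr, of 0 1 0] frame_zero[OF fr, of 0 0 1] frame_zero[OF fr, of 0 x y] by auto
  have B13: "B v1 v3 \<noteq> 0" using orth[of v3] ne(2) B23 B33 by (auto simp: s)
  have B22: "B v2 v2 \<noteq> 0"
  proof
    assume 0: "B v2 v2 = 0"
    \<comment> \<open>The multiple of \<open>v3\<close> is chosen to remove the pairing with
      \<open>v1\<close>; if \<open>B v2 v2\<close> were zero, this vector would be orthogonal to the
      whole frame.\<close>
    have "v2 + (- (B v2 v1 / B v1 v3)) *\<^sub>R v3 = 0"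
      by (rule orth) (use 0 B13 B23 B33 in \<open>simp_all add: bB s\<close>)
    then have "(1 :: real) = 0" by (intro ne(3)[of 1 "- (B v2 v1 / B v1 v3)"]) (simp only: scaleR_one)
    then show False by simp
  qed
  have "d * B v1 v3 = 0"
    using cl[of v1 v2 v2] B23 by (simp add: br t bB s)
  then have "d = 0" using B13 by simp
  moreover have "(2 * c - b) * B v1 v3 = a * B v2 v2"
    using cl[of v1 v2 v1] B23 by (simp add: br t bB s algebra_simps)
  ultimately show ?thesis
    unfolding normal_form_def using fr tab(1) B23 B33 B13 B22 by simp
qed

text \<open>What has to be arranged is that \<open>v3\<close> is null and orthogonal to
  \<open>v2\<close>. If \<open>b\<close>, \<open>c\<close>, \<open>d\<close> are not all zero,
  closedness makes \<open>v3\<close> null. Otherwise the only product is \<open>n = m v1 v1\<close>,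
  which is orthogonal to \<open>v2\<close> and \<open>v3\<close> and, when nonzero, serves as the
  last vector itself.\<close>

lemma exists_normal_form:
  assumes h: "hessian_structure br m B" and fr: "frame v1 v2 v3"
    and tab: "product_table m v1 v2 v3 a k b c d" "d * a = 0"
  obtains "\<And>x y. m x y = 0" | v1 v2 v3 a k b c where "normal_form m B v1 v2 v3 a k b c"
proof -
  have m: "bilinear m" and B: "bilinear B" and br: "\<And>x y. br x y = m x y - m y x" and sym: "\<And>x y. B x y = B y x"
    and nd: "\<forall>x. (\<forall>y. B x y = 0) \<longrightarrow> x = 0" and cl: "\<And>x y z. B (br x y) z = B x (m y z) - B y (m x z)"
    by (rule hessian_structureD[OF h])+
  note bm = bilinear_simps[OF m] and bB = bilinear_simps[OF B]
  note s = sym[of v3 v1] sym[of v3 v2] sym[of v2 v1]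
  have t: "m v1 v1 = a *\<^sub>R v2 + k *\<^sub>R v3" "m v1 v2 = b *\<^sub>R v3" "m v2 v1 = c *\<^sub>R v3" "m v2 v2 = d *\<^sub>R v3"
     "m v1 v3 = 0" "m v2 v3 = 0" "m v3 v1 = 0" "m v3 v2 = 0" "m v3 v3 = 0"
    using tab(1) by (auto simp: product_table_def)
  have g1: "a * B v2 v3 + k * B v3 v3 = 0" using cl[of v1 v3 v1] by (simp add: br t bB s)
  have g2: "b * B v3 v3 = 0" using cl[of v1 v3 v2] by (simp add: br t bB)
  have g3: "c * B v3 v3 = 0" using cl[of v2 v3 v1] by (simp add: br t bB)
  have g4: "d * B v3 v3 = 0" using cl[of v2 v3 v2] by (simp add: br t bB)
  show ?thesis
  proof (cases "b = 0 \<and> c = 0 \<and> d = 0")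
    case bcd: True
    define n where "n = a *\<^sub>R v2 + k *\<^sub>R v3"
    have t': "m v1 v1 = n" "m v1 v2 = 0" "m v2 v1 = 0" "m v2 v2 = 0" using t bcd by (simp_all add: n_def)
    have n2: "B n v2 = 0" using cl[of v1 v2 v1] t bcd by (simp add: br bB n_def s algebra_simps)
    have n3: "B n v3 = 0" using g1 by (simp add: n_def bB)
    show ?thesis
    proof (cases "a = 0 \<and> k = 0")
      case True
      then have n: "n = 0" by (simp add: n_def)
      have "m x y = 0" for x y
      proof -
        obtain x1 x2 x3 y1 y2 y3 where "x = x1 *\<^sub>R v1 + x2 *\<^sub>R v2 + x3 *\<^sub>R v3" "y = y1 *\<^sub>R v1 + y2 *\<^sub>R v2 + y3 *\<^sub>R v3"
          using frame_span[OF fr] by meson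
        then show ?thesis using True bcd by (simp add: bm t)
      qed
      then show ?thesis by (rule that(1))
    next
      case False
      \<comment> \<open>Completes \<open>n\<close> to a basis of the span of \<open>v2\<close> and
        \<open>v3\<close>: the vector \<open>n\<close> lies on the line of \<open>v3\<close> exactly
        when \<open>a = 0\<close>.\<close>
      define p where "p = (if a = 0 then v2 else v3)"
      have "frame v1 p n"
      proof (cases "a = 0")
        case True
        with False have k: "k \<noteq> 0" by simp
        show ?thesis
        proof (rule frameI)
          fix x y z assume "x *\<^sub>R v1 + y *\<^sub>R p + z *\<^sub>R n = 0"
          then have "x *\<^sub>R v1 + y *\<^sub>R v2 + (z * k) *\<^sub>R v3 = 0" using True by (simp add: p_def n_def)
          from frame_zero[OF fr this] show "x = 0 \<and> y = 0 \<and> z = 0" using k by auto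
        next
          fix v obtain x y z where "v = x *\<^sub>R v1 + y *\<^sub>R v2 + z *\<^sub>R v3" using frame_span[OF fr] by blast
          then have "v = x *\<^sub>R v1 + y *\<^sub>R p + (z / k) *\<^sub>R n" using True k by (simp add: p_def n_def)
          then show "\<exists>x y z. v = x *\<^sub>R v1 + y *\<^sub>R p + z *\<^sub>R n" by blast
        qed
      next
        case a: False
        show ?thesis
        proof (rule frameI)
          fix x y z assume "x *\<^sub>R v1 + y *\<^sub>R p + z *\<^sub>R n = 0"
          then have "x *\<^sub>R v1 + (z * a) *\<^sub>R v2 + (y + z * k) *\<^sub>R v3 = 0" using a by (simp add: p_def n_def algebra_simps)
          from frame_zero[OF fr this] show "x = 0 \<and> y = 0 \<and> z = 0" using a by auto
        next
          fix v obtain x y z where "v = x *\<^sub>R v1 + y *\<^sub>R v2 + z *\<^sub>R v3" using frame_span[OF fr] by blast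
          then have "v = x *\<^sub>R v1 + (z - y * k / a) *\<^sub>R p + (y / a) *\<^sub>R n" using a by (simp add: p_def n_def algebra_simps)
          then show "\<exists>x y z. v = x *\<^sub>R v1 + y *\<^sub>R p + z *\<^sub>R n" by blast
        qed
      qed
      moreover have "product_table m v1 p n 0 1 0 0 0"
        using t t' by (auto simp: product_table_def p_def bm n_def)
      moreover have "B n n = 0"
      proof -
        have "B n n = a * B n v2 + k * B n v3" by (subst (2) n_def) (simp add: bB)
        then show ?thesis by (simp add: n2 n3)
      qed
      moreover have "B p n = 0" using n2 n3 by (simp add: p_def sym[of v2 n] sym[of v3 n])
      ultimately have "normal_form m B v1 p n 0 1 0 0" by (intro normal_formI[OF h]) auto
      then show ?thesis by (rule that(2))
    qed
  next
    case False
    then have B33: "B v3 v3 = 0" using g2 g3 g4 by auto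
    with g1 have a23: "a * B v2 v3 = 0" by simp
    show ?thesis
    proof (cases "B v2 v3 = 0")
      case True
      show ?thesis by (rule that(2)[OF normal_formI[OF h fr tab True B33]])
    next
      case ne: False
      with a23 have a: "a = 0" by simp
      \<comment> \<open>This coefficient makes \<open>p\<close> orthogonal to \<open>v3\<close>.
        With \<open>a = 0\<close> all products lie on the line of \<open>v3\<close>, so
        \<open>v1\<close> and \<open>v2\<close> may exchange their places.\<close>
      define r where "r = B v1 v3 / B v2 v3"
      define p where "p = v1 + (- r) *\<^sub>R v2"
      have "frame v2 p v3"
      proof (rule frameI)
        fix x y z assume "x *\<^sub>R v2 + y *\<^sub>R p + z *\<^sub>R v3 = 0"
        then have "y *\<^sub>R v1 + (x - y * r) *\<^sub>R v2 + z *\<^sub>R v3 = 0" by (simp add: p_def algebra_simps)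
        from frame_zero[OF fr this] show "x = 0 \<and> y = 0 \<and> z = 0" by auto
      next
        fix v obtain x y z where "v = x *\<^sub>R v1 + y *\<^sub>R v2 + z *\<^sub>R v3" using frame_span[OF fr] by blast
        then have "v = (y + x * r) *\<^sub>R v2 + x *\<^sub>R p + z *\<^sub>R v3" by (simp add: p_def algebra_simps)
        then show "\<exists>x y z. v = x *\<^sub>R v2 + y *\<^sub>R p + z *\<^sub>R v3" by blast
      qed
      moreover have "product_table m v2 p v3 0 d (c - r * d) (b - r * d) (k - r * b - r * c + r * r * d)"
        unfolding product_table_def p_def using a by (simp add: t bm algebra_simps)
      moreover have "B p v3 = 0" using ne by (simp add: p_def bB r_def)
      ultimately have "normal_form m B v2 p v3 0 d (c - r * d) (b - r * d)"
        by (intro normal_formI[OF h]) (auto simp: B33)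
      then show ?thesis by (rule that(2))
    qed
  qed
qed

text \<open>The table is read off by pairing \<open>dual\<close> with the frame. The equation for
  \<open>\<alpha>\<close> is the last clause of \<open>normal_form\<close> for the dual table, as 2
  (- c) - (b - 2 c) = - b; the equation for \<open>\<kappa>\<close> compares the pairings of the two
  squares of \<open>v1\<close> with \<open>v1\<close>.\<close>

lemma normal_form_dual:
  assumes nf: "normal_form m B v1 v2 v3 a k b c" and h: "hessian_structure br m B"
    and h': "hessian_structure br m' B" and dual: "dual_product m m' B"
  obtains \<alpha> \<kappa> where "product_table m' v1 v2 v3 \<alpha> \<kappa> (b - 2 * c) (- c) 0" "\<alpha> * B v2 v2 = - b * B v1 v3"
    "\<alpha> * B v1 v2 + \<kappa> * B v1 v3 = - (a * B v1 v2 + k * B v1 v3)"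
proof -
  have B: "bilinear B" and sym: "\<And>x y. B x y = B y x"
    and nd: "\<forall>x. (\<forall>y. B x y = 0) \<longrightarrow> x = 0"
    by (rule hessian_structureD[OF h])+
  note bB = bilinear_simps[OF B]
  have fr: "frame v1 v2 v3" and t: "m v1 v1 = a *\<^sub>R v2 + k *\<^sub>R v3" "m v1 v2 = b *\<^sub>R v3" "m v2 v1 = c *\<^sub>R v3" "m v2 v2 = 0"
     "m v1 v3 = 0" "m v2 v3 = 0" "m v3 v1 = 0" "m v3 v2 = 0" "m v3 v3 = 0"
    and g: "B v2 v3 = 0" "B v3 v3 = 0" "B v1 v3 \<noteq> 0" "B v2 v2 \<noteq> 0" and e: "(2 * c - b) * B v1 v3 = a * B v2 v2"
    using nf by (auto simp: normal_form_def product_table_def)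
  have g': "B v3 v2 = 0" "B v3 v1 = B v1 v3" "B v2 v1 = B v1 v2" using g(1) sym by metis+
  have d: "B (m' x y) z = - B y (m x z)" for x y z using dual by (simp add: dual_product_def)
  have eqI: "v = w" if "B v v1 = B w v1" "B v v2 = B w v2" "B v v3 = B w v3" for v w
  proof (rule nondegenerate_eqI[OF B nd])
    fix u obtain x y z where "u = x *\<^sub>R v1 + y *\<^sub>R v2 + z *\<^sub>R v3" using frame_span[OF fr] by blast
    then show "B v u = B w u" using that by (simp add: bB)
  qed
  define \<alpha> where "\<alpha> = - b * B v1 v3 / B v2 v2"
  define \<kappa> where "\<kappa> = - (a * B v1 v2 + k * B v1 v3 + \<alpha> * B v1 v2) / B v1 v3"
  have 1: "\<alpha> * B v2 v2 = - b * B v1 v3" using g by (simp add: \<alpha>_def)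
  have 2: "\<alpha> * B v1 v2 + \<kappa> * B v1 v3 = - (a * B v1 v2 + k * B v1 v3)" using g by (simp add: \<kappa>_def)
  have "product_table m' v1 v2 v3 \<alpha> \<kappa> (b - 2 * c) (- c) 0"
    unfolding product_table_def
    by (intro conjI; rule eqI; simp add: d t bB g g') (use 1 2 e in \<open>simp_all add: algebra_simps\<close>)
  then show ?thesis using that 1 2 by blast
qed

section \<open>The nilpotent Lie algebras in dimension six\<close>

lemma exhaust_6:
  fixes x :: 6
  shows "x = 1 \<or> x = 2 \<or> x = 3 \<or> x = 4 \<or> x = 5 \<or> x = 6"
proof (induct x)
  case (of_int z)
  then have "z = 0 \<or> z = 1 \<or> z = 2 \<or> z = 3 \<or> z = 4 \<or> z = 5" by fastforce
  then show ?case by auto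
qed

lemma forall_6: "(\<forall>i::6. P i) \<longleftrightarrow> P 1 \<and> P 2 \<and> P 3 \<and> P 4 \<and> P 5 \<and> P 6"
  by (metis exhaust_6)

lemma from_equations_nth:
  "from_equations [d1, d2, d3, d4, d5, d6] X Y $ 1 = - d1 X Y"
  "from_equations [d1, d2, d3, d4, d5, d6] X Y $ 2 = - d2 X Y"
  "from_equations [d1, d2, d3, d4, d5, d6] X Y $ 3 = - d3 X Y"
  "from_equations [d1, d2, d3, d4, d5, d6] X Y $ 4 = - d4 X Y"
  "from_equations [d1, d2, d3, d4, d5, d6] X Y $ 5 = - d5 X Y"
  "from_equations [d1, d2, d3, d4, d5, d6] X Y $ 6 = - d6 X Y"
proof -
  have "{1..6} = {1, 2, 3, 4, 5, 6 :: nat}" by auto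
  then have "from_equations [d1, d2, d3, d4, d5, d6] X Y =
    (- d1 X Y *\<^sub>R axis 1 1) + ((- d2 X Y *\<^sub>R axis 2 1) + ((- d3 X Y *\<^sub>R axis 3 1) +
     ((- d4 X Y *\<^sub>R axis 4 1) + ((- d5 X Y *\<^sub>R axis 5 1) + (- d6 X Y *\<^sub>R axis 6 1)))))"
    by (simp add: from_equations_def)
  then show "from_equations [d1, d2, d3, d4, d5, d6] X Y $ 1 = - d1 X Y"
    "from_equations [d1, d2, d3, d4, d5, d6] X Y $ 2 = - d2 X Y"
    "from_equations [d1, d2, d3, d4, d5, d6] X Y $ 3 = - d3 X Y"
    "from_equations [d1, d2, d3, d4, d5, d6] X Y $ 4 = - d4 X Y"
    "from_equations [d1, d2, d3, d4, d5, d6] X Y $ 5 = - d5 X Y"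
    "from_equations [d1, d2, d3, d4, d5, d6] X Y $ 6 = - d6 X Y"
    by (simp_all add: axis_def)
qed

definition vec6 :: "real \<Rightarrow> real \<Rightarrow> real \<Rightarrow> real \<Rightarrow> real \<Rightarrow> real \<Rightarrow> real^6" where
  "vec6 a1 a2 a3 a4 a5 a6 = (\<chi> i. if i = 1 then a1 else if i = 2 then a2 else if i = 3 then a3
     else if i = 4 then a4 else if i = 5 then a5 else a6)"

lemma vec6_nth [simp]:
  "vec6 a1 a2 a3 a4 a5 a6 $ 1 = a1" "vec6 a1 a2 a3 a4 a5 a6 $ 2 = a2" "vec6 a1 a2 a3 a4 a5 a6 $ 3 = a3"
  "vec6 a1 a2 a3 a4 a5 a6 $ 4 = a4" "vec6 a1 a2 a3 a4 a5 a6 $ 5 = a5" "vec6 a1 a2 a3 a4 a5 a6 $ 6 = a6"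
  by (simp_all add: vec6_def)

lemma vec6_eq_iff:
  "x = y \<longleftrightarrow> x $ 1 = y $ 1 \<and> x $ 2 = y $ 2 \<and> x $ 3 = y $ 3 \<and> x $ 4 = y $ 4 \<and> x $ 5 = y $ 5 \<and> x $ 6 = y $ 6"
  for x y :: "'a^6"
  by (simp add: vec_eq_iff forall_6)

lemmas nilpotent_defs = \<hh>\<^sub>1_def \<hh>\<^sub>4_def \<hh>\<^sub>7_def \<hh>\<^sub>8_def \<hh>\<^sub>9_def \<hh>\<^sub>1\<^sub>0_def \<hh>\<^sub>1\<^sub>1_def

section \<open>Normal forms in coordinates and their Lie algebras\<close>

type_synonym vec3 = "real \<times> real \<times> real"

text \<open>The table of \<open>normal_form\<close> on concrete triples, where an isomorphism with a
  list of structure equations becomes an identity in coordinates.\<close>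

fun std_product :: "real \<Rightarrow> real \<Rightarrow> real \<Rightarrow> real \<Rightarrow> vec3 \<Rightarrow> vec3 \<Rightarrow> vec3" where
  "std_product a k b c (x1, x2, x3) (y1, y2, y3) = (0, a * x1 * y1, k * x1 * y1 + b * x1 * y2 + c * x2 * y1)"

definition std_bracket :: "real \<Rightarrow> real \<Rightarrow> real \<Rightarrow> real \<Rightarrow> vec3 \<times> vec3 \<Rightarrow> vec3 \<times> vec3 \<Rightarrow> vec3 \<times> vec3" where
  "std_bracket a k b c =
     semidirect (\<lambda>x y. std_product a k b c x y - std_product a k b c y x) (std_product a k b c)"

lemma std_bracket_simp [simp]:
  "std_bracket a k b c ((x1, x2, x3), (u1, u2, u3)) ((y1, y2, y3), (v1, v2, v3)) =
     ((0, 0, (b - c) * (x1 * y2 - x2 * y1)),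
      (0, a * (x1 * v1 - u1 * y1), k * (x1 * v1 - u1 * y1) + b * (x1 * v2 - u2 * y1) + c * (x2 * v1 - u1 * y2)))"
  by (simp add: std_bracket_def algebra_simps)

lemma lie_isomorphicI:
  assumes "linear f" "\<And>x. g (f x) = x" "\<And>y. f (g y) = y" "\<And>x y. f (br x y) = br' (f x) (f y)"
  shows "lie_isomorphic br br'"
proof -
  have "bij f" by (rule o_bij[of g]) (auto simp: assms)
  with assms show ?thesis unfolding lie_isomorphic_def lie_isomorphism_def by blast
qed

lemma std_isomorphic_h1: "lie_isomorphic (std_bracket 0 0 0 0) \<hh>\<^sub>1"
  by (rule lie_isomorphicI[where f = "\<lambda>((x1, x2, x3), (u1, u2, u3)). vec6 x1 x2 x3 u1 u2 u3"
      and g = "\<lambda>X. ((X $ 1, X $ 2, X $ 3), (X $ 4, X $ 5, X $ 6))"])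
    (auto intro!: linearI simp: vec6_eq_iff nilpotent_defs from_equations_nth e2_def algebra_simps)

lemma std_isomorphic_h8:
  assumes "k \<noteq> 0"
  shows "lie_isomorphic (std_bracket 0 k 0 0) \<hh>\<^sub>8"
  by (rule lie_isomorphicI[where f = "\<lambda>((x1, x2, x3), (u1, u2, u3)). vec6 x2 x1 u1 x3 u2 (u3 / k)"
      and g = "\<lambda>X. ((X $ 2, X $ 1, X $ 4), (X $ 3, X $ 5, k * X $ 6))"])
    (use assms in \<open>auto intro!: linearI simp: vec6_eq_iff nilpotent_defs from_equations_nth e2_def field_simps\<close>)

text \<open>With e_i and f_i the bases of the two summands, \<open>k\<close> is absorbed by
  replacing f_1 with f_1 - k / (2 c) f_2, whose bracket with e_1 vanishes.\<close>

lemma std_isomorphic_h4: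
  assumes "c \<noteq> 0"
  shows "lie_isomorphic (std_bracket 0 k (2 * c) c) \<hh>\<^sub>4"
  by (rule lie_isomorphicI[where
        f = "\<lambda>((x1, x2, x3), (u1, u2, u3)). vec6 x1 (u1 / 2) x2 (u2 + k / (2 * c) * u1) (- x3 / c) (- u3 / (2 * c))"
      and g = "\<lambda>X. ((X $ 1, X $ 3, - c * X $ 5), (2 * X $ 2, X $ 4 - k / c * X $ 2, - 2 * c * X $ 6))"])
    (use assms in \<open>auto intro!: linearI simp: vec6_eq_iff nilpotent_defs from_equations_nth e2_def field_simps\<close>)

text \<open>Here and in the following isomorphisms \<open>a\<close> is nonzero, and \<open>k\<close>
  is absorbed by taking f_2 + (k / a) f_3 as the new f_2.\<close>

lemma std_isomorphic_h7:
  assumes "a \<noteq> 0" "c \<noteq> 0"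
  shows "lie_isomorphic (std_bracket a k 0 c) \<hh>\<^sub>7"
  by (rule lie_isomorphicI[where
        f = "\<lambda>((x1, x2, x3), (u1, u2, u3)). vec6 x1 x2 u1 (x3 / c) (- u2 / a) ((u3 - k / a * u2) / c)"
      and g = "\<lambda>X. ((X $ 1, X $ 2, c * X $ 4), (X $ 3, - a * X $ 5, c * X $ 6 - k * X $ 5))"])
    (use assms in \<open>auto intro!: linearI simp: vec6_eq_iff nilpotent_defs from_equations_nth e2_def field_simps\<close>)

lemma std_isomorphic_h9:
  assumes "a \<noteq> 0" "b \<noteq> 0"
  shows "lie_isomorphic (std_bracket a k b b) \<hh>\<^sub>9"
  by (rule lie_isomorphicI[where
        f = "\<lambda>((x1, x2, x3), (u1, u2, u3)). vec6 x1 u1 (- x2 / a) (- u2 / a) x3 ((u3 - k / a * u2) / (a * b))"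
      and g = "\<lambda>X. ((X $ 1, - a * X $ 3, X $ 5), (X $ 2, - a * X $ 4, a * b * X $ 6 - k * X $ 4))"])
    (use assms in \<open>auto intro!: linearI simp: vec6_eq_iff nilpotent_defs from_equations_nth e2_def field_simps\<close>)

lemma std_isomorphic_h10:
  assumes "a \<noteq> 0" "b \<noteq> 0"
  shows "lie_isomorphic (std_bracket a k b 0) \<hh>\<^sub>1\<^sub>0"
  by (rule lie_isomorphicI[where
        f = "\<lambda>((x1, x2, x3), (u1, u2, u3)). vec6 x1 u1 x2 (- u2 / a) (- x3 / b) ((u3 - k / a * u2) / (a * b))"
      and g = "\<lambda>X. ((X $ 1, X $ 3, - b * X $ 5), (X $ 2, - a * X $ 4, a * b * X $ 6 - k * X $ 4))"])
    (use assms in \<open>auto intro!: linearI simp: vec6_eq_iff nilpotent_defs from_equations_nth e2_def field_simps\<close>)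

text \<open>The factor c / b in the third coordinate gives the two terms of
  \<open>e2 1 4 - e2 2 3\<close> the same weight; the fifth coordinate is then fixed by [e_1, e_2] =
  (b - c) e_3.\<close>

lemma std_isomorphic_h11:
  assumes "a \<noteq> 0" "b \<noteq> 0" "c \<noteq> 0" "b \<noteq> c"
  shows "lie_isomorphic (std_bracket a k b c) \<hh>\<^sub>1\<^sub>1"
proof -
  \<comment> \<open>Naming the difference keeps it a single nonzero denominator.\<close>
  define e where "e = b - c"
  have e: "e \<noteq> 0" "b - c = e" using assms by (auto simp: e_def)
  show ?thesis
    by (rule lie_isomorphicI[where
        f = "\<lambda>((x1, x2, x3), (u1, u2, u3)). vec6 x1 u1 (- c * x2 / (a * b)) (- u2 / a)
          (c * x3 / (a * b * e)) ((u3 - k / a * u2) / (a * b))"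
      and g = "\<lambda>X. ((X $ 1, - (a * b) * X $ 3 / c, a * b * e * X $ 5 / c), (X $ 2, - a * X $ 4, a * b * X $ 6 - k * X $ 4))"])
    (use assms(1-3) e(1) in \<open>auto intro!: linearI simp: e(2) vec6_eq_iff nilpotent_defs from_equations_nth e2_def field_simps\<close>)
qed

section \<open>Invariants that separate the seven algebras\<close>

definition derived_bound :: "nat \<Rightarrow> ('a::real_vector \<Rightarrow> 'a \<Rightarrow> 'a) \<Rightarrow> bool" where
  "derived_bound n br \<longleftrightarrow> (\<exists>S. finite S \<and> card S \<le> n \<and> (\<forall>x y. br x y \<in> span S))"

definition two_step :: "('a::real_vector \<Rightarrow> 'a \<Rightarrow> 'a) \<Rightarrow> bool" where
  "two_step br \<longleftrightarrow> (\<forall>x y z. br x (br y z) = 0)"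

definition centralizer_abelian :: "('a::real_vector \<Rightarrow> 'a \<Rightarrow> 'a) \<Rightarrow> bool" where
  "centralizer_abelian br \<longleftrightarrow> (\<forall>x y. (\<forall>u v. br x (br u v) = 0) \<longrightarrow> (\<forall>u v. br y (br u v) = 0) \<longrightarrow> br x y = 0)"

text \<open>The derived algebra has dimension 0 for \<open>\<hh>\<^sub>1\<close>, 1 for
  \<open>\<hh>\<^sub>8\<close>, 2 for \<open>\<hh>\<^sub>4\<close> and \<open>\<hh>\<^sub>9\<close>,
  and 3 for the others. Being two-step separates \<open>\<hh>\<^sub>4\<close> from
  \<open>\<hh>\<^sub>9\<close> and \<open>\<hh>\<^sub>7\<close> from
  \<open>\<hh>\<^sub>1\<^sub>0\<close> and \<open>\<hh>\<^sub>1\<^sub>1\<close>; the centralizer of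
  the derived algebra is abelian for \<open>\<hh>\<^sub>1\<^sub>0\<close> and not for
  \<open>\<hh>\<^sub>1\<^sub>1\<close>.\<close>

definition signature where
  "signature br = (derived_bound 0 br, derived_bound 1 br, derived_bound 2 br, two_step br, centralizer_abelian br)"

lemma signature_imp:
  assumes "lie_isomorphism br br' f"
  shows "derived_bound n br \<Longrightarrow> derived_bound n br'" "two_step br \<Longrightarrow> two_step br'"
    "centralizer_abelian br \<Longrightarrow> centralizer_abelian br'"
proof -
  have f: "linear f" "bij f" "\<And>x y. f (br x y) = br' (f x) (f y)" using assms by (auto simp: lie_isomorphism_def)
  note g = lie_isomorphism_inv[OF assms]
  have b: "br' x y = f (br (inv f x) (inv f y))" for x y by (simp add: f(3) g)
  have z: "f x = 0 \<longleftrightarrow> x = 0" for x using f(1,2) by (metis g(2) linear_0)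
  have all: "(\<forall>x. P (inv f x)) \<longleftrightarrow> (\<forall>x. P x)" for P using g(2) by metis
  show "derived_bound n br'" if D: "derived_bound n br"
  proof -
    obtain S where S: "finite S" "card S \<le> n" "\<And>x y. br x y \<in> span S" using D by (auto simp: derived_bound_def)
    have "br' x y \<in> span (f ` S)" for x y
      unfolding b linear_span_image[OF f(1)] using S(3) by blast
    moreover have "card (f ` S) \<le> n" using S(1,2) card_image_le le_trans by blast
    ultimately show ?thesis unfolding derived_bound_def using S(1) by blast
  qed
  show "two_step br \<Longrightarrow> two_step br'"
    by (simp add: two_step_def b g(2) z)
  show "centralizer_abelian br'" if "centralizer_abelian br"
  proof (unfold centralizer_abelian_def, intro allI impI)
    fix x y assume "\<forall>u v. br' x (br' u v) = 0" "\<forall>u v. br' y (br' u v) = 0"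
    then have "br' x (br' (f u) (f v)) = 0" "br' y (br' (f u) (f v)) = 0" for u v by auto
    then have "br (inv f x) (br u v) = 0" "br (inv f y) (br u v) = 0" for u v
      by (simp_all add: b g(2) z)
    then have "br (inv f x) (inv f y) = 0" using that unfolding centralizer_abelian_def by blast
    then show "br' x y = 0" by (simp only: b z)
  qed
qed

lemma signature_eq:
  assumes "lie_isomorphic br br'"
  shows "signature br = signature br'"
proof -
  obtain f where f: "lie_isomorphism br br' f" using assms by (auto simp: lie_isomorphic_def)
  show ?thesis
    unfolding signature_def using signature_imp[OF f] signature_imp[OF lie_isomorphism_inv(1)[OF f]] by blast
qed

lemma derived_bound_mono: "derived_bound n br \<Longrightarrow> n \<le> n' \<Longrightarrow> derived_bound n' br"
  unfolding derived_bound_def using le_trans by blast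

lemma not_derived_bound:
  fixes br :: "real^6 \<Rightarrow> real^6 \<Rightarrow> real^6"
  assumes "\<And>i. i \<in> I \<Longrightarrow> \<exists>x y. br x y = axis i 1" "n < card I"
  shows "\<not> derived_bound n br"
proof
  assume "derived_bound n br"
  then obtain S where S: "finite S" "card S \<le> n" "\<And>x y. br x y \<in> span S" by (auto simp: derived_bound_def)
  let ?T = "(\<lambda>i. axis i 1) ` I :: (real^6) set"
  have "independent ?T" by (rule independent_mono[OF independent_Basis]) (auto simp: Basis_vec_def)
  moreover have "?T \<subseteq> span S" using assms(1) S(3) by (metis image_subsetI)
  ultimately have "card ?T \<le> card S" using independent_span_bound[OF S(1)] by blast
  moreover have "card ?T = card I" by (rule card_image) (simp add: inj_on_def axis_eq_axis)
  ultimately show False using S(2) assms(2) by simp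
qed

lemma bracket_nth:
  "\<hh>\<^sub>1 X Y = 0"
  "\<hh>\<^sub>8 X Y = (X $ 2 * Y $ 3 - X $ 3 * Y $ 2) *\<^sub>R axis 6 1"
  "\<hh>\<^sub>4 X Y = (X $ 3 * Y $ 1 - X $ 1 * Y $ 3) *\<^sub>R axis 5 1 +
     (X $ 4 * Y $ 1 - X $ 1 * Y $ 4 + X $ 2 * Y $ 3 - X $ 3 * Y $ 2) *\<^sub>R axis 6 1"
  "\<hh>\<^sub>9 X Y = (X $ 2 * Y $ 1 - X $ 1 * Y $ 2) *\<^sub>R axis 4 1 +
     (X $ 4 * Y $ 1 - X $ 1 * Y $ 4 + X $ 2 * Y $ 3 - X $ 3 * Y $ 2) *\<^sub>R axis 6 1"
  "\<hh>\<^sub>7 X Y = (X $ 2 * Y $ 1 - X $ 1 * Y $ 2) *\<^sub>R axis 4 1 + (X $ 3 * Y $ 1 - X $ 1 * Y $ 3) *\<^sub>R axis 5 1 +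
     (X $ 2 * Y $ 3 - X $ 3 * Y $ 2) *\<^sub>R axis 6 1"
  "\<hh>\<^sub>1\<^sub>0 X Y = (X $ 2 * Y $ 1 - X $ 1 * Y $ 2) *\<^sub>R axis 4 1 + (X $ 3 * Y $ 1 - X $ 1 * Y $ 3) *\<^sub>R axis 5 1 +
     (X $ 4 * Y $ 1 - X $ 1 * Y $ 4) *\<^sub>R axis 6 1"
  "\<hh>\<^sub>1\<^sub>1 X Y = (X $ 2 * Y $ 1 - X $ 1 * Y $ 2) *\<^sub>R axis 4 1 + (X $ 3 * Y $ 1 - X $ 1 * Y $ 3) *\<^sub>R axis 5 1 +
     (X $ 4 * Y $ 1 - X $ 1 * Y $ 4 + X $ 2 * Y $ 3 - X $ 3 * Y $ 2) *\<^sub>R axis 6 1"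
  by (simp_all add: vec6_eq_iff nilpotent_defs from_equations_nth e2_def axis_def)

lemma axis_nth_6 [simp]: "axis i (1 :: real) $ j = (if i = j then 1 else 0)" for i j :: 6
  by (simp add: axis_def)

lemma derived_bounds:
  "derived_bound 0 \<hh>\<^sub>1" "derived_bound 1 \<hh>\<^sub>8" "derived_bound 2 \<hh>\<^sub>4" "derived_bound 2 \<hh>\<^sub>9"
proof -
  show "derived_bound 0 \<hh>\<^sub>1" by (auto simp: derived_bound_def bracket_nth)
  show "derived_bound 1 \<hh>\<^sub>8"
    unfolding derived_bound_def by (rule exI[of _ "{axis 6 1}"]) (auto simp: bracket_nth intro!: span_scale[OF span_base])
  show "derived_bound 2 \<hh>\<^sub>4"
    unfolding derived_bound_def
    by (rule exI[of _ "{axis 5 1, axis 6 1}"])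
      (auto simp: bracket_nth card_insert_if intro!: span_add span_scale[OF span_base])
  show "derived_bound 2 \<hh>\<^sub>9"
    unfolding derived_bound_def
    by (rule exI[of _ "{axis 4 1, axis 6 1}"])
      (auto simp: bracket_nth card_insert_if intro!: span_add span_scale[OF span_base])
qed

lemma not_derived_bounds:
  "\<not> derived_bound 0 \<hh>\<^sub>8" "\<not> derived_bound 1 \<hh>\<^sub>4" "\<not> derived_bound 1 \<hh>\<^sub>9"
  "\<not> derived_bound 2 \<hh>\<^sub>7" "\<not> derived_bound 2 \<hh>\<^sub>1\<^sub>0" "\<not> derived_bound 2 \<hh>\<^sub>1\<^sub>1"
proof -
  have 8: "\<hh>\<^sub>8 (axis 2 1) (axis 3 1) = axis 6 1" by (simp add: bracket_nth)
  show "\<not> derived_bound 0 \<hh>\<^sub>8" by (rule not_derived_bound[of "{6}"]) (use 8 in auto)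
  have 4: "\<hh>\<^sub>4 (axis 3 1) (axis 1 1) = axis 5 1" "\<hh>\<^sub>4 (axis 4 1) (axis 1 1) = axis 6 1" by (simp_all add: bracket_nth)
  show "\<not> derived_bound 1 \<hh>\<^sub>4" by (rule not_derived_bound[of "{5, 6}"]) (use 4 in auto)
  have 9: "\<hh>\<^sub>9 (axis 2 1) (axis 1 1) = axis 4 1" "\<hh>\<^sub>9 (axis 4 1) (axis 1 1) = axis 6 1" by (simp_all add: bracket_nth)
  show "\<not> derived_bound 1 \<hh>\<^sub>9" by (rule not_derived_bound[of "{4, 6}"]) (use 9 in auto)
  have 7: "\<hh>\<^sub>7 (axis 2 1) (axis 1 1) = axis 4 1" "\<hh>\<^sub>7 (axis 3 1) (axis 1 1) = axis 5 1"
    "\<hh>\<^sub>7 (axis 2 1) (axis 3 1) = axis 6 1" by (simp_all add: bracket_nth)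
  show "\<not> derived_bound 2 \<hh>\<^sub>7" by (rule not_derived_bound[of "{4, 5, 6}"]) (use 7 in auto)
  have 10: "\<hh>\<^sub>1\<^sub>0 (axis 2 1) (axis 1 1) = axis 4 1" "\<hh>\<^sub>1\<^sub>0 (axis 3 1) (axis 1 1) = axis 5 1"
    "\<hh>\<^sub>1\<^sub>0 (axis 4 1) (axis 1 1) = axis 6 1" by (simp_all add: bracket_nth)
  show "\<not> derived_bound 2 \<hh>\<^sub>1\<^sub>0" by (rule not_derived_bound[of "{4, 5, 6}"]) (use 10 in auto)
  have 11: "\<hh>\<^sub>1\<^sub>1 (axis 2 1) (axis 1 1) = axis 4 1" "\<hh>\<^sub>1\<^sub>1 (axis 3 1) (axis 1 1) = axis 5 1"
    "\<hh>\<^sub>1\<^sub>1 (axis 4 1) (axis 1 1) = axis 6 1" by (simp_all add: bracket_nth)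
  show "\<not> derived_bound 2 \<hh>\<^sub>1\<^sub>1" by (rule not_derived_bound[of "{4, 5, 6}"]) (use 11 in auto)
qed

lemma two_steps:
  "two_step \<hh>\<^sub>4" "two_step \<hh>\<^sub>7" "\<not> two_step \<hh>\<^sub>9" "\<not> two_step \<hh>\<^sub>1\<^sub>0" "\<not> two_step \<hh>\<^sub>1\<^sub>1"
proof -
  show "two_step \<hh>\<^sub>4" "two_step \<hh>\<^sub>7" by (simp_all add: two_step_def bracket_nth)
  have "\<hh>\<^sub>9 (axis 1 1) (\<hh>\<^sub>9 (axis 1 1) (axis 2 1)) $ 6 \<noteq> 0" "\<hh>\<^sub>1\<^sub>0 (axis 1 1) (\<hh>\<^sub>1\<^sub>0 (axis 1 1) (axis 2 1)) $ 6 \<noteq> 0"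
    "\<hh>\<^sub>1\<^sub>1 (axis 1 1) (\<hh>\<^sub>1\<^sub>1 (axis 1 1) (axis 2 1)) $ 6 \<noteq> 0"
    by (simp_all add: bracket_nth)
  then show "\<not> two_step \<hh>\<^sub>9" "\<not> two_step \<hh>\<^sub>1\<^sub>0" "\<not> two_step \<hh>\<^sub>1\<^sub>1"
    unfolding two_step_def by (metis zero_index)+
qed

lemma centralizers: "centralizer_abelian \<hh>\<^sub>1\<^sub>0" "\<not> centralizer_abelian \<hh>\<^sub>1\<^sub>1"
proof -
  show "centralizer_abelian \<hh>\<^sub>1\<^sub>0"
    unfolding centralizer_abelian_def
  proof (intro allI impI)
    fix X Y assume "\<forall>U V. \<hh>\<^sub>1\<^sub>0 X (\<hh>\<^sub>1\<^sub>0 U V) = 0" "\<forall>U V. \<hh>\<^sub>1\<^sub>0 Y (\<hh>\<^sub>1\<^sub>0 U V) = 0"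
    then have "\<hh>\<^sub>1\<^sub>0 X (\<hh>\<^sub>1\<^sub>0 (axis 2 1) (axis 1 1)) $ 6 = 0" "\<hh>\<^sub>1\<^sub>0 Y (\<hh>\<^sub>1\<^sub>0 (axis 2 1) (axis 1 1)) $ 6 = 0" by simp_all
    then have "X $ 1 = 0" "Y $ 1 = 0" by (simp_all add: bracket_nth)
    then show "\<hh>\<^sub>1\<^sub>0 X Y = 0" by (simp add: bracket_nth)
  qed
  have "\<forall>U V. \<hh>\<^sub>1\<^sub>1 (axis 2 1) (\<hh>\<^sub>1\<^sub>1 U V) = 0" "\<forall>U V. \<hh>\<^sub>1\<^sub>1 (axis 3 1) (\<hh>\<^sub>1\<^sub>1 U V) = 0"
    by (simp_all add: bracket_nth)
  moreover have "\<hh>\<^sub>1\<^sub>1 (axis 2 1) (axis 3 1) $ 6 \<noteq> 0" by (simp add: bracket_nth)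
  ultimately show "\<not> centralizer_abelian \<hh>\<^sub>1\<^sub>1"
    unfolding centralizer_abelian_def by (metis zero_index)
qed

lemma derived_bounds_mono:
  "derived_bound 1 \<hh>\<^sub>1" "derived_bound 2 \<hh>\<^sub>1" "derived_bound 2 \<hh>\<^sub>8"
  "\<not> derived_bound 0 \<hh>\<^sub>4" "\<not> derived_bound 0 \<hh>\<^sub>9" "\<not> derived_bound 0 \<hh>\<^sub>7" "\<not> derived_bound 0 \<hh>\<^sub>1\<^sub>0" "\<not> derived_bound 0 \<hh>\<^sub>1\<^sub>1"
  "\<not> derived_bound 1 \<hh>\<^sub>7" "\<not> derived_bound 1 \<hh>\<^sub>1\<^sub>0" "\<not> derived_bound 1 \<hh>\<^sub>1\<^sub>1"
  using derived_bounds not_derived_bounds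
    derived_bound_mono[of 0 _ 1] derived_bound_mono[of 1 _ 2] derived_bound_mono[of 0 _ 2]
  by auto

lemmas signature_facts = derived_bounds not_derived_bounds derived_bounds_mono two_steps centralizers

text \<open>The theorem speaks of every structure on a given algebra, so a hypothesis on the
  isomorphism type has to single out one case of the classification.\<close>

lemma isomorphic_unique:
  assumes "lie_isomorphic br \<kk>" "lie_isomorphic br \<kk>'"
    and "\<kk> \<in> {\<hh>\<^sub>1, \<hh>\<^sub>4, \<hh>\<^sub>7, \<hh>\<^sub>8, \<hh>\<^sub>9, \<hh>\<^sub>1\<^sub>0, \<hh>\<^sub>1\<^sub>1}" "\<kk>' \<in> {\<hh>\<^sub>1, \<hh>\<^sub>4, \<hh>\<^sub>7, \<hh>\<^sub>8, \<hh>\<^sub>9, \<hh>\<^sub>1\<^sub>0, \<hh>\<^sub>1\<^sub>1}"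
  shows "\<kk> = \<kk>'"
proof -
  have "signature \<kk> = signature \<kk>'" using signature_eq[OF assms(1)] signature_eq[OF assms(2)] by simp
  then show ?thesis
    using assms(3,4) signature_facts unfolding signature_def by (elim insertE emptyE) simp_all
qed

lemma nilpotent_distinct: "distinct [\<hh>\<^sub>1, \<hh>\<^sub>4, \<hh>\<^sub>7, \<hh>\<^sub>8, \<hh>\<^sub>9, \<hh>\<^sub>1\<^sub>0, \<hh>\<^sub>1\<^sub>1]"
proof -
  have "distinct (map signature [\<hh>\<^sub>1, \<hh>\<^sub>4, \<hh>\<^sub>7, \<hh>\<^sub>8, \<hh>\<^sub>9, \<hh>\<^sub>1\<^sub>0, \<hh>\<^sub>1\<^sub>1])"
    using signature_facts by (simp add: signature_def)
  then show ?thesis by (rule distinct_map[THEN iffD1, THEN conjunct1])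
qed

section \<open>Comparison of a structure with its mirror\<close>

lemma lie_isomorphic_sym: "lie_isomorphic br br' \<Longrightarrow> lie_isomorphic br' br"
  unfolding lie_isomorphic_def using lie_isomorphism_inv(1) by blast

lemma lie_isomorphism_compose:
  assumes "lie_isomorphism br br' f" "lie_isomorphism br' br'' g"
  shows "lie_isomorphism br br'' (\<lambda>x. g (f x))"
  using assms linear_compose[of f g] bij_comp[of f g] by (auto simp: lie_isomorphism_def o_def)

lemma lie_isomorphic_trans: "lie_isomorphic br br' \<Longrightarrow> lie_isomorphic br' br'' \<Longrightarrow> lie_isomorphic br br''"
  unfolding lie_isomorphic_def using lie_isomorphism_compose by blast

definition frame_map :: "'g::real_vector \<Rightarrow> 'g \<Rightarrow> 'g \<Rightarrow> vec3 \<Rightarrow> 'g" where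
  "frame_map v1 v2 v3 = (\<lambda>(x1, x2, x3). x1 *\<^sub>R v1 + x2 *\<^sub>R v2 + x3 *\<^sub>R v3)"

lemma linear_frame_map: "linear (frame_map v1 v2 v3)"
  by (rule linearI) (auto simp: frame_map_def algebra_simps)

lemma bij_frame_map:
  assumes "frame v1 v2 v3"
  shows "bij (frame_map v1 v2 v3)"
proof -
  have "inj (frame_map v1 v2 v3)"
  proof (rule linear_injective_0[OF linear_frame_map, THEN iffD2], intro allI impI)
    fix p assume "frame_map v1 v2 v3 p = 0"
    then show "p = 0" using frame_zero[OF assms] by (cases p) (auto simp: frame_map_def zero_prod_def)
  qed
  moreover have "surj (frame_map v1 v2 v3)"
  proof (unfold surj_def, rule allI)
    fix v obtain x y z where "v = x *\<^sub>R v1 + y *\<^sub>R v2 + z *\<^sub>R v3" using frame_span[OF assms] by blast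
    then have "v = frame_map v1 v2 v3 (x, y, z)" by (simp add: frame_map_def)
    then show "\<exists>p. v = frame_map v1 v2 v3 p" by blast
  qed
  ultimately show ?thesis by (simp add: bij_def)
qed

lemma frame_map_product:
  assumes "bilinear m" "product_table m v1 v2 v3 a k b c 0"
  shows "m (frame_map v1 v2 v3 x) (frame_map v1 v2 v3 y) = frame_map v1 v2 v3 (std_product a k b c x y)"
  using assms(2) by (cases x; cases y) (simp add: frame_map_def bilinear_simps[OF assms(1)] product_table_def algebra_simps)

lemma std_lie_isomorphism:
  assumes m: "bilinear m" and br: "\<And>x y. br x y = m x y - m y x"
    and fr: "frame v1 v2 v3" and tab: "product_table m v1 v2 v3 a k b c 0"
  defines "G \<equiv> frame_map v1 v2 v3"
  shows "lie_isomorphism (std_bracket a k b c) (semidirect br m) (map_prod G G)"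
    "map_prod G G (model_J p) = model_J (map_prod G G p)"
proof -
  have G: "linear G" "bij G" unfolding G_def by (rule linear_frame_map, rule bij_frame_map[OF fr])
  have p: "m (G x) (G y) = G (std_product a k b c x y)" for x y
    unfolding G_def by (rule frame_map_product[OF m tab])
  show "lie_isomorphism (std_bracket a k b c) (semidirect br m) (map_prod G G)"
    unfolding lie_isomorphism_def
  proof (intro conjI allI)
    show "linear (map_prod G G)" by (rule linearI) (simp_all add: map_prod_def case_prod_beta linear_add[OF G(1)] linear_scale[OF G(1)])
    show "bij (map_prod G G)" using G(2) by (simp add: bij_def prod.inj_map map_prod_surj)
    show "map_prod G G (std_bracket a k b c x y) = semidirect br m (map_prod G G x) (map_prod G G y)" for x y
      unfolding std_bracket_def by (cases x; cases y) (simp add: br p linear_diff[OF G(1)])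
  qed
  show "map_prod G G (model_J p) = model_J (map_prod G G p)"
    by (simp add: model_J_def map_prod_def case_prod_beta linear_neg[OF G(1)])
qed

lemma std_isomorphic:
  assumes "bilinear m" "\<And>x y. br x y = m x y - m y x" "frame v1 v2 v3" "product_table m v1 v2 v3 a k b c 0"
    "lie_isomorphic (std_bracket a k b c) \<kk>"
  shows "lie_isomorphic (semidirect br m) \<kk>"
  using std_lie_isomorphism(1)[OF assms(1-4)] assms(5) lie_isomorphic_sym lie_isomorphic_trans
  unfolding lie_isomorphic_def by blast

text \<open>
  With \<open>e\<^sub>i\<close> the basis of \<open>\<gg>\<close> and \<open>f\<^sub>i = J e\<^sub>i\<close>, the map \<open>\<phi>\<close> preserves the lower central series
  \<open>\<langle>e\<^sub>3, f\<^sub>2, f\<^sub>3\<rangle> \<supset> \<langle>f\<^sub>3\<rangle>\<close> and commutes with \<open>J\<close>, so it is triangular, and the brackets \<open>[e\<^sub>1, f\<^sub>2] = b f\<^sub>3\<close> and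
  \<open>[e\<^sub>2, f\<^sub>1] = c f\<^sub>3\<close> are scaled by the same factor.
\<close>

lemma std_holomorphic_invariant:
  assumes iso: "lie_isomorphism (std_bracket a k b c) (std_bracket a' k' b' c') \<phi>"
    and J: "\<And>p. \<phi> (model_J p) = model_J (\<phi> p)" and ne: "a \<noteq> 0" "b \<noteq> 0" "b' \<noteq> 0"
  shows "b' * c = b * c'"
proof -
  let ?B = "std_bracket a k b c" and ?B' = "std_bracket a' k' b' c'"
  let ?o = "(0, 0, 0) :: vec3"
  have \<phi>: "linear \<phi>" "inj \<phi>" "\<And>x y. \<phi> (?B x y) = ?B' (\<phi> x) (\<phi> y)"
    using iso by (auto simp: lie_isomorphism_def bij_is_inj)
  have p0: "\<phi> ((0, 0, 0), (0, 0, 0)) = ((0, 0, 0), (0, 0, 0))"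
    using linear_0[OF \<phi>(1)] by (simp add: zero_prod_def)
  have J': "\<phi> (u, - x) = - model_J (\<phi> (x, u))" for x u
    using J[of "(x, u)"] linear_neg[OF \<phi>(1), of "(- u, x)"] by simp
  let ?e1 = "((1, 0, 0), ?o) :: vec3 \<times> vec3" and ?e2 = "((0, 1, 0), ?o) :: vec3 \<times> vec3" and ?e3 = "((0, 0, 1), ?o) :: vec3 \<times> vec3"
  let ?f1 = "(?o, (1, 0, 0)) :: vec3 \<times> vec3" and ?f2 = "(?o, (0, 1, 0)) :: vec3 \<times> vec3" and ?f3 = "(?o, (0, 0, 1)) :: vec3 \<times> vec3"
  have der: "\<exists>s t w. ?B' p q = ((0, 0, s), (0, t, w))" for p q
    by (cases p rule: prod.exhaust; cases q rule: prod.exhaust) (auto simp: split_paired_all)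
  have der2: "\<exists>w. ?B' p ((0, 0, s), (0, t, z)) = (?o, (0, 0, w))" for p s t z
    by (cases p rule: prod.exhaust) (auto simp: split_paired_all)
  have "\<phi> (?B ?e1 (?B ?e1 ?f1)) = ?B' (\<phi> ?e1) (?B' (\<phi> ?e1) (\<phi> ?f1))" by (simp only: \<phi>(3))
  then obtain l where "\<phi> (?B ?e1 (?B ?e1 ?f1)) = (?o, (0, 0, l))" using der der2 by metis
  moreover have "?B ?e1 (?B ?e1 ?f1) = (a * b) *\<^sub>R ?f3" by simp
  ultimately have l: "(a * b) *\<^sub>R \<phi> ?f3 = (?o, (0, 0, l))" by (simp only: linear_scale[OF \<phi>(1)])
  have "\<phi> ?f3 = (1 / (a * b)) *\<^sub>R ((a * b) *\<^sub>R \<phi> ?f3)" using ne by simp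
  also have "\<dots> = (?o, (0, 0, l / (a * b)))" unfolding l by simp
  finally have "\<phi> ?f3 = (?o, (0, 0, l / (a * b)))" .
  then obtain r where f3: "\<phi> ?f3 = (?o, (0, 0, r))" by blast
  have e3: "\<phi> ?e3 = ((0, 0, r), ?o)" using J'[of "(0, 0, 1)" ?o] by (simp add: f3)
  have l0: "r \<noteq> 0"
  proof
    assume "r = 0"
    then have "\<phi> ?f3 = \<phi> 0" using f3 by (simp add: p0 zero_prod_def)
    then have "?f3 = 0" by (rule injD[OF \<phi>(2)])
    then show False by (simp add: zero_prod_def)
  qed
  obtain s t w where "\<phi> (?B ?e1 ?f1) = ((0, 0, s), (0, t, w))" using der \<phi>(3) by metis
  moreover have "?f2 = (1 / a) *\<^sub>R ?B ?e1 ?f1 + (- k / a) *\<^sub>R ?f3" using ne by simp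
  ultimately have "\<phi> ?f2 = (1 / a) *\<^sub>R ((0, 0, s), (0, t, w)) + (- k / a) *\<^sub>R (?o, (0, 0, r))"
    by (simp only: linear_add[OF \<phi>(1)] linear_scale[OF \<phi>(1)] f3)
  then obtain s t w where f2: "\<phi> ?f2 = ((0, 0, s), (0, t, w))" by simp
  have e2: "\<phi> ?e2 = ((0, t, w), (0, 0, - s))" using J'[of "(0, 1, 0)" ?o] by (simp add: f2)
  have t0: "t \<noteq> 0"
  proof
    assume "t = 0"
    then have "\<phi> ?f2 = (s / r) *\<^sub>R \<phi> ?e3 + (w / r) *\<^sub>R \<phi> ?f3" using l0 by (simp add: f2 f3 e3)
    also have "\<dots> = \<phi> ((s / r) *\<^sub>R ?e3 + (w / r) *\<^sub>R ?f3)" by (simp only: linear_add[OF \<phi>(1)] linear_scale[OF \<phi>(1)])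
    finally have "?f2 = (s / r) *\<^sub>R ?e3 + (w / r) *\<^sub>R ?f3" by (rule injD[OF \<phi>(2)])
    then show False by simp
  qed
  obtain p p2 p3 q q2 q3 where f1: "\<phi> ?f1 = ((p, p2, p3), (q, q2, q3))" by (metis prod.collapse)
  have e1: "\<phi> ?e1 = ((q, q2, q3), (- p, - p2, - p3))" using J'[of "(1, 0, 0)" ?o] by (simp add: f1)
  \<comment> \<open>f_1 and f_2 commute, which excludes an e_1 component in the image of
    f_1.\<close>
  have "?B' (\<phi> ?f1) (\<phi> ?f2) = \<phi> (?B ?f1 ?f2)" by (simp only: \<phi>(3))
  also have "?B ?f1 ?f2 = 0" by (simp add: zero_prod_def)
  finally have "b' * (p * t) = 0" unfolding f1 f2 by (simp add: p0 zero_prod_def)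
  then have p: "p = 0" using ne t0 by simp
  have "?B' (\<phi> ?e1) (\<phi> ?f2) = \<phi> (?B ?e1 ?f2)" by (simp only: \<phi>(3))
  also have "?B ?e1 ?f2 = b *\<^sub>R ?f3" by simp
  finally have 1: "b' * (q * t) = b * r"
    unfolding linear_scale[OF \<phi>(1)] f3 e1 f2 by simp
  have "?B' (\<phi> ?e2) (\<phi> ?f1) = \<phi> (?B ?e2 ?f1)" by (simp only: \<phi>(3))
  also have "?B ?e2 ?f1 = c *\<^sub>R ?f3" by simp
  finally have 2: "c' * (t * q) = c * r"
    unfolding linear_scale[OF \<phi>(1)] f3 e2 f1 by (simp add: p)
  have "r * (b' * c) = b' * (c * r)" by simp
  also have "\<dots> = c' * (b' * (q * t))" unfolding 2[symmetric] by simp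
  also have "\<dots> = r * (b * c')" unfolding 1 by simp
  finally show ?thesis using l0 by simp
qed

text \<open>Self-mirror symmetry on the level of models. No condition on \<open>J\<close> enters,
  because the algebras of the complex structures are already identified with symplectic
  ones.\<close>

definition symplectomorphic_models where
  "symplectomorphic_models br m m' B \<longleftrightarrow> (\<exists>f. lie_isomorphism (semidirect br m) (semidirect br m') f \<and>
     (\<forall>p q. model_omega B (f p) (f q) = model_omega B p q))"

lemma symplectomorphic_modelsI:
  assumes \<sigma>: "linear \<sigma>" "bij \<sigma>" "\<And>x y. \<sigma> (m x y) = m' (\<sigma> x) (\<sigma> y)" "\<And>x y. B (\<sigma> x) (\<sigma> y) = B x y"
    and br: "\<And>x y. br x y = m x y - m y x" "\<And>x y. br x y = m' x y - m' y x"
  shows "symplectomorphic_models br m m' B"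
proof -
  have "lie_isomorphism (semidirect br m) (semidirect br m') (map_prod \<sigma> \<sigma>)"
    unfolding lie_isomorphism_def
  proof (intro conjI allI)
    show "linear (map_prod \<sigma> \<sigma>)" by (rule linearI) (simp_all add: map_prod_def case_prod_beta linear_add[OF \<sigma>(1)] linear_scale[OF \<sigma>(1)])
    show "bij (map_prod \<sigma> \<sigma>)" using \<sigma>(2) by (simp add: bij_def prod.inj_map map_prod_surj)
    have "\<sigma> (br x y) = br (\<sigma> x) (\<sigma> y)" for x y
      by (simp only: br(1)[of x y] linear_diff[OF \<sigma>(1)] \<sigma>(3) br(2)[symmetric])
    then show "map_prod \<sigma> \<sigma> (semidirect br m x y) = semidirect br m' (map_prod \<sigma> \<sigma> x) (map_prod \<sigma> \<sigma> y)" for x y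
      by (cases x; cases y) (simp add: \<sigma>(3) linear_diff[OF \<sigma>(1)])
  qed
  moreover have "model_omega B (map_prod \<sigma> \<sigma> p) (map_prod \<sigma> \<sigma> q) = model_omega B p q" for p q
    by (cases p; cases q) (simp add: \<sigma>(4))
  ultimately show ?thesis unfolding symplectomorphic_models_def by blast
qed

text \<open>Here \<open>m' = - m\<close>, so that \<open>- 1\<close> exchanges the two products.\<close>

lemma symplectomorphic_abelian:
  assumes h: "hessian_structure br m B" and h': "hessian_structure br m' B" and dual: "dual_product m m' B"
    and ab: "\<And>x y. br x y = 0"
  shows "symplectomorphic_models br m m' B"
proof -
  have m: "bilinear m" and B: "bilinear B" and br: "\<And>x y. br x y = m x y - m y x" and sym: "\<And>x y. B x y = B y x"
    and nd: "\<forall>x. (\<forall>y. B x y = 0) \<longrightarrow> x = 0" and cl: "\<And>x y z. B (br x y) z = B x (m y z) - B y (m x z)"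
    by (rule hessian_structureD[OF h])+
  have br': "\<And>x y. br x y = m' x y - m' y x" and m': "bilinear m'" by (rule hessian_structureD[OF h'])+
  note bm = bilinear_simps[OF m] and bm' = bilinear_simps[OF m'] and bB = bilinear_simps[OF B]
  have comm: "m x y = m y x" for x y using br[of x y] ab by simp
  have inv: "B x (m y z) = B y (m x z)" for x y z using cl[of x y z] ab by (simp add: bB)
  have "m' x y = - m x y" for x y
  proof (rule nondegenerate_eqI[OF B nd])
    fix z
    have "B (m x y) z = B z (m x y)" by (rule sym)
    also have "\<dots> = B x (m z y)" by (rule inv)
    also have "\<dots> = B x (m y z)" using comm by simp
    also have "\<dots> = B y (m x z)" by (rule inv)
    finally show "B (m' x y) z = B (- m x y) z" using dual by (simp add: dual_product_def bB)
  qed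
  then show ?thesis
    by (intro symplectomorphic_modelsI[where \<sigma> = uminus] br br')
      (auto simp: bm bB intro!: linearI bij_uminus)
qed

text \<open>The isomorphism is \<open>v\<^sub>1 \<mapsto> - v\<^sub>1\<close>, \<open>v\<^sub>2 \<mapsto> v\<^sub>2 + \<delta> v\<^sub>3\<close>, \<open>v\<^sub>3 \<mapsto> - v\<^sub>3\<close>.\<close>

lemma symplectomorphic_c_zero:
  assumes nf: "normal_form m B v1 v2 v3 a k b 0" and a: "a \<noteq> 0" and h: "hessian_structure br m B"
    and h': "hessian_structure br m' B" and dual: "dual_product m m' B"
  shows "symplectomorphic_models br m m' B"
proof -
  have m: "bilinear m" and B: "bilinear B" and br: "\<And>x y. br x y = m x y - m y x" and sym: "\<And>x y. B x y = B y x"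
    by (rule hessian_structureD[OF h])+
  have br': "\<And>x y. br x y = m' x y - m' y x" and m': "bilinear m'" by (rule hessian_structureD[OF h'])+
  note bB = bilinear_simps[OF B]
  have fr: "frame v1 v2 v3" and tab: "product_table m v1 v2 v3 a k b 0 0"
    and g: "B v2 v3 = 0" "B v3 v3 = 0" "B v1 v3 \<noteq> 0" "B v2 v2 \<noteq> 0" and e: "(2 * 0 - b) * B v1 v3 = a * B v2 v2"
    using nf by (auto simp: normal_form_def)
  obtain \<alpha> \<kappa> where tab': "product_table m' v1 v2 v3 \<alpha> \<kappa> (b - 2 * 0) (- 0) 0"
    and \<alpha>: "\<alpha> * B v2 v2 = - b * B v1 v3" and \<kappa>: "\<alpha> * B v1 v2 + \<kappa> * B v1 v3 = - (a * B v1 v2 + k * B v1 v3)"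
    using normal_form_dual[OF nf h h' dual] by metis
  have "\<alpha> * B v2 v2 = a * B v2 v2" using \<alpha> e by simp
  then have \<alpha>a: "\<alpha> = a" using g by simp
  define \<delta> where "\<delta> = (\<kappa> + k) / a"
  have \<delta>: "\<kappa> = \<delta> * a - k" using a by (simp add: \<delta>_def)
  have "a * (2 * B v1 v2 + \<delta> * B v1 v3) = 0" using \<kappa> unfolding \<delta> \<alpha>a by (simp add: algebra_simps)
  \<comment> \<open>The value of \<open>\<delta>\<close> that matches the products is also the one
    that makes the map an isometry: B(- v1, v2 + \<delta> v3) = B(v1, v2).\<close>
  then have d: "\<delta> * B v1 v3 = - 2 * B v1 v2" using a by simp
  let ?G = "frame_map v1 v2 v3"
  have G: "linear ?G" "bij ?G" by (rule linear_frame_map, rule bij_frame_map[OF fr])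
  have i: "inv ?G (?G x) = x" "?G (inv ?G v) = v" for x v
    using G(2) by (simp_all add: bij_is_inj bij_is_surj surj_f_inv_f)
  define s :: "vec3 \<Rightarrow> vec3" where "s = (\<lambda>(x1, x2, x3). (- x1, x2, \<delta> * x2 - x3))"
  have s: "linear s" by (auto simp: s_def intro!: linearI simp: algebra_simps)
  have ss: "s (s x) = x" for x by (cases x) (simp add: s_def)
  define \<sigma> where "\<sigma> v = ?G (s (inv ?G v))" for v
  have \<sigma>G: "\<sigma> (?G x) = ?G (s x)" for x by (simp add: \<sigma>_def i)
  have ex: "\<exists>x. v = ?G x" for v using i(2) by metis
  show ?thesis
  proof (rule symplectomorphic_modelsI[where \<sigma> = \<sigma>])
    show "linear \<sigma>"
      using linear_compose[OF linear_compose[OF linear_inv_bij[OF G] s] G(1)] by (simp add: \<sigma>_def[abs_def] o_def)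
    show "bij \<sigma>" by (rule o_bij[of \<sigma>]) (auto simp: \<sigma>_def i ss fun_eq_iff)
    fix u v obtain x y where x: "u = ?G x" and y: "v = ?G y" using ex by metis
    have "s (std_product a k b 0 x y) = std_product \<alpha> \<kappa> (b - 2 * 0) (- 0) (s x) (s y)"
      by (cases x; cases y) (simp add: s_def \<alpha>a \<delta> algebra_simps)
    then show "\<sigma> (m u v) = m' (\<sigma> u) (\<sigma> v)"
      unfolding x y \<sigma>G frame_map_product[OF m tab] frame_map_product[OF m' tab'] by simp
    have B': "B v2 v1 = B v1 v2" "B v3 v1 = B v1 v3" "B v3 v2 = 0" using sym g(1) by metis+
    have "B (?G (s x)) (?G (s y)) = B (?G x) (?G y)"
    proof (cases x; cases y)
      fix x1 x' y1 y' assume "x = (x1, x')" "y = (y1, y')"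
      then obtain x2 x3 y2 y3 where xy: "x = (x1, x2, x3)" "y = (y1, y2, y3)" by (metis prod.collapse)
      have "B (?G (s x)) (?G (s y)) = x1 * y1 * B v1 v1 - (x1 * y2 + x2 * y1) * (B v1 v2 + \<delta> * B v1 v3)
          + (x1 * y3 + x3 * y1) * B v1 v3 + x2 * y2 * B v2 v2"
        by (simp add: xy s_def frame_map_def bB B' g algebra_simps)
      also have "\<dots> = B (?G x) (?G y)"
        unfolding d by (simp add: xy frame_map_def bB B' g algebra_simps)
      finally show ?thesis .
    qed
    then show "B (\<sigma> u) (\<sigma> v) = B u v" unfolding x y \<sigma>G .
  qed (rule br br')+
qed

section \<open>The mirror theorem\<close>

text \<open>The mirror of the mirror has the original product; this gives the weak mirror pair in
  the opposite direction.\<close>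

lemma dual_product_sym:
  assumes "hessian_structure br m B" "dual_product m m' B"
  shows "dual_product m' m B"
proof -
  have sym: "\<And>x y. B x y = B y x" by (rule hessian_structureD[OF assms(1)])
  have d: "B (m' x y) z = - B y (m x z)" for x y z using assms(2) by (simp add: dual_product_def)
  have "B (m x y) z = - B y (m' x z)" for x y z
    using d[of x z y] sym[of "m x y" z] sym[of y "m' x z"] by simp
  then show ?thesis by (simp add: dual_product_def)
qed

text \<open>A basis of \<open>\<gg>\<close> and its copy in \<open>V\<close> under \<open>j\<close>
  together form a basis of the whole space, so its cardinality is half of 6.\<close>

lemma basis_of_half:
  fixes j :: "'g::real_vector \<Rightarrow> 'v::real_vector"
  assumes j: "linear j" "bij j" and dim: "dim (UNIV :: ('g \<times> 'v) set) = 6"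
  obtains S :: "'g set" where "finite S" "independent S" "span S = UNIV" "card S = 3"
proof -
  obtain T :: "('g \<times> 'v) set" where T: "independent T" "UNIV \<subseteq> span T" "card T = dim (UNIV :: ('g \<times> 'v) set)"
    using basis_exists[of UNIV] by metis
  \<comment> \<open>A set of positive cardinality is finite: this is where finite dimension comes
    out of the hypothesis on \<open>dim\<close>.\<close>
  have "finite T" using T(3) dim by (simp add: card_ge_0_finite)
  then have "finite_dimensional TYPE('g \<times> 'v)" using T(2) by (auto simp: finite_dimensional_def)
  then have "finite_dimensional TYPE('g)"
    by (rule finite_dimensional_surj[of fst]) (auto simp: linear_iff surj_def)
  then obtain S :: "'g set" where S: "finite S" "independent S" "span S = UNIV"
    using finite_dimensional_basis by blast
  let ?f = "\<lambda>x. (x, 0 :: 'v)" and ?g = "\<lambda>x. (0 :: 'g, j x)"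
  let ?U = "?f ` S \<union> ?g ` S"
  have l: "linear ?f" "linear ?g" by (auto simp: linear_iff linear_add[OF j(1)] linear_scale[OF j(1)])
  have inj: "inj j" using j(2) by (rule bij_is_inj)
  have i: "inj_on ?f S" "inj_on ?g S" using inj by (auto simp: inj_on_def)
  have "0 \<notin> S" using S(2) dependent_zero by blast
  then have dis: "?f ` S \<inter> ?g ` S = {}" by auto
  have sp: "span ?U = UNIV"
  proof -
    have f: "?f x \<in> span ?U" and g: "?g x \<in> span ?U" for x
    proof -
      have "?f x \<in> ?f ` span S" "?g x \<in> ?g ` span S" using S(3) by auto
      then show "?f x \<in> span ?U" "?g x \<in> span ?U"
        unfolding linear_span_image[OF l(1), symmetric] linear_span_image[OF l(2), symmetric]
        using span_mono[of "?f ` S" ?U] span_mono[of "?g ` S" ?U] by blast+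
    qed
    have "(x, v) \<in> span ?U" for x v
    proof -
      obtain y where "v = j y" using j(2) by (metis bij_pointE)
      then have "(x, v) = ?f x + ?g y" by simp
      then show ?thesis using span_add[OF f g] by metis
    qed
    then show ?thesis by auto
  qed
  have "independent ?U"
  proof (rule ccontr)
    assume "\<not> independent ?U"
    then obtain u where u: "\<exists>v\<in>?U. u v \<noteq> 0" "(\<Sum>v\<in>?U. u v *\<^sub>R v) = 0"
      using dependent_finite[of ?U] S(1) by auto
    have "(\<Sum>v\<in>?U. u v *\<^sub>R v) = (\<Sum>v\<in>?f ` S. u v *\<^sub>R v) + (\<Sum>v\<in>?g ` S. u v *\<^sub>R v)"
      using S(1) dis by (intro sum.union_disjoint) auto
    also have "\<dots> = (\<Sum>x\<in>S. u (?f x) *\<^sub>R ?f x) + (\<Sum>x\<in>S. u (?g x) *\<^sub>R ?g x)"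
      by (simp only: sum.reindex[OF i(1)] sum.reindex[OF i(2)] o_def)
    also have "\<dots> = ?f (\<Sum>x\<in>S. u (?f x) *\<^sub>R x) + ?g (\<Sum>x\<in>S. u (?g x) *\<^sub>R x)"
      by (simp only: linear_sum[OF l(1)] linear_sum[OF l(2)] linear_scale[OF l(1)] linear_scale[OF l(2)])
    finally have "(\<Sum>x\<in>S. u (?f x) *\<^sub>R x) = 0" "j (\<Sum>x\<in>S. u (?g x) *\<^sub>R x) = 0"
      using u(2) by (auto simp: zero_prod_def)
    then have 0: "(\<Sum>x\<in>S. u (?f x) *\<^sub>R x) = 0" "(\<Sum>x\<in>S. u (?g x) *\<^sub>R x) = 0"
      using inj linear_0[OF j(1)] by (metis injD)+
    have "u (?f x) = 0" "u (?g x) = 0" if "x \<in> S" for x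
      using independentD[OF S(2,1) order_refl 0(1) that] independentD[OF S(2,1) order_refl 0(2) that] by auto
    with u(1) show False by blast
  qed
  then have "card ?U = dim (UNIV :: ('g \<times> 'v) set)" using sp by (intro dim_eq_card[symmetric]) (simp_all only: span_UNIV simp_thms)
  then have "card ?U = 6" using dim by simp
  moreover have "card ?U = card S + card S"
    using S(1) dis card_image[OF i(1)] card_image[OF i(2)] by (simp add: card_Un_disjoint)
  ultimately show ?thesis using that S by simp
qed

lemma bracket_zero_if_commutative:
  assumes "bilinear m" "\<And>x y. br x y = m x y - m y x" "frame v1 v2 v3" "product_table m v1 v2 v3 a k b b 0"
  shows "br x y = 0"
proof -
  obtain p q where p: "x = frame_map v1 v2 v3 p" "y = frame_map v1 v2 v3 q"
    using bij_frame_map[OF assms(3)] by (metis bij_pointE)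
  have "std_product a k b b p q = std_product a k b b q p" by (cases p; cases q) (simp add: algebra_simps)
  then show ?thesis by (simp add: p assms(2) frame_map_product[OF assms(1,4)])
qed

text \<open>The invariant b / c would agree with its mirror value 2 - b / c, which happens only for
  b = c.\<close>

lemma not_holomorphically_equivalent:
  assumes m: "bilinear m" "\<And>x y. br x y = m x y - m y x" and m': "bilinear m'" "\<And>x y. br x y = m' x y - m' y x"
    and fr: "frame v1 v2 v3" and tab: "product_table m v1 v2 v3 a k b c 0" and tab': "product_table m' v1 v2 v3 \<alpha> \<kappa> (b - 2 * c) (- c) 0"
    and ne: "a \<noteq> 0" "b \<noteq> 0" "c \<noteq> 0" "b \<noteq> c" "b \<noteq> 2 * c"
    and f: "lie_isomorphism (semidirect br m) (semidirect br m') f" "\<And>p. f (model_J p) = model_J (f p)"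
  shows False
proof -
  let ?G = "map_prod (frame_map v1 v2 v3) (frame_map v1 v2 v3)"
  note g = std_lie_isomorphism[OF m fr tab] and g' = std_lie_isomorphism[OF m' fr tab']
  note i = lie_isomorphism_inv[OF g'(1)]
  have "lie_isomorphism (std_bracket a k b c) (std_bracket \<alpha> \<kappa> (b - 2 * c) (- c)) (\<lambda>p. inv ?G (f (?G p)))"
    by (rule lie_isomorphism_compose[OF lie_isomorphism_compose[OF g(1) f(1)] i(1)])
  moreover have "inv ?G (model_J q) = model_J (inv ?G q)" for q
    using g'(2)[of "inv ?G q"] i(2,3) by metis
  then have "inv ?G (f (?G (model_J p))) = model_J (inv ?G (f (?G p)))" for p
    by (simp only: g(2) f(2))
  ultimately have "(b - 2 * c) * c = b * (- c)"
    by (rule std_holomorphic_invariant) (use ne in auto)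
  then have "c * (b - c) = 0" by (simp add: algebra_simps)
  then show False using ne by simp
qed

text \<open>For \<open>\<hh>\<^sub>1\<^sub>1\<close> the obstruction is recorded for the complex
  structures alone, which is stronger than the failure of pseudo-Kaehler equivalence.\<close>

definition mirror_classification where
  "mirror_classification br m m' B \<longleftrightarrow>
     (\<exists>\<kk>\<in>{\<hh>\<^sub>1, \<hh>\<^sub>8, \<hh>\<^sub>9, \<hh>\<^sub>1\<^sub>0}. lie_isomorphic (semidirect br m) \<kk> \<and> symplectomorphic_models br m m' B) \<or>
     lie_isomorphic (semidirect br m) \<hh>\<^sub>4 \<and> lie_isomorphic (semidirect br m') \<hh>\<^sub>7 \<or>
     lie_isomorphic (semidirect br m) \<hh>\<^sub>7 \<and> lie_isomorphic (semidirect br m') \<hh>\<^sub>4 \<or>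
     lie_isomorphic (semidirect br m) \<hh>\<^sub>1\<^sub>1 \<and> lie_isomorphic (semidirect br m') \<hh>\<^sub>1\<^sub>1 \<and>
       (\<nexists>f. lie_isomorphism (semidirect br m) (semidirect br m') f \<and> (\<forall>p. f (model_J p) = model_J (f p)))"

lemma mirror_classification_normal_form:
  assumes nf: "normal_form m B v1 v2 v3 a k b c" and h: "hessian_structure br m B"
    and h': "hessian_structure br m' B" and dual: "dual_product m m' B"
  shows "mirror_classification br m m' B"
proof -
  have m: "bilinear m" and br: "\<And>x y. br x y = m x y - m y x" by (rule hessian_structureD[OF h])+
  have m': "bilinear m'" and br': "\<And>x y. br x y = m' x y - m' y x" by (rule hessian_structureD[OF h'])+
  have fr: "frame v1 v2 v3" and tab: "product_table m v1 v2 v3 a k b c 0"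
    and g: "B v1 v3 \<noteq> 0" "B v2 v2 \<noteq> 0" and e: "(2 * c - b) * B v1 v3 = a * B v2 v2"
    using nf by (auto simp: normal_form_def)
  obtain \<alpha> \<kappa> where tab': "product_table m' v1 v2 v3 \<alpha> \<kappa> (b - 2 * c) (- c) 0"
    and \<alpha>: "\<alpha> * B v2 v2 = - b * B v1 v3"
    using normal_form_dual[OF nf h h' dual] by metis
  have iso: "lie_isomorphic (semidirect br m) \<kk>" if "lie_isomorphic (std_bracket a k b c) \<kk>" for \<kk>
    by (rule std_isomorphic[OF m br fr tab that])
  have iso': "lie_isomorphic (semidirect br m') \<kk>" if "lie_isomorphic (std_bracket \<alpha> \<kappa> (b - 2 * c) (- c)) \<kk>" for \<kk>
    by (rule std_isomorphic[OF m' br' fr tab' that])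
  have \<alpha>0: "\<alpha> = 0 \<longleftrightarrow> b = 0" using \<alpha> g by auto
  have a0: "a = 0 \<longleftrightarrow> b = 2 * c" using e g by auto
  have comm: "symplectomorphic_models br m m' B" if "b = c"
    using symplectomorphic_abelian[OF h h' dual] bracket_zero_if_commutative[OF m br fr] tab that by blast
  \<comment> \<open>In this order the cases belong to \<open>\<hh>\<^sub>1\<close> or
    \<open>\<hh>\<^sub>8\<close> (according to \<open>k\<close>), \<open>\<hh>\<^sub>4\<close>,
    \<open>\<hh>\<^sub>9\<close>, \<open>\<hh>\<^sub>7\<close>, \<open>\<hh>\<^sub>1\<^sub>0\<close>
    and \<open>\<hh>\<^sub>1\<^sub>1\<close>.\<close>
  consider "a = 0" "c = 0" | "a = 0" "c \<noteq> 0" | "a \<noteq> 0" "b = c" | "a \<noteq> 0" "b \<noteq> c" "b = 0"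
    | "a \<noteq> 0" "b \<noteq> c" "c = 0" | "a \<noteq> 0" "b \<noteq> c" "b \<noteq> 0" "c \<noteq> 0" by blast
  then show ?thesis
  proof cases
    case 1
    then have "b = 0" using a0 by simp
    then have "lie_isomorphic (semidirect br m) \<hh>\<^sub>1 \<or> lie_isomorphic (semidirect br m) \<hh>\<^sub>8"
      using 1 iso std_isomorphic_h1 std_isomorphic_h8[of k] by (cases "k = 0") auto
    then show ?thesis using comm \<open>b = 0\<close> 1 unfolding mirror_classification_def by blast
  next
    case 2
    then have b: "b = 2 * c" using a0 by simp
    have "lie_isomorphic (semidirect br m) \<hh>\<^sub>4" using iso std_isomorphic_h4[of c k] 2 b by simp
    moreover have "lie_isomorphic (semidirect br m') \<hh>\<^sub>7"
      using iso' std_isomorphic_h7[of \<alpha> "- c" \<kappa>] \<alpha>0 2 b by simp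
    ultimately show ?thesis unfolding mirror_classification_def by blast
  next
    case 3
    then have "b \<noteq> 0" using a0 by auto
    then have "lie_isomorphic (semidirect br m) \<hh>\<^sub>9" using iso std_isomorphic_h9[of a b k] 3 by simp
    then show ?thesis using comm[OF 3(2)] unfolding mirror_classification_def by blast
  next
    case 4
    then have "lie_isomorphic (semidirect br m) \<hh>\<^sub>7" using iso std_isomorphic_h7[of a c k] by simp
    moreover have "lie_isomorphic (semidirect br m') \<hh>\<^sub>4"
      using iso' std_isomorphic_h4[of "- c" \<kappa>] \<alpha>0 4 by simp
    ultimately show ?thesis unfolding mirror_classification_def by blast
  next
    case 5
    then have "lie_isomorphic (semidirect br m) \<hh>\<^sub>1\<^sub>0" using iso std_isomorphic_h10[of a b k] by simp
    moreover have "symplectomorphic_models br m m' B"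
      using symplectomorphic_c_zero[OF _ 5(1) h h' dual] nf 5(3) by blast
    ultimately show ?thesis unfolding mirror_classification_def by blast
  next
    case 6
    then have "lie_isomorphic (semidirect br m) \<hh>\<^sub>1\<^sub>1" using iso std_isomorphic_h11[of a b c k] by simp
    moreover have "lie_isomorphic (semidirect br m') \<hh>\<^sub>1\<^sub>1"
      using iso' std_isomorphic_h11[of \<alpha> "b - 2 * c" "- c" \<kappa>] \<alpha>0 a0 6 by simp
    moreover have "\<nexists>f. lie_isomorphism (semidirect br m) (semidirect br m') f \<and> (\<forall>p. f (model_J p) = model_J (f p))"
      using not_holomorphically_equivalent[OF m br m' br' fr tab tab'] 6 a0 by blast
    ultimately show ?thesis unfolding mirror_classification_def by blast
  qed
qed

lemma mirror_classification_if_nilpotent: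
  assumes h: "hessian_structure br m (B :: 'g::real_vector \<Rightarrow> 'g \<Rightarrow> real)"
    and h': "hessian_structure br m' B" and dual: "dual_product m m' B" and nil: "left_powers m n \<subseteq> {0}"
    and S: "finite (S :: 'g set)" "independent S" "span S = UNIV" "card S = 3"
  shows "mirror_classification br m m' B"
proof -
  have m: "bilinear m" and br: "\<And>x y. br x y = m x y - m y x" by (rule hessian_structureD[OF h])+
  obtain v1 v2 v3 a k b c d where fr: "frame v1 v2 v3" and t: "product_table m v1 v2 v3 a k b c d" "d * a = 0"
    using exists_product_table[OF h nil S] by metis
  show ?thesis
  proof (rule exists_normal_form[OF h fr t])
    assume 0: "\<And>x y. m x y = 0"
    have "product_table m v1 v2 v3 0 0 0 0 0" by (simp add: product_table_def 0)
    from std_isomorphic[OF m br fr this std_isomorphic_h1]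
    have "lie_isomorphic (semidirect br m) \<hh>\<^sub>1" .
    moreover have "symplectomorphic_models br m m' B"
      by (rule symplectomorphic_abelian[OF h h' dual]) (simp add: br 0)
    ultimately show ?thesis unfolding mirror_classification_def by blast
  qed (rule mirror_classification_normal_form[OF _ h h' dual])
qed

lemma DGA_complex_modelled_by:
  fixes br :: "'g::real_vector \<Rightarrow> 'g \<Rightarrow> 'g"
  assumes fin: "finite_dimensional TYPE('g)" and mod: "modelled_by br \<rho> J \<omega> j m B"
    and h': "hessian_structure br m' B" and dual: "dual_product m m' B"
  shows "dga_isomorphic (DGA_complex (semidirect br \<rho>) J) (DGA_symplectic (semidirect br m') (model_omega B))"
proof -
  have h: "hessian_structure br m B" using mod by (simp add: modelled_by_def)
  interpret dual_products br m m' B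
    by (rule dual_products.intro[OF fin hessian_structureD(1)[OF h] hessian_structureD(1)[OF h'] hessian_structureD(2,4,5,3)[OF h]])
      (use dual in \<open>simp add: dual_product_def\<close>)
  have "linear J"
    using special_lagrangian_if_modelled_by[OF mod]
    by (simp add: special_lagrangian_def pseudo_kaehler_def integrable_complex_structure_def)
  obtain f where f: "lie_isomorphism (semidirect br \<rho>) (semidirect br m) f" "\<forall>p. f (J p) = model_J (f p)"
    "\<forall>p q. model_omega B (f p) (f q) = \<omega> p q" using modelled_by_equivalence[OF mod] by blast
  show ?thesis by (rule DGA_complex_isomorphic_mirror[OF f(1) f(2)[rule_format] \<open>linear J\<close>])
qed

lemma DGA_symplectic_models:
  fixes br :: "'g::real_vector \<Rightarrow> 'g \<Rightarrow> 'g"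
  assumes fin: "finite_dimensional TYPE('g)" and h: "hessian_structure br m B"
    and f: "lie_isomorphism (semidirect br m) br' f" "\<And>p q. \<omega>' (f p) (f q) = model_omega B p q"
  shows "dga_isomorphic (DGA_symplectic (semidirect br m) (model_omega B)) (DGA_symplectic br' \<omega>')"
proof -
  have m: "bilinear m" and B: "bilinear B" and nd: "\<forall>x. (\<forall>y. B x y = 0) \<longrightarrow> x = 0" and br: "\<And>x y. br x y = m x y - m y x"
    by (rule hessian_structureD[OF h])+
  have bil: "bilinear (semidirect br m)"
    unfolding bilinear_def by (auto intro!: linearI simp: br bilinear_simps[OF m] algebra_simps)
  show ?thesis
    by (rule DGA_symplectic_isomorphic[OF finite_dimensional_prod[OF fin fin] bil _ bilinear_model_omega[OF B]
        model_omega_nondegenerate[OF B nd] f])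
      (auto simp: br zero_prod_def)
qed

lemma DGA_symplectic_modelled_by:
  fixes br :: "'g::real_vector \<Rightarrow> 'g \<Rightarrow> 'g"
  assumes fin: "finite_dimensional TYPE('g)" and mod: "modelled_by br \<rho> J \<omega> j m B"
  shows "dga_isomorphic (DGA_symplectic (semidirect br m) (model_omega B)) (DGA_symplectic (semidirect br \<rho>) \<omega>)"
proof -
  have h: "hessian_structure br m B" using mod by (simp add: modelled_by_def)
  obtain f where f: "lie_isomorphism (semidirect br \<rho>) (semidirect br m) f" "\<forall>p. f (J p) = model_J (f p)"
    "\<forall>p q. model_omega B (f p) (f q) = \<omega> p q" using modelled_by_equivalence[OF mod] by blast
  note i = lie_isomorphism_inv[OF f(1)]
  show ?thesis by (rule DGA_symplectic_models[OF fin h i(1)]) (metis f(3) i(3))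
qed

lemma quasi_isomorphicI:
  "dga_isomorphic (DGA_complex br J) (DGA_symplectic br' \<omega>) \<Longrightarrow> quasi_isomorphic (DGA_complex br J) (DGA_symplectic br' \<omega>)"
  "dga_isomorphic (DGA_symplectic br' \<omega>) (DGA_complex br J) \<Longrightarrow> quasi_isomorphic (DGA_symplectic br' \<omega>) (DGA_complex br J)"
  "dga_isomorphic (DGA_symplectic br' \<omega>) (DGA_symplectic br'' \<omega>') \<Longrightarrow> quasi_isomorphic (DGA_symplectic br' \<omega>) (DGA_symplectic br'' \<omega>')"
  "dga_isomorphic (DGA_complex br J) (DGA_complex br''' J') \<Longrightarrow> quasi_isomorphic (DGA_complex br J) (DGA_complex br''' J')"
  unfolding DGA_complex_def DGA_symplectic_def
  by (intro quasi_isomorphic_if_isomorphic additive_complex_exterior_dga; assumption)+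

section \<open>A structure and its mirror side by side\<close>

locale mirror_models =
  fixes br :: "'g::real_vector \<Rightarrow> 'g \<Rightarrow> 'g" and \<rho> :: "'g \<Rightarrow> 'v::real_vector \<Rightarrow> 'v" and J \<omega>
    and j :: "'g \<Rightarrow> 'v" and m m' B
  assumes fin: "finite_dimensional TYPE('g)" and mod: "modelled_by br \<rho> J \<omega> j m B"
    and h': "hessian_structure br m' B" and dual: "dual_product m m' B"
begin

abbreviation "\<hh> \<equiv> semidirect br \<rho>"
abbreviation "\<hh>v \<equiv> semidirect br (dual_rep \<rho>)"
abbreviation "Jv \<equiv> mirror_J \<omega>"
abbreviation "\<omega>v \<equiv> mirror_omega J"

lemma h: "hessian_structure br m B"
  using mod by (simp add: modelled_by_def)

lemma mod': "modelled_by br (dual_rep \<rho>) Jv \<omega>v (omega_iso \<omega>) m' B"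
  by (rule modelled_by_mirror[OF fin mod h' dual])

lemma special_lagrangian_mirror: "special_lagrangian br (dual_rep \<rho>) Jv \<omega>v"
  by (rule special_lagrangian_if_modelled_by[OF mod'])

lemma complex_iso:
  "dga_isomorphic (DGA_complex \<hh> J) (DGA_symplectic (semidirect br m') (model_omega B))"
  "dga_isomorphic (DGA_complex \<hh>v Jv) (DGA_symplectic (semidirect br m) (model_omega B))"
  by (rule DGA_complex_modelled_by[OF fin mod h' dual])
    (rule DGA_complex_modelled_by[OF fin mod' h dual_product_sym[OF h dual]])

lemma symplectic_iso:
  "dga_isomorphic (DGA_symplectic (semidirect br m) (model_omega B)) (DGA_symplectic \<hh> \<omega>)"
  "dga_isomorphic (DGA_symplectic (semidirect br m') (model_omega B)) (DGA_symplectic \<hh>v \<omega>v)"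
  by (rule DGA_symplectic_modelled_by[OF fin mod]) (rule DGA_symplectic_modelled_by[OF fin mod'])

lemma weak_mirror_pairs: "weak_mirror_pair \<hh> J \<hh>v \<omega>v" "weak_mirror_pair \<hh>v Jv \<hh> \<omega>"
  unfolding weak_mirror_pair_def
  by (intro quasi_isomorphicI dga_isomorphic_trans[OF complex_iso(1) symplectic_iso(2)]
      dga_isomorphic_trans[OF complex_iso(2) symplectic_iso(1)])+

lemma isomorphic_model:
  "lie_isomorphic \<hh> (semidirect br m)" "lie_isomorphic \<hh>v (semidirect br m')"
  unfolding lie_isomorphic_def
  using modelled_by_equivalence[OF mod] modelled_by_equivalence[OF mod'] by blast+

text \<open>The algebras of (\<open>\<hh>\<close>, \<open>J\<close>) and (\<open>\<hh>v\<close>,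
  \<open>\<omega>v\<close>) are both the symplectic algebra of the model with \<open>m'\<close>, the
  other two that of the model with \<open>m\<close>; the assumed symplectomorphism identifies these
  two models.\<close>

lemma self_mirror:
  assumes "symplectomorphic_models br m m' B"
  shows "lie_isomorphic \<hh> \<hh>v" "quasi_isomorphic (DGA_symplectic \<hh>v \<omega>v) (DGA_symplectic \<hh> \<omega>)"
    "quasi_isomorphic (DGA_symplectic \<hh> \<omega>) (DGA_complex \<hh>v Jv)" "quasi_isomorphic (DGA_complex \<hh>v Jv) (DGA_complex \<hh> J)"
proof -
  obtain f where f: "lie_isomorphism (semidirect br m) (semidirect br m') f"
    "\<And>p q. model_omega B (f p) (f q) = model_omega B p q"
    using assms unfolding symplectomorphic_models_def by blast
  have "lie_isomorphic (semidirect br m) (semidirect br m')" using f(1) by (auto simp: lie_isomorphic_def)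
  then show "lie_isomorphic \<hh> \<hh>v"
    using isomorphic_model lie_isomorphic_sym lie_isomorphic_trans by metis
  have s: "dga_isomorphic (DGA_symplectic (semidirect br m) (model_omega B)) (DGA_symplectic (semidirect br m') (model_omega B))"
    by (rule DGA_symplectic_models[OF fin h f])
  note sym = dga_isomorphic_sym and trans = dga_isomorphic_trans
  show "quasi_isomorphic (DGA_symplectic \<hh>v \<omega>v) (DGA_symplectic \<hh> \<omega>)"
    by (intro quasi_isomorphicI trans[OF sym[OF symplectic_iso(2)] trans[OF sym[OF s] symplectic_iso(1)]])
  show "quasi_isomorphic (DGA_symplectic \<hh> \<omega>) (DGA_complex \<hh>v Jv)"
    by (intro quasi_isomorphicI trans[OF sym[OF symplectic_iso(1)] sym[OF complex_iso(2)]])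
  show "quasi_isomorphic (DGA_complex \<hh>v Jv) (DGA_complex \<hh> J)"
    by (intro quasi_isomorphicI trans[OF complex_iso(2) trans[OF s sym[OF complex_iso(1)]]])
qed

lemma not_equivalent:
  assumes "\<nexists>f. lie_isomorphism (semidirect br m) (semidirect br m') f \<and> (\<forall>p. f (model_J p) = model_J (f p))"
  shows "\<not> pseudo_kaehler_equivalent \<hh> J \<omega> \<hh>v Jv \<omega>v"
proof
  assume "pseudo_kaehler_equivalent \<hh> J \<omega> \<hh>v Jv \<omega>v"
  then obtain f where f: "lie_isomorphism \<hh> \<hh>v f" "\<And>p. f (J p) = Jv (f p)"
    by (auto simp: pseudo_kaehler_equivalent_def)
  obtain g where g: "lie_isomorphism \<hh> (semidirect br m) g" "\<forall>p. g (J p) = model_J (g p)"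
    "\<forall>p q. model_omega B (g p) (g q) = \<omega> p q" using modelled_by_equivalence[OF mod] by blast
  obtain g' where g': "lie_isomorphism \<hh>v (semidirect br m') g'" "\<forall>p. g' (Jv p) = model_J (g' p)"
    "\<forall>p q. model_omega B (g' p) (g' q) = \<omega>v p q" using modelled_by_equivalence[OF mod'] by blast
  note i = lie_isomorphism_inv[OF g(1)]
  have "inv g (model_J q) = J (inv g q)" for q using g(2)[rule_format, of "inv g q"] i(2,3) by metis
  then have "g' (f (inv g (model_J q))) = model_J (g' (f (inv g q)))" for q by (simp only: f(2) g'(2)[rule_format])
  moreover have "lie_isomorphism (semidirect br m) (semidirect br m') (\<lambda>q. g' (f (inv g q)))"
    by (rule lie_isomorphism_compose[OF lie_isomorphism_compose[OF i(1) f(1)] g'(1)])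
  ultimately show False using assms by blast
qed

end

lemma mirror_modelsI:
  fixes br :: "'g::real_vector \<Rightarrow> 'g \<Rightarrow> 'g" and \<rho> :: "'g \<Rightarrow> 'v::real_vector \<Rightarrow> 'v"
  assumes fin: "finite_dimensional TYPE('g)" and mod: "modelled_by br \<rho> J \<omega> j m B"
  obtains m' where "mirror_models br \<rho> J \<omega> j m m' B"
proof -
  have "hessian_structure br m B" using mod by (simp add: modelled_by_def)
  from dual_product_exists[OF fin this] obtain m' where "hessian_structure br m' B" "dual_product m m' B" by blast
  then show ?thesis using that fin mod by (simp add: mirror_models_def)
qed

lemma mirror_theorem:
  fixes br :: "'g::real_vector \<Rightarrow> 'g \<Rightarrow> 'g" and \<rho> :: "'g \<Rightarrow> 'v::real_vector \<Rightarrow> 'v"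
  assumes dim: "dim (UNIV :: ('g \<times> 'v) set) = 6" and nil: "nilpotent_lie (semidirect br \<rho>)"
    and sl: "special_lagrangian br \<rho> J \<omega>"
  obtains j m m' B where "mirror_models br \<rho> J \<omega> j m m' B" "mirror_classification br m m' B"
proof -
  obtain j m B where mod: "modelled_by br \<rho> J \<omega> j m B" using modelled_by_if_special_lagrangian[OF sl] by blast
  then have j: "linear j" "bij j" by (auto simp: modelled_by_def)
  obtain S :: "'g set" where S: "finite S" "independent S" "span S = UNIV" "card S = 3"
    using basis_of_half[OF j dim] by blast
  have fin: "finite_dimensional TYPE('g)" using S by (auto simp: finite_dimensional_def)
  obtain m' where mm: "mirror_models br \<rho> J \<omega> j m m' B" using mirror_modelsI[OF fin mod] by blast
  then interpret mirror_models br \<rho> J \<omega> j m m' B .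
  obtain n where "left_powers m n \<subseteq> {0}" using nilpotent_left_powers[OF mod nil] by blast
  from mirror_classification_if_nilpotent[OF h h' dual this S] mm show ?thesis by (rule that[rotated])
qed

text \<open>The witness is the normal form with \<open>a = c = 1\<close> and \<open>k = b = 0\<close>.\<close>

lemma exists_mirror_pair_7_4:
  "\<exists>(br :: real^3 \<Rightarrow> real^3 \<Rightarrow> real^3) (\<rho> :: real^3 \<Rightarrow> real^3 \<Rightarrow> real^3) J \<omega>.
       special_lagrangian br \<rho> J \<omega> \<and>
       lie_isomorphic (semidirect br \<rho>) \<hh>\<^sub>7 \<and>
       special_lagrangian br (dual_rep \<rho>) (mirror_J \<omega>) (mirror_omega J) \<and>
       lie_isomorphic (semidirect br (dual_rep \<rho>)) \<hh>\<^sub>4"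
proof -
  define m :: "real^3 \<Rightarrow> real^3 \<Rightarrow> real^3" where "m x y = vector [0, x $ 1 * y $ 1, x $ 2 * y $ 1]" for x y
  \<comment> \<open>The coefficient 2 is forced by
    \<open>(2 * c - b) * B v1 v3 = a * B v2 v2\<close>.\<close>
  define B :: "real^3 \<Rightarrow> real^3 \<Rightarrow> real" where "B x y = x $ 1 * y $ 3 + x $ 3 * y $ 1 + 2 * x $ 2 * y $ 2" for x y
  define br where "br x y = m x y - m y x" for x y
  have bm: "bilinear m" unfolding bilinear_def m_def
    by (auto intro!: linearI simp: vec_eq_iff forall_3 algebra_simps)
  have bB: "bilinear B" unfolding bilinear_def B_def
    by (auto intro!: linearI simp: algebra_simps)
  let ?v1 = "axis 1 1 :: real^3" and ?v2 = "axis 2 1 :: real^3" and ?v3 = "axis 3 1 :: real^3"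
  have ax: "axis i (1 :: real) $ k = (if i = k then 1 else 0)" for i k :: 3 by (simp add: axis_def)
  have h: "hessian_structure br m B"
    unfolding hessian_structure_def
  proof (intro conjI allI impI bm bB)
    fix x y z
    show "B x y = B y x" by (simp add: B_def)
    show "br x y = m x y - m y x" by (simp add: br_def)
    show "m (br x y) z = m x (m y z) - m y (m x z)" by (simp add: br_def m_def vec_eq_iff forall_3 algebra_simps)
    show "B (br x y) z = B x (m y z) - B y (m x z)" by (simp add: br_def m_def B_def algebra_simps)
  next
    fix x assume "\<forall>y. B x y = 0"
    then have "B x ?v1 = 0" "B x ?v2 = 0" "B x ?v3 = 0" by auto
    then show "x = 0" by (simp add: B_def ax vec_eq_iff forall_3)
  qed
  define J :: "(real^3) \<times> (real^3) \<Rightarrow> (real^3) \<times> (real^3)" where "J = model_J"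
  have mod: "modelled_by br m J (model_omega B) (\<lambda>x. x) m B"
    unfolding modelled_by_def J_def using h bij_id by (simp add: linear_ident id_def)
  have "finite_dimensional TYPE(real^3)"
    unfolding finite_dimensional_def by (rule exI[of _ Basis]) simp
  from mirror_modelsI[OF this mod] obtain m' where "mirror_models br m J (model_omega B) (\<lambda>x. x) m m' B" by blast
  then interpret mirror_models br m J "model_omega B" "\<lambda>x. x" m m' B .
  have "frame ?v1 ?v2 ?v3"
  proof (rule frameI)
    fix x y z :: real assume "x *\<^sub>R ?v1 + y *\<^sub>R ?v2 + z *\<^sub>R ?v3 = 0"
    then show "x = 0 \<and> y = 0 \<and> z = 0" by (simp add: vec_eq_iff forall_3 ax)
  next
    fix v :: "real^3"
    have "v = v $ 1 *\<^sub>R ?v1 + v $ 2 *\<^sub>R ?v2 + v $ 3 *\<^sub>R ?v3" by (simp add: vec_eq_iff forall_3 ax)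
    then show "\<exists>x y z. v = x *\<^sub>R ?v1 + y *\<^sub>R ?v2 + z *\<^sub>R ?v3" by blast
  qed
  moreover have "product_table m ?v1 ?v2 ?v3 1 0 0 1 0"
    by (simp add: product_table_def m_def ax vec_eq_iff forall_3)
  ultimately have nf: "normal_form m B ?v1 ?v2 ?v3 1 0 0 1"
    by (simp add: normal_form_def B_def ax)
  then obtain \<alpha> \<kappa> where "product_table m' ?v1 ?v2 ?v3 \<alpha> \<kappa> (0 - 2 * 1) (- 1) 0" and \<alpha>: "\<alpha> * B ?v2 ?v2 = - 0 * B ?v1 ?v3"
    using normal_form_dual[OF nf h h' dual] by metis
  moreover have "\<alpha> = 0" using \<alpha> by (simp add: B_def ax)
  ultimately have tab': "product_table m' ?v1 ?v2 ?v3 0 \<kappa> (2 * (- 1)) (- 1) 0" by simp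
  have "bilinear m'" and br': "\<And>x y. br x y = m' x y - m' y x" by (rule hessian_structureD[OF h'])+
  have "lie_isomorphic (semidirect br m) \<hh>\<^sub>7"
    using nf unfolding normal_form_def by (intro std_isomorphic[OF bm br_def _ _ std_isomorphic_h7]) auto
  moreover have "lie_isomorphic (semidirect br m') \<hh>\<^sub>4"
    using nf unfolding normal_form_def
    by (intro std_isomorphic[OF \<open>bilinear m'\<close> br' _ tab' std_isomorphic_h4]) auto
  ultimately have "lie_isomorphic (semidirect br m) \<hh>\<^sub>7" "lie_isomorphic \<hh>v \<hh>\<^sub>4"
    using isomorphic_model lie_isomorphic_trans by metis+
  then show ?thesis
    using special_lagrangian_if_modelled_by[OF mod] special_lagrangian_mirror by blast
qed

theorem theorem5p1:
  shows
   "(\<forall>(br :: 'g::real_vector \<Rightarrow> 'g \<Rightarrow> 'g) (\<rho> :: 'g \<Rightarrow> 'v::real_vector \<Rightarrow> 'v) J \<omega>.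
       let \<hh> = semidirect br \<rho>;
           \<hh>v = semidirect br (dual_rep \<rho>);
           Jv = mirror_J \<omega>;
           \<omega>v = mirror_omega J
       in
       dim (UNIV :: ('g \<times> 'v) set) = 6 \<longrightarrow> nilpotent_lie \<hh> \<longrightarrow> special_lagrangian br \<rho> J \<omega> \<longrightarrow>
         (\<exists>\<kk>\<in>{\<hh>\<^sub>1, \<hh>\<^sub>4, \<hh>\<^sub>7, \<hh>\<^sub>8, \<hh>\<^sub>9, \<hh>\<^sub>1\<^sub>0, \<hh>\<^sub>1\<^sub>1}. lie_isomorphic \<hh> \<kk>) \<and>
         special_lagrangian br (dual_rep \<rho>) Jv \<omega>v \<and>
         weak_mirror_pair \<hh> J \<hh>v \<omega>v \<and>
         (\<forall>(\<kk>, \<kk>v)\<in>{(\<hh>\<^sub>1, \<hh>\<^sub>1), (\<hh>\<^sub>4, \<hh>\<^sub>7), (\<hh>\<^sub>7, \<hh>\<^sub>4), (\<hh>\<^sub>8, \<hh>\<^sub>8), (\<hh>\<^sub>9, \<hh>\<^sub>9), (\<hh>\<^sub>1\<^sub>0, \<hh>\<^sub>1\<^sub>0), (\<hh>\<^sub>1\<^sub>1, \<hh>\<^sub>1\<^sub>1)}.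
            lie_isomorphic \<hh> \<kk> \<longrightarrow> lie_isomorphic \<hh>v \<kk>v) \<and>
         (\<forall>\<kk>\<in>{\<hh>\<^sub>1, \<hh>\<^sub>8, \<hh>\<^sub>9, \<hh>\<^sub>1\<^sub>0}. lie_isomorphic \<hh> \<kk> \<longrightarrow>
            lie_isomorphic \<hh> \<hh>v \<and>
            DGA_symplectic \<hh>v \<omega>v \<approx> DGA_symplectic \<hh> \<omega> \<and>
            DGA_symplectic \<hh> \<omega> \<approx> DGA_complex \<hh>v Jv \<and>
            DGA_complex \<hh>v Jv \<approx> DGA_complex \<hh> J) \<and>
         (\<forall>(\<kk>, \<kk>v)\<in>{(\<hh>\<^sub>7, \<hh>\<^sub>4), (\<hh>\<^sub>4, \<hh>\<^sub>7)}. lie_isomorphic \<hh> \<kk> \<longrightarrow>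
            lie_isomorphic \<hh>v \<kk>v \<and> special_lagrangian br (dual_rep \<rho>) Jv \<omega>v \<and>
            weak_mirror_pair \<hh> J \<hh>v \<omega>v \<and> weak_mirror_pair \<hh>v Jv \<hh> \<omega>) \<and>
         (lie_isomorphic \<hh> \<hh>\<^sub>1\<^sub>1 \<longrightarrow>
            lie_isomorphic \<hh>v \<hh>\<^sub>1\<^sub>1 \<and> special_lagrangian br (dual_rep \<rho>) Jv \<omega>v \<and>
            \<not> pseudo_kaehler_equivalent \<hh> J \<omega> \<hh>v Jv \<omega>v)) \<and>
    (\<exists>(br :: real^3 \<Rightarrow> real^3 \<Rightarrow> real^3) (\<rho> :: real^3 \<Rightarrow> real^3 \<Rightarrow> real^3) J \<omega>.
       special_lagrangian br \<rho> J \<omega> \<and>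
       lie_isomorphic (semidirect br \<rho>) \<hh>\<^sub>7 \<and>
       special_lagrangian br (dual_rep \<rho>) (mirror_J \<omega>) (mirror_omega J) \<and>
       lie_isomorphic (semidirect br (dual_rep \<rho>)) \<hh>\<^sub>4)"
proof (rule conjI[OF _ exists_mirror_pair_7_4], intro allI, unfold Let_def, intro impI, goal_cases)
  case (1 br \<rho> J \<omega>)
  obtain j m m' B where "mirror_models br \<rho> J \<omega> j m m' B" and cl: "mirror_classification br m m' B"
    by (rule mirror_theorem[OF 1])
  then interpret mirror_models br \<rho> J \<omega> j m m' B by simp
  let ?L = "{\<hh>\<^sub>1, \<hh>\<^sub>4, \<hh>\<^sub>7, \<hh>\<^sub>8, \<hh>\<^sub>9, \<hh>\<^sub>1\<^sub>0, \<hh>\<^sub>1\<^sub>1}"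
  have iso: "lie_isomorphic \<hh> \<kk> \<longleftrightarrow> lie_isomorphic (semidirect br m) \<kk>"
    "lie_isomorphic \<hh>v \<kk> \<longleftrightarrow> lie_isomorphic (semidirect br m') \<kk>" for \<kk> :: "real^6 \<Rightarrow> real^6 \<Rightarrow> real^6"
    using isomorphic_model lie_isomorphic_sym lie_isomorphic_trans by metis+
  \<comment> \<open>Turns every hypothesis on the isomorphism type of \<open>\<hh>\<close> into an
    equation between the listed algebras, which \<open>ne\<close> then decides.\<close>
  have only: "lie_isomorphic \<hh> \<kk> \<longleftrightarrow> \<kk> = \<kk>0" if "lie_isomorphic \<hh> \<kk>0" "\<kk>0 \<in> ?L" "\<kk> \<in> ?L" for \<kk> \<kk>0
    using isomorphic_unique[OF _ that(1,3,2)] that(1) by blast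
  \<comment> \<open>The reversed list supplies each inequality in the other orientation.\<close>
  have "distinct [\<hh>\<^sub>1\<^sub>1, \<hh>\<^sub>1\<^sub>0, \<hh>\<^sub>9, \<hh>\<^sub>8, \<hh>\<^sub>7, \<hh>\<^sub>4, \<hh>\<^sub>1]"
    using nilpotent_distinct by auto
  note ne = this[simplified] nilpotent_distinct[simplified]
  note facts = special_lagrangian_mirror weak_mirror_pairs
  from cl consider \<kk> where "\<kk> \<in> {\<hh>\<^sub>1, \<hh>\<^sub>8, \<hh>\<^sub>9, \<hh>\<^sub>1\<^sub>0}" "lie_isomorphic \<hh> \<kk>" "symplectomorphic_models br m m' B"
    | "lie_isomorphic \<hh> \<hh>\<^sub>4" "lie_isomorphic \<hh>v \<hh>\<^sub>7" | "lie_isomorphic \<hh> \<hh>\<^sub>7" "lie_isomorphic \<hh>v \<hh>\<^sub>4"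
    | "lie_isomorphic \<hh> \<hh>\<^sub>1\<^sub>1" "lie_isomorphic \<hh>v \<hh>\<^sub>1\<^sub>1" "\<not> pseudo_kaehler_equivalent \<hh> J \<omega> \<hh>v Jv \<omega>v"
    using not_equivalent unfolding mirror_classification_def iso by blast
  then show ?case
  proof cases
    case (1 \<kk>)
    have v: "lie_isomorphic \<hh>v \<kk>"
      using self_mirror(1)[OF 1(3)] 1(2) lie_isomorphic_sym lie_isomorphic_trans by metis
    have o: "lie_isomorphic \<hh> \<kk>' \<longleftrightarrow> \<kk>' = \<kk>" if "\<kk>' \<in> ?L" for \<kk>'
      by (rule only[OF 1(2) _ that]) (use 1(1) in blast)
    show ?thesis
      using 1(1) v facts self_mirror[OF 1(3)] by (elim insertE emptyE) (simp_all add: o ne)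
  next
    case 2
    then show ?thesis using facts by (simp add: only[OF 2(1)] ne)
  next
    case 3
    then show ?thesis using facts by (simp add: only[OF 3(1)] ne)
  next
    case 4
    then show ?thesis using facts by (simp add: only[OF 4(1)] ne)
  qed
qed

end
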